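(* Fix nonnegative rational numbers $\varepsilon,\delta$, positive integers $I,J$, nonnegative integers $M_1,\dots,M_I$ and $N_1\ge N_2\ge\dots\ge N_J$, and a constant $C>0$. Assume $(\varepsilon,\delta)$ is nondegenerate: $\nu\varepsilon+2-\frac{l}{[\delta]+1}\delta\ne0$ for all integers $0\le\nu\le\max_iM_i$ and $0\le l\le([\delta]+1)\max_jN_j$. Let $$\mathcal{B}=\{b=(b'_{i,\mu},b''_{j,\nu}):1\le i\le I,\,1\le j\le J,\,0\le\mu\le M_i,\,0\le\nu\le N_j,\ b'_{i,\mu},b''_{j,\nu}\in\mathbb{C},\ b'_{i,\mu}\ne0\text{ for some }i,\mu\}\subseteq\mathbb{C}^a,$$ and for $b\in\mathcal{B}$ let $P_i(b;Z)=\sum_{\mu=0}^{M_i}b'_{i,\mu}Z^\mu$, $Q_j(b;Z)=\sum_{\nu=0}^{N_j}b''_{j,\nu}Z^\nu$, and $$R_b(z)=\frac{\big(\sum_{i=1}^I|P_i(b;z)|^2\big)^{\varepsilon/2}}{\big(\sum_{j=1}^J|Q_j(b;z)|^2\big)^{\delta/2}}.$$ Then there exist $s\in(0,1)$, a finite chain $\mathcal{B}=U_0\supset U_1\supset\dots\supset U_{\mathcal N}=\emptyset$ of subsets of $\mathcal{B}$, each the intersection of $\mathcal{B}$ with an algebraic variety in $\mathbb{C}^a$, and ARPs $T_\lambda=K_\lambda/L_\lambda\in\mathbb{Z}|(B'_{i,\mu},B''_{j,\nu})|$, $0\le\lambda\le\mathcal N-1$, such that: 1. for $b\in U_\lambda\setminus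 U_{\lambda+1}$, $K_\lambda(b)\ne0$ (so $T_\lambda$ is defined and nowhere vanishing on $U_\lambda\setminus U_{\lambda+1}$, with values in $(0,\infty]$); 2. for every $b\in U_\lambda\setminus U_{\lambda+1}$ satisfying $|||Q_1(b;Z)-Z^{N_1}|||<s$ and $|||Q_j(b;Z)|||<C$ for $j>1$, one has $\int_BR_b(z)\,dV\sim T_\lambda(b)$, where $B$ is the unit disk and the implied constants depend only on $I,J,M_i,N_j,\varepsilon,\delta,C$ (in particular the integral is infinite iff $L_\lambda(b)=0$); 3. $U_{\lambda+1}=\{b\in U_\lambda:K_\lambda(b)=0\}=\{b\in U_\lambda:K_\lambda(b)=0\text{ and }L_\lambda(b)=0\}$.
   Context: An absolute rational power (ARP) in variables $X=(X_1,\dots,X_m)$ with coefficients in a subring $A\subseteq\mathbb{C}$ is an expression $R(X)=K(X)/L(X)$ with $K(X)=(\sum_{i}|P_i(X)|^2)^{\varepsilon/2}$, $L(X)=(\sum_j|Q_j(X)|^2)^{\delta/2}$, where the $P_i,Q_j\in A[X]$ are finitely many polynomials, not all $P_i$ zero, and $\varepsilon,\delta$ are nonnegative rationals; $K$ and $L$ are called absolute polynomial powers. The set of such is denoted $A|(X)|$. Its domain is the complement of $\{K=0\}$ (where it takes values in $(0,\infty]$); its strict domain is the complement of $\{K=0\}\cup\{L=0\}$. For a polynomial $Q(Z)=\sum_{\mu=0}^Mb_\mu Z^\mu$, $|||Q|||=\sum_{\mu}|b_\mu|$. $dV$ is Lebesgue measure on $\mathbb{C}$; $[\delta]$ is the integer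 part of $\delta$. *)

theory Defs
  imports "HOL-Analysis.Analysis"
begin

inductive_set polyfun :: "'a::comm_ring_1 set \<Rightarrow> 'v set \<Rightarrow> (('v \<Rightarrow> 'a) \<Rightarrow> 'a) set"
  for A :: "'a set" and V :: "'v set" where
  const: "c \<in> A \<Longrightarrow> (\<lambda>x. c) \<in> polyfun A V"
| var: "v \<in> V \<Longrightarrow> (\<lambda>x. x v) \<in> polyfun A V"
| add: "p \<in> polyfun A V \<Longrightarrow> q \<in> polyfun A V \<Longrightarrow> (\<lambda>x. p x + q x) \<in> polyfun A V"
| mult: "p \<in> polyfun A V \<Longrightarrow> q \<in> polyfun A V \<Longrightarrow> (\<lambda>x. p x * q x) \<in> polyfun A V"

definition is_variety :: "'v set \<Rightarrow> ('v \<Rightarrow> complex) set \<Rightarrow> bool" where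
  "is_variety V S \<longleftrightarrow> (\<exists>ps. set ps \<subseteq> polyfun UNIV V \<and> S = {x. \<forall>p\<in>set ps. p x = 0})"

text \<open>S^(e/2) with the convention S^0 = 1 (also for S = 0).\<close>
definition apow :: "real \<Rightarrow> rat \<Rightarrow> real" where
  "apow S e = (if e = 0 then 1 else S powr (real_of_rat e / 2))"

definition abs_poly_power :: "(('v \<Rightarrow> complex) \<Rightarrow> complex) list \<Rightarrow> rat \<Rightarrow> ('v \<Rightarrow> complex) \<Rightarrow> real" where
  "abs_poly_power Ps e x = apow (\<Sum>p\<leftarrow>Ps. (cmod (p x))\<^sup>2) e"

type_synonym 'v arp = "(('v \<Rightarrow> complex) \<Rightarrow> complex) list \<times> rat \<times> (('v \<Rightarrow> complex) \<Rightarrow> complex) list \<times> rat"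

definition is_ARP :: "complex set \<Rightarrow> 'v set \<Rightarrow> 'v arp \<Rightarrow> bool" where
  "is_ARP A V T = (case T of (Ps, e, Qs, d) \<Rightarrow>
      set Ps \<subseteq> polyfun A V \<and> set Qs \<subseteq> polyfun A V \<and> (\<exists>p\<in>set Ps. p \<noteq> (\<lambda>_. 0))
      \<and> e \<ge> 0 \<and> d \<ge> 0)"

definition arpK :: "'v arp \<Rightarrow> ('v \<Rightarrow> complex) \<Rightarrow> real" where
  "arpK T x = (case T of (Ps, e, Qs, d) \<Rightarrow> abs_poly_power Ps e x)"

definition arpL :: "'v arp \<Rightarrow> ('v \<Rightarrow> complex) \<Rightarrow> real" where
  "arpL T x = (case T of (Ps, e, Qs, d) \<Rightarrow> abs_poly_power Qs d x)"

text \<open>Value K/L in [0,\<infinity>] (K/0 = \<infinity> for K > 0).\<close>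
definition arp_val :: "'v arp \<Rightarrow> ('v \<Rightarrow> complex) \<Rightarrow> ennreal" where
  "arp_val T x = ennreal (arpK T x) / ennreal (arpL T x)"

text \<open>Coordinates of b: b'_{i,mu} = b (Inl (i,mu)), b''_{j,nu} = b (Inr (j,nu)).\<close>
type_synonym coord = "(nat \<times> nat) + (nat \<times> nat)"

definition coords :: "nat \<Rightarrow> nat \<Rightarrow> (nat \<Rightarrow> nat) \<Rightarrow> (nat \<Rightarrow> nat) \<Rightarrow> coord set" where
  "coords I J M N = {Inl (i, \<mu>) | i \<mu>. 1 \<le> i \<and> i \<le> I \<and> \<mu> \<le> M i}
                  \<union> {Inr (j, \<nu>) | j \<nu>. 1 \<le> j \<and> j \<le> J \<and> \<nu> \<le> N j}"

text \<open>The parameter set \<B> (points of C^a, encoded as functions vanishing off the coordinates).\<close>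
definition paramB :: "nat \<Rightarrow> nat \<Rightarrow> (nat \<Rightarrow> nat) \<Rightarrow> (nat \<Rightarrow> nat) \<Rightarrow> (coord \<Rightarrow> complex) set" where
  "paramB I J M N = {b. (\<forall>v. v \<notin> coords I J M N \<longrightarrow> b v = 0)
       \<and> (\<exists>i \<mu>. 1 \<le> i \<and> i \<le> I \<and> \<mu> \<le> M i \<and> b (Inl (i, \<mu>)) \<noteq> 0)}"

definition Pb :: "(nat \<Rightarrow> nat) \<Rightarrow> (coord \<Rightarrow> complex) \<Rightarrow> nat \<Rightarrow> complex \<Rightarrow> complex" where
  "Pb M b i z = (\<Sum>\<mu>=0..M i. b (Inl (i, \<mu>)) * z ^ \<mu>)"

definition Qb :: "(nat \<Rightarrow> nat) \<Rightarrow> (coord \<Rightarrow> complex) \<Rightarrow> nat \<Rightarrow> complex \<Rightarrow> complex" where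
  "Qb N b j z = (\<Sum>\<nu>=0..N j. b (Inr (j, \<nu>)) * z ^ \<nu>)"

definition Rb :: "nat \<Rightarrow> nat \<Rightarrow> (nat \<Rightarrow> nat) \<Rightarrow> (nat \<Rightarrow> nat) \<Rightarrow> rat \<Rightarrow> rat
      \<Rightarrow> (coord \<Rightarrow> complex) \<Rightarrow> complex \<Rightarrow> ennreal" where
  "Rb I J M N \<epsilon> \<delta> b z =
     ennreal (apow (\<Sum>i=1..I. (cmod (Pb M b i z))\<^sup>2) \<epsilon>)
     / ennreal (apow (\<Sum>j=1..J. (cmod (Qb N b j z))\<^sup>2) \<delta>)"

end

theory Submission
  imports Defs "HOL-Computational_Algebra.Computational_Algebra"
begin

text \<open>
  Let \<open>F(b)\<close> be the integral. Replacing \<open>Q\<^sub>j\<close> by \<open>h Q\<^sub>1 + Q\<^sub>j\<close> with a large integer \<open>h\<close> makes all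
  denominators nearly multiples of \<open>Z\<^sup>N\<close>, so their roots lie well inside the disc. Call these
  roots, together with \<open>0\<close>, the centers. Near its closest center \<open>x\<close>, at distance \<open>r\<close>, the point
  \<open>z\<close> satisfies \<open>|Q(z)| ~ max\<^sub>l c\<^sub>l r\<^sup>l\<close>, where \<open>c\<^sub>l\<close> are the sizes of the Taylor coefficients at
  \<open>x\<close>; likewise \<open>|P|\<close> is at most, and on a large part of the disc at least, about \<open>max\<^sub>\<nu> d\<^sub>\<nu> r\<^sup>\<nu>\<close>.
  By nondegeneracy no exponent \<open>\<nu>\<epsilon> + 2 - l\<delta>\<close> vanishes, so the radial integral of \<open>r\<^sup>\<nu>\<^sup>\<epsilon> min\<^sub>l (c\<^sub>l
  r\<^sup>l)\<^sup>-\<^sup>\<delta>\<close> is comparable to the maximal value of \<open>r\<^sup>\<nu>\<^sup>\<epsilon>\<^sup>+\<^sup>2 min\<^sub>l (c\<^sub>l r\<^sup>l)\<^sup>-\<^sup>\<delta>\<close>. This value is \<open>1 / D\<^sub>\<nu>\<close>,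
  where \<open>D\<^sub>\<nu>\<close> is the maximum of \<open>c\<^sub>l\<^sup>\<xi> c\<^sub>m\<^sup>\<eta>\<close> over \<open>l\<delta> < \<nu>\<epsilon> + 2 < m\<delta>\<close> with positive rational
  exponents determined by \<open>\<xi> + \<eta> = \<delta>\<close> and \<open>l\<xi> + m\<eta> = \<nu>\<epsilon> + 2\<close>. Hence \<open>F\<close> is comparable to the sum
  of all \<open>d\<^sub>\<nu>\<^sup>\<epsilon> / D\<^sub>\<nu>\<close> over centers and \<open>\<nu>\<close>.

  A sum of such quotients is brought over common denominators in finitely many strata, which
  separate the vanishing patterns of numerators and denominators. The roots are then eliminated
  by summing over all their arrangements: the largest of \<open>n\<close> numbers is comparable to the
  largest \<open>|p\<^sub>r|\<^sup>1\<^sup>/\<^sup>r\<close> over their power sums \<open>p\<^sub>1, \<dots>, p\<^sub>n\<close>, and power sums over arrangements of roots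
  are polynomials in the coefficients by Newton's identities.
\<close>

section \<open>Absolute polynomial powers up to comparability\<close>

text \<open>The centers are not polynomial in \<open>b\<close>; uniformity is what lets them be
  eliminated. The combinations \<open>h Q_1 + Q_j\<close> all have degree exactly \<open>N\<close>
  and leading coefficients between two positive constants. So their product has a fixed number of
  roots, and the powers of its leading coefficient that enter through Newton's identities are
  comparable to 1. The same combinations control every \<open>Q_j\<close>: for \<open>j = 1\<close>
  one gets \<open>(h + 1) Q_1\<close>, and \<open>Q_j\<close> is then recovered by subtraction. A
  second obstacle is that quotients may be infinite or \<open>0 / 0\<close>. Values are therefore
  described by lists of pairs, where the first pair other than \<open>(0, 0)\<close> is the valid
  one. Such lists can be added. They can also be averaged over arrangements of roots, because a
  mediant of quotients comparable to one value is comparable to that value. Finally, numerators must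
  be positive on their strata. For this the norm of the coefficients of \<open>P\<close>, to the
  power \<epsilon>, is added to every quotient; up to a constant it is bounded by the
  integral.\<close>

lemma polyfun_minus:
  assumes "p \<in> polyfun \<int> V" "q \<in> polyfun \<int> V"
  shows "(\<lambda>x. p x - q x :: complex) \<in> polyfun \<int> V"
proof -
  have "(\<lambda>x. p x + (-1) * q x) \<in> polyfun \<int> V"
    by (intro polyfun.intros assms) simp
  then show ?thesis by simp
qed

lemma polyfun_power:
  assumes "p \<in> polyfun \<int> V"
  shows "(\<lambda>x. p x ^ n :: complex) \<in> polyfun \<int> V"
  by (induction n) (auto intro: polyfun.intros assms)

lemma polyfun_sum:
  assumes "\<And>i. i \<in> S \<Longrightarrow> p i \<in> polyfun \<int> V"
  shows "(\<lambda>x. \<Sum>i\<in>S. p i x :: complex) \<in> polyfun \<int> V"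
  using assms by (induction S rule: infinite_finite_induct) (auto intro: polyfun.intros)

lemma polyfun_mono:
  assumes "p \<in> polyfun A V" "A \<subseteq> B" "V \<subseteq> W"
  shows "p \<in> polyfun B W"
  using assms(1) by induction (use assms in \<open>auto intro: polyfun.intros\<close>)

lemma polyfun_cong:
  assumes "p \<in> polyfun A V" "\<And>v. v \<in> V \<Longrightarrow> x v = y v"
  shows "p x = p y"
  using assms(1) by induction (use assms in auto)

lemma polyfun_reindex:
  assumes "p \<in> polyfun A V" "\<And>v. v \<in> V \<Longrightarrow> (\<lambda>x. h x v) \<in> polyfun A W"
  shows "(\<lambda>x. p (h x)) \<in> polyfun A W"
  using assms(1) by induction (use assms in \<open>auto intro: polyfun.intros\<close>)

section \<open>Sums of squared moduli of integer polynomials\<close>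

definition is_sos :: "'v set \<Rightarrow> (('v \<Rightarrow> complex) \<Rightarrow> real) \<Rightarrow> bool" where
  "is_sos V f \<longleftrightarrow> (\<exists>ps. set ps \<subseteq> polyfun \<int> V \<and> f = (\<lambda>x. \<Sum>p\<leftarrow>ps. (cmod (p x))\<^sup>2))"

lemma is_sos_nonneg: "is_sos V f \<Longrightarrow> 0 \<le> f x"
  by (auto simp: is_sos_def intro!: sum_list_nonneg)

lemma is_sos_0: "is_sos V (\<lambda>x. 0)"
  unfolding is_sos_def by (intro exI[of _ "[]"]) auto

lemma is_sos_poly: "p \<in> polyfun \<int> V \<Longrightarrow> is_sos V (\<lambda>x. (cmod (p x))\<^sup>2)"
  unfolding is_sos_def by (intro exI[of _ "[p]"]) auto

lemma is_sos_add: "is_sos V f \<Longrightarrow> is_sos V g \<Longrightarrow> is_sos V (\<lambda>x. f x + g x)"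
  unfolding is_sos_def
proof (elim exE conjE)
  fix ps qs
  assume "set ps \<subseteq> polyfun \<int> V" "f = (\<lambda>x. \<Sum>p\<leftarrow>ps. (cmod (p x))\<^sup>2)"
     "set qs \<subseteq> polyfun \<int> V" "g = (\<lambda>x. \<Sum>p\<leftarrow>qs. (cmod (p x))\<^sup>2)"
  then show "\<exists>rs. set rs \<subseteq> polyfun \<int> V \<and> (\<lambda>x. f x + g x) = (\<lambda>x. \<Sum>p\<leftarrow>rs. (cmod (p x))\<^sup>2)"
    by (intro exI[of _ "ps @ qs"]) auto
qed

text \<open>Products stay in the class because \<open>|p|^2 |q|^2 = |p q|^2\<close> holds term by
  term.\<close>

lemma is_sos_mult:
  assumes "is_sos V f" "is_sos V g"
  shows "is_sos V (\<lambda>x. f x * g x)"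
proof -
  obtain ps where ps: "set ps \<subseteq> polyfun \<int> V" "f = (\<lambda>x. \<Sum>p\<leftarrow>ps. (cmod (p x))\<^sup>2)"
    using assms(1) by (auto simp: is_sos_def)
  obtain qs where qs: "set qs \<subseteq> polyfun \<int> V" "g = (\<lambda>x. \<Sum>p\<leftarrow>qs. (cmod (p x))\<^sup>2)"
    using assms(2) by (auto simp: is_sos_def)
  have *: "is_sos V (\<lambda>x. (cmod (p x))\<^sup>2 * (\<Sum>q\<leftarrow>qs. (cmod (q x))\<^sup>2))" if p: "p \<in> polyfun \<int> V" for p
    using qs(1)
  proof (induction qs)
    case (Cons q qs)
    have "is_sos V (\<lambda>x. (cmod (p x * q x))\<^sup>2)"
      using p Cons.prems by (intro is_sos_poly polyfun.intros) auto
    from is_sos_add[OF this Cons.IH] Cons.prems show ?case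
      by (simp add: algebra_simps norm_mult power_mult_distrib)
  qed (simp add: is_sos_0)
  have "is_sos V (\<lambda>x. (\<Sum>p\<leftarrow>ps. (cmod (p x))\<^sup>2) * (\<Sum>q\<leftarrow>qs. (cmod (q x))\<^sup>2))"
    using ps(1)
  proof (induction ps)
    case (Cons p ps)
    from is_sos_add[OF *[of p] Cons.IH] Cons.prems show ?case
      by (simp add: algebra_simps)
  qed (simp add: is_sos_0)
  then show ?thesis by (simp add: ps qs)
qed

lemma is_sos_power: "is_sos V f \<Longrightarrow> is_sos V (\<lambda>x. f x ^ n)"
proof (induction n)
  case 0
  have "is_sos V (\<lambda>x. (cmod 1)\<^sup>2)"
    by (rule is_sos_poly) (auto intro: polyfun.intros)
  then show ?case by simp
qed (simp add: is_sos_mult)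

section \<open>Comparability up to a constant factor\<close>

definition comp_on :: "'p set \<Rightarrow> ('p \<Rightarrow> real) \<Rightarrow> ('p \<Rightarrow> real) \<Rightarrow> bool" where
  "comp_on \<Omega> f g \<longleftrightarrow> (\<exists>C>0. \<forall>x\<in>\<Omega>. f x \<le> C * g x \<and> g x \<le> C * f x)"

lemma comp_on_refl: "comp_on \<Omega> f f"
  unfolding comp_on_def by (intro exI[of _ 1]) auto

lemma comp_on_sym: "comp_on \<Omega> f g \<Longrightarrow> comp_on \<Omega> g f"
  unfolding comp_on_def by blast

lemma comp_on_trans:
  assumes "comp_on \<Omega> f g" "comp_on \<Omega> g h"
  shows "comp_on \<Omega> f h"
proof -
  obtain C where C: "C > 0" "\<And>x. x \<in> \<Omega> \<Longrightarrow> f x \<le> C * g x \<and> g x \<le> C * f x"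
    using assms(1) by (auto simp: comp_on_def)
  obtain D where D: "D > 0" "\<And>x. x \<in> \<Omega> \<Longrightarrow> g x \<le> D * h x \<and> h x \<le> D * g x"
    using assms(2) by (auto simp: comp_on_def)
  show ?thesis unfolding comp_on_def
  proof (intro exI[of _ "C * D"] conjI ballI)
    fix x assume x: "x \<in> \<Omega>"
    have "C * g x \<le> C * (D * h x)" using C D x by simp
    then show "f x \<le> C * D * h x" using C(2)[OF x] by (simp add: mult.assoc)
    have "D * g x \<le> D * (C * f x)" using C D x by simp
    then show "h x \<le> C * D * f x" using D(2)[OF x] by (simp add: algebra_simps)
  qed (use C D in auto)
qed

text \<open>Signs are not built into \<open>comp_on\<close>; they pass from one side to the other
  through \<open>g \<le> C f\<close> with \<open>C > 0\<close>.\<close>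

lemma comp_on_nonneg:
  assumes "comp_on \<Omega> f g" "x \<in> \<Omega>" "0 \<le> g x"
  shows "0 \<le> f x"
proof -
  obtain C where "C > 0" "g x \<le> C * f x"
    using assms by (auto simp: comp_on_def)
  then have "0 \<le> C * f x" using assms(3) by linarith
  then show ?thesis using \<open>C > 0\<close> by (simp add: zero_le_mult_iff)
qed

lemma comp_on_add:
  assumes "comp_on \<Omega> f g" "comp_on \<Omega> f' g'"
    "\<And>x. x \<in> \<Omega> \<Longrightarrow> 0 \<le> g x" "\<And>x. x \<in> \<Omega> \<Longrightarrow> 0 \<le> g' x"
  shows "comp_on \<Omega> (\<lambda>x. f x + f' x) (\<lambda>x. g x + g' x)"
proof -
  obtain C where C: "C > 0" "\<And>x. x \<in> \<Omega> \<Longrightarrow> f x \<le> C * g x \<and> g x \<le> C * f x"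
    using assms(1) by (auto simp: comp_on_def)
  obtain D where D: "D > 0" "\<And>x. x \<in> \<Omega> \<Longrightarrow> f' x \<le> D * g' x \<and> g' x \<le> D * f' x"
    using assms(2) by (auto simp: comp_on_def)
  show ?thesis unfolding comp_on_def
  proof (intro exI[of _ "C + D"] conjI ballI)
    fix x assume x: "x \<in> \<Omega>"
    have nn: "0 \<le> f x" "0 \<le> f' x" "0 \<le> g x" "0 \<le> g' x"
      using comp_on_nonneg[OF assms(1) x] comp_on_nonneg[OF assms(2) x] assms(3,4) x by auto
    have p: "0 \<le> D * g x" "0 \<le> C * g' x" "0 \<le> D * f x" "0 \<le> C * f' x" 
      using C D nn by auto
    show "f x + f' x \<le> (C + D) * (g x + g' x)" "g x + g' x \<le> (C + D) * (f x + f' x)"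
      using C(2)[OF x] D(2)[OF x] p by (simp_all add: algebra_simps)
  qed (use C D in auto)
qed

lemma comp_on_mult:
  assumes "comp_on \<Omega> f g" "comp_on \<Omega> f' g'"
    "\<And>x. x \<in> \<Omega> \<Longrightarrow> 0 \<le> g x" "\<And>x. x \<in> \<Omega> \<Longrightarrow> 0 \<le> g' x"
  shows "comp_on \<Omega> (\<lambda>x. f x * f' x) (\<lambda>x. g x * g' x)"
proof -
  obtain C where C: "C > 0" "\<And>x. x \<in> \<Omega> \<Longrightarrow> f x \<le> C * g x \<and> g x \<le> C * f x"
    using assms(1) by (auto simp: comp_on_def)
  obtain D where D: "D > 0" "\<And>x. x \<in> \<Omega> \<Longrightarrow> f' x \<le> D * g' x \<and> g' x \<le> D * f' x"
    using assms(2) by (auto simp: comp_on_def)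
  show ?thesis unfolding comp_on_def
  proof (intro exI[of _ "C * D"] conjI ballI)
    fix x assume x: "x \<in> \<Omega>"
    have nn: "0 \<le> f x" "0 \<le> f' x" "0 \<le> g x" "0 \<le> g' x"
      using comp_on_nonneg[OF assms(1) x] comp_on_nonneg[OF assms(2) x] assms(3,4) x by auto
    have "f x * f' x \<le> (C * g x) * (D * g' x)" "g x * g' x \<le> (C * f x) * (D * f' x)"
      using C(2)[OF x] D(2)[OF x] nn C(1) D(1) by (auto intro!: mult_mono)
    then show "f x * f' x \<le> C * D * (g x * g' x)" "g x * g' x \<le> C * D * (f x * f' x)"
      by (simp_all add: algebra_simps)
  qed (use C D in auto)
qed

lemma comp_on_powr:
  assumes "comp_on \<Omega> f g" "\<And>x. x \<in> \<Omega> \<Longrightarrow> 0 \<le> g x" "0 \<le> a"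
  shows "comp_on \<Omega> (\<lambda>x. f x powr a) (\<lambda>x. g x powr a)"
proof -
  obtain C where C: "C > 0" "\<And>x. x \<in> \<Omega> \<Longrightarrow> f x \<le> C * g x \<and> g x \<le> C * f x"
    using assms(1) by (auto simp: comp_on_def)
  show ?thesis unfolding comp_on_def
  proof (intro exI[of _ "C powr a"] conjI ballI)
    fix x assume x: "x \<in> \<Omega>"
    have nn: "0 \<le> f x" "0 \<le> g x"
      using comp_on_nonneg[OF assms(1) x] assms(2) x by auto
    have "f x powr a \<le> (C * g x) powr a" "g x powr a \<le> (C * f x) powr a"
      using C(2)[OF x] nn assms(3) by (auto intro!: powr_mono2)
    then show "f x powr a \<le> C powr a * g x powr a" "g x powr a \<le> C powr a * f x powr a"
      using C nn by (simp_all add: powr_mult)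
  qed (use C in auto)
qed

lemma add_powr_le:
  fixes x y a :: real
  assumes "0 \<le> x" "0 \<le> y" "0 \<le> a"
  shows "(x + y) powr a \<le> 2 powr a * (x powr a + y powr a)"
    and "x powr a + y powr a \<le> 2 * (x + y) powr a"
proof -
  have "(x + y) powr a \<le> (2 * max x y) powr a"
    using assms by (intro powr_mono2) auto
  also have "\<dots> = 2 powr a * max x y powr a" using assms by (simp add: powr_mult)
  also have "max x y powr a \<le> x powr a + y powr a" by (auto simp: max_def)
  finally show "(x + y) powr a \<le> 2 powr a * (x powr a + y powr a)" by simp
  have "x powr a \<le> (x + y) powr a" "y powr a \<le> (x + y) powr a"
    using assms by (auto intro!: powr_mono2)
  then show "x powr a + y powr a \<le> 2 * (x + y) powr a" by simp
qed

lemma comp_on_add_powr: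
  assumes "0 \<le> a" "\<And>x. x \<in> \<Omega> \<Longrightarrow> 0 \<le> f x" "\<And>x. x \<in> \<Omega> \<Longrightarrow> 0 \<le> g x"
  shows "comp_on \<Omega> (\<lambda>x. (f x + g x) powr a) (\<lambda>x. f x powr a + g x powr a)"
  unfolding comp_on_def
proof (intro exI[of _ "2 + 2 powr a"] conjI ballI)
  fix x assume x: "x \<in> \<Omega>"
  note * = add_powr_le[OF assms(2)[OF x] assms(3)[OF x] assms(1)]
  have p: "0 \<le> 2 * f x powr a" "0 \<le> 2 * g x powr a" "0 \<le> 2 powr a * (f x + g x) powr a" by auto
  show "(f x + g x) powr a \<le> (2 + 2 powr a) * (f x powr a + g x powr a)"
    "f x powr a + g x powr a \<le> (2 + 2 powr a) * (f x + g x) powr a"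
    using * p unfolding distrib_right distrib_left by linarith+
qed (simp add: add_pos_nonneg)

text \<open>Restricting to unit fractions as exponents loses nothing: \<open>u\<close>-th powers of sums of squares
  are again such sums.\<close>
definition app :: "'v set \<Rightarrow> ('v \<Rightarrow> complex) set \<Rightarrow> (('v \<Rightarrow> complex) \<Rightarrow> real) \<Rightarrow> bool" where
  "app V \<Omega> f \<longleftrightarrow> (\<exists>g m. is_sos V g \<and> m \<ge> (1::nat) \<and> comp_on \<Omega> f (\<lambda>x. g x powr (1 / real m)))"

lemma app_nonneg: "app V \<Omega> f \<Longrightarrow> x \<in> \<Omega> \<Longrightarrow> 0 \<le> f x"
  unfolding app_def by (metis comp_on_nonneg powr_ge_zero)

lemma app_comp_on: "app V \<Omega> f \<Longrightarrow> comp_on \<Omega> f f' \<Longrightarrow> app V \<Omega> f'"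
  by (meson app_def comp_on_sym comp_on_trans)

lemma is_sos_powr_nat:
  assumes "is_sos V f" "k \<ge> (1::nat)"
  shows "f x powr (real k / a) = (f x ^ k) powr (1 / a)"
proof -
  have "(f x ^ k) = f x powr real k"
    using assms is_sos_nonneg[OF assms(1), of x] by (cases "f x = 0") (auto simp: powr_realpow)
  then show ?thesis by (simp add: powr_powr)
qed

lemma app_norm: "p \<in> polyfun \<int> V \<Longrightarrow> app V \<Omega> (\<lambda>x. cmod (p x))"
  unfolding app_def
  by (intro exI[of _ "\<lambda>x. (cmod (p x))\<^sup>2"] exI[of _ 2])
     (auto simp: is_sos_poly powr_half_sqrt comp_on_refl)

lemma app_0: "app V \<Omega> (\<lambda>x. 0)"
  using app_norm[OF polyfun.const[of 0 \<int> V], of \<Omega>] by simp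

lemma app_1: "app V \<Omega> (\<lambda>x. 1)"
  using app_norm[OF polyfun.const[of 1 \<int> V], of \<Omega>] by simp

text \<open>Raising the two sums of squares to the powers \<open>k\<close> and \<open>m\<close>
  turns the exponents \<open>1 / m\<close> and \<open>1 / k\<close> into the common exponent
  \<open>1 / (m * k)\<close>.\<close>

lemma app_common:
  assumes "app V \<Omega> f" "app V \<Omega> g"
  obtains s t m where "is_sos V s" "is_sos V t" "m \<ge> (1::nat)"
    "comp_on \<Omega> f (\<lambda>x. s x powr (1 / real m))" "comp_on \<Omega> g (\<lambda>x. t x powr (1 / real m))"
proof -
  obtain s m where s: "is_sos V s" "m \<ge> (1::nat)" "comp_on \<Omega> f (\<lambda>x. s x powr (1 / real m))"
    using assms(1) by (auto simp: app_def)
  obtain t k where t: "is_sos V t" "k \<ge> (1::nat)" "comp_on \<Omega> g (\<lambda>x. t x powr (1 / real k))"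
    using assms(2) by (auto simp: app_def)
  have 1: "s x powr (1 / real m) = (s x ^ k) powr (1 / real (m * k))" for x
    using is_sos_powr_nat[OF s(1) t(2), of x "real (m * k)"] s(2) t(2) by simp
  have 2: "t x powr (1 / real k) = (t x ^ m) powr (1 / real (m * k))" for x
    using is_sos_powr_nat[OF t(1) s(2), of x "real (m * k)"] s(2) t(2) by simp
  show ?thesis
    by (rule that[of "\<lambda>x. s x ^ k" "\<lambda>x. t x ^ m" "m * k"])
       (use s t 1 2 in \<open>auto intro: is_sos_power\<close>)
qed

lemma app_add:
  assumes "app V \<Omega> f" "app V \<Omega> g"
  shows "app V \<Omega> (\<lambda>x. f x + g x)"
proof -
  from assms obtain s t m where st: "is_sos V s" "is_sos V t" "m \<ge> (1::nat)"
    "comp_on \<Omega> f (\<lambda>x. s x powr (1 / real m))" "comp_on \<Omega> g (\<lambda>x. t x powr (1 / real m))"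
    by (rule app_common)
  have "comp_on \<Omega> (\<lambda>x. f x + g x) (\<lambda>x. s x powr (1 / real m) + t x powr (1 / real m))"
    using st by (intro comp_on_add) auto
  moreover have "comp_on \<Omega> (\<lambda>x. (s x + t x) powr (1 / real m)) (\<lambda>x. s x powr (1 / real m)
    + t x powr (1 / real m))"
    using st by (intro comp_on_add_powr) (auto intro: is_sos_nonneg)
  ultimately have "comp_on \<Omega> (\<lambda>x. f x + g x) (\<lambda>x. (s x + t x) powr (1 / real m))"
    using comp_on_sym comp_on_trans by blast
  then show ?thesis unfolding app_def using is_sos_add st by blast
qed

lemma app_mult:
  assumes "app V \<Omega> f" "app V \<Omega> g"
  shows "app V \<Omega> (\<lambda>x. f x * g x)"
proof -
  from assms obtain s t m where st: "is_sos V s" "is_sos V t" "m \<ge> (1::nat)"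
    "comp_on \<Omega> f (\<lambda>x. s x powr (1 / real m))" "comp_on \<Omega> g (\<lambda>x. t x powr (1 / real m))"
    by (rule app_common)
  have "comp_on \<Omega> (\<lambda>x. f x * g x) (\<lambda>x. s x powr (1 / real m) * t x powr (1 / real m))"
    using st by (intro comp_on_mult) auto
  also have "(\<lambda>x. s x powr (1 / real m) * t x powr (1 / real m))
    = (\<lambda>x. (s x * t x) powr (1 / real m))"
    using st by (auto simp: powr_mult is_sos_nonneg)
  finally show ?thesis unfolding app_def using is_sos_mult st by blast
qed

lemma app_sum:
  assumes "\<And>i. i \<in> S \<Longrightarrow> app V \<Omega> (f i)"
  shows "app V \<Omega> (\<lambda>x. \<Sum>i\<in>S. f i x)"
  using assms by (induction S rule: infinite_finite_induct) (auto intro: app_0 app_add)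

text \<open>For \<open>q = u / v\<close> the numerator goes into a power of the sum of squares and
  the denominator into the root. Positivity of \<open>q\<close> gives \<open>u \<ge> 1\<close> and
  so avoids the exponent zero, at which \<open>powr\<close> is discontinuous in the base.\<close>

lemma app_powr:
  assumes "app V \<Omega> f" "q \<in> \<rat>" "q > 0"
  shows "app V \<Omega> (\<lambda>x. f x powr q)"
proof -
  obtain u v where uv: "v \<noteq> (0::nat)" "\<bar>q\<bar> = real u / real v"
    using Rats_abs_nat_div_natE[OF assms(2)] by metis
  then have u: "u \<ge> 1" using assms(3) by (cases u) auto
  obtain s m where s: "is_sos V s" "m \<ge> (1::nat)" "comp_on \<Omega> f (\<lambda>x. s x powr (1 / real m))"
    using assms(1) by (auto simp: app_def)
  have "comp_on \<Omega> (\<lambda>x. f x powr q) (\<lambda>x. (s x powr (1 / real m)) powr q)"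
    using s assms by (intro comp_on_powr) auto
  also have "(\<lambda>x. (s x powr (1 / real m)) powr q) = (\<lambda>x. (s x ^ u) powr (1 / real (m * v)))"
  proof
    fix x
    have "(s x powr (1 / real m)) powr q = s x powr (real u / real (m * v))"
      using uv assms(3) by (simp add: powr_powr)
    also have "\<dots> = (s x ^ u) powr (1 / real (m * v))"
      using is_sos_powr_nat[OF s(1) u] by blast
    finally show "(s x powr (1 / real m)) powr q = (s x ^ u) powr (1 / real (m * v))" .
  qed
  finally show ?thesis unfolding app_def
    using s uv by (intro exI[of _ "\<lambda>x. s x ^ u"] exI[of _ "m * v"]) (auto intro: is_sos_power)
qed

section \<open>Power sums and elimination of roots\<close>

text \<open>Newton's identities as a logarithmic derivative: for \<open>E = prod (1 - w_k X)\<close>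
  one has \<open>X E' / E = - sum w_k X / (1 - w_k X)\<close>, and the sum on the right is the
  generating series of the power sums. The reversed factors \<open>1 - w_k X\<close> give
  \<open>E\<close> the constant term 1.\<close>

lemma newton_fps:
  fixes w :: "'k \<Rightarrow> complex"
  assumes "finite S"
  shows "fps_X * fps_deriv (\<Prod>k\<in>S. 1 - fps_const (w k) * fps_X) =
    - (\<Prod>k\<in>S. 1 - fps_const (w k) * fps_X) * Abs_fps (\<lambda>r. if r = 0 then 0 else \<Sum>k\<in>S. w k ^ r)"
  using assms
proof induction
  case empty
  then show ?case by (simp add: fps_eq_iff)
next
  case (insert x S)
  define E where "E = (\<Prod>k\<in>S. 1 - fps_const (w k) * fps_X)"
  define T where "T = Abs_fps (\<lambda>r. if r = 0 then 0 else \<Sum>k\<in>S. w k ^ r)"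
  define W where "W = Abs_fps (\<lambda>r. if r = 0 then 0 else w x ^ r)"
  have T': "Abs_fps (\<lambda>r. if r = 0 then 0 else \<Sum>k\<in>insert x S. w k ^ r) = T + W"
    using insert by (auto simp: T_def W_def fps_eq_iff)
  have W: "(1 - fps_const (w x) * fps_X) * W = fps_const (w x) * fps_X"
  proof (rule fps_ext)
    fix i
    have "((1 - fps_const (w x) * fps_X) * W) $ i = W $ i - w x * (fps_X * W) $ i"
      by (simp add: algebra_simps)
    also have "\<dots> = (fps_const (w x) * fps_X) $ i"
      by (cases i; cases "i - 1") (auto simp: W_def fps_X_mult_nth)
    finally show "((1 - fps_const (w x) * fps_X) * W) $ i = (fps_const (w x) * fps_X) $ i" .
  qed
  have IH: "fps_X * fps_deriv E = - E * T"
    using insert.IH by (simp add: E_def T_def)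
  have "fps_X * fps_deriv ((1 - fps_const (w x) * fps_X) * E)
      = (1 - fps_const (w x) * fps_X) * (fps_X * fps_deriv E) - (fps_const (w x) * fps_X) * E"
    by (simp add: algebra_simps)
  also have "\<dots> = (1 - fps_const (w x) * fps_X) * (- E * T) - ((1 - fps_const (w x) * fps_X) * W)
    * E"
    unfolding IH W ..
  also have "\<dots> = - ((1 - fps_const (w x) * fps_X) * E) * (T + W)"
    by (simp add: algebra_simps)
  finally show ?case using insert T' by (simp add: E_def)
qed

lemma newton_coeff:
  fixes w :: "'k \<Rightarrow> complex"
  assumes "finite S" "r \<ge> 1"
  defines "E \<equiv> \<Prod>k\<in>S. 1 - fps_const (w k) * fps_X"
  shows "of_nat r * E $ r = - (\<Sum>i<r. E $ i * (\<Sum>k\<in>S. w k ^ (r - i)))"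
proof -
  have "of_nat r * E $ r = (fps_X * fps_deriv E) $ r"
    using assms(2) by (simp add: fps_X_mult_nth)
  also have "\<dots> = - (\<Sum>i=0..r. E $ i * (if r - i = 0 then 0 else \<Sum>k\<in>S. w k ^ (r - i)))"
    unfolding E_def newton_fps[OF assms(1)] by (simp add: fps_mult_nth sum_negf)
  also have "(\<Sum>i=0..r. E $ i * (if r - i = 0 then 0 else \<Sum>k\<in>S. w k ^ (r - i)))
      = (\<Sum>i<r. E $ i * (\<Sum>k\<in>S. w k ^ (r - i)))"
    by (rule sum.mono_neutral_cong_right) auto
  finally show ?thesis .
qed

lemma newton_fps_nth_0: "finite S \<Longrightarrow> (\<Prod>k\<in>S. 1 - fps_const (w k) * fps_X) $ 0 = (1::complex)"
  by (induction rule: finite_induct) auto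

lemma degree_prod_linear:
  fixes w :: "'k \<Rightarrow> complex"
  shows "finite S \<Longrightarrow> degree (\<Prod>k\<in>S. [:- w k, 1:]) = card S"
  by (subst degree_prod_eq_sum_degree) auto

text \<open>The series is the reversal of the monic polynomial with roots \<open>w k\<close>, so its
  entries are the coefficients counted from the top degree.\<close>

lemma fps_nth_prod_linear:
  fixes w :: "'k \<Rightarrow> complex"
  assumes "finite S"
  shows "(\<Prod>k\<in>S. 1 - fps_const (w k) * fps_X) $ i =
    (if i \<le> card S then coeff (\<Prod>k\<in>S. [:- w k, 1:]) (card S - i) else 0)"
proof -
  have "fps_of_poly (reflect_poly (\<Prod>k\<in>S. [:- w k, 1:]))
    = (\<Prod>k\<in>S. fps_of_poly (reflect_poly [:- w k, 1:]))"
    by (simp add: reflect_poly_prod fps_of_poly_prod)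
  also have "\<dots> = (\<Prod>k\<in>S. 1 - fps_const (w k) * fps_X)"
  proof (rule prod.cong)
    fix k
    have "reflect_poly [:- w k, 1:] = [:1, - w k:]"
      by (rule poly_eqI) (auto simp: coeff_reflect_poly coeff_pCons split: nat.split)
    then show "fps_of_poly (reflect_poly [:- w k, 1:]) = 1 - fps_const (w k) * fps_X"
      by (auto simp: fps_eq_iff coeff_pCons fps_X_def split: nat.split)
  qed simp
  finally have "(\<Prod>k\<in>S. 1 - fps_const (w k) * fps_X) $ i
    = coeff (reflect_poly (\<Prod>k\<in>S. [:- w k, 1:])) i"
    by (metis fps_of_poly_nth)
  then show ?thesis
    using assms by (auto simp: coeff_reflect_poly degree_prod_linear)
qed

text \<open>Newton's recursion carries the bounds \<open>T ^ r\<close> over to the elementary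
  symmetric functions \<open>E $ r\<close>. If \<open>|w k| > 2 T\<close>, then in the equation
  satisfied by \<open>w k\<close> the lower terms add up to at most \<open>1 - 2^(-m)\<close> times
  the top term, which is impossible.\<close>

lemma root_le_of_power_sums_le:
  fixes w :: "'k \<Rightarrow> complex"
  assumes "finite S" "k \<in> S" "0 \<le> T"
    and le: "\<And>r. 1 \<le> r \<Longrightarrow> r \<le> card S \<Longrightarrow> cmod (\<Sum>k\<in>S. w k ^ r) \<le> T ^ r"
  shows "cmod (w k) \<le> 2 * T"
proof (rule ccontr)
  assume "\<not> ?thesis"
  then have wT: "T \<le> cmod (w k) / 2" and w0: "0 < cmod (w k)" using assms(3) by auto
  define m where "m = card S"
  define E where "E = (\<Prod>k\<in>S. 1 - fps_const (w k) * fps_X)"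
  have E: "cmod (E $ i) \<le> T ^ i" if "i \<le> m" for i
    using that
  proof (induction i rule: less_induct)
    case (less r)
    show ?case
    proof (cases "r = 0")
      case True
      then show ?thesis using newton_fps_nth_0[OF assms(1), of w] by (simp add: E_def)
    next
      case False
      then have r: "1 \<le> r" by simp
      have "real r * cmod (E $ r) = cmod (of_nat r * E $ r)" by (simp add: norm_mult)
      also have "\<dots> = cmod (\<Sum>i<r. E $ i * (\<Sum>k\<in>S. w k ^ (r - i)))"
        using newton_coeff[OF assms(1) r, of w] by (simp add: E_def norm_minus_cancel)
      also have "\<dots> \<le> (\<Sum>i<r. cmod (E $ i) * cmod (\<Sum>k\<in>S. w k ^ (r - i)))"
        by (rule order_trans[OF norm_sum]) (simp add: norm_mult)
      also have "\<dots> \<le> (\<Sum>i<r. T ^ i * T ^ (r - i))"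
        using less.prems assms(3) by (intro sum_mono mult_mono less.IH le) (auto simp: m_def)
      also have "\<dots> = real r * T ^ r" by (simp flip: power_add)
      finally show ?thesis using r by simp
    qed
  qed
  have "poly (\<Prod>k\<in>S. [:- w k, 1:]) (w k) = 0"
    using assms(1,2) by (auto simp: poly_prod)
  then have "0 = (\<Sum>j\<le>m. coeff (\<Prod>k\<in>S. [:- w k, 1:]) j * w k ^ j)"
    using assms(1) by (simp add: poly_altdef degree_prod_linear m_def)
  also have "\<dots> = (\<Sum>i\<le>m. E $ i * w k ^ (m - i))"
    by (rule sum.reindex_bij_witness[of _ "\<lambda>i. m - i" "\<lambda>i. m - i"])
       (auto simp: E_def fps_nth_prod_linear[OF assms(1)] m_def)
  also have "\<dots> = w k ^ m + (\<Sum>i\<in>{1..m}. E $ i * w k ^ (m - i))"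
  proof -
    have "{..m} = insert 0 {1..m}" by auto
    then show ?thesis using newton_fps_nth_0[OF assms(1), of w] by (simp add: E_def)
  qed
  finally have "w k ^ m = - (\<Sum>i\<in>{1..m}. E $ i * w k ^ (m - i))"
    by (simp add: eq_neg_iff_add_eq_0)
  then have "cmod (w k) ^ m = cmod (\<Sum>i\<in>{1..m}. E $ i * w k ^ (m - i))"
    by (metis norm_minus_cancel norm_power)
  also have "\<dots> \<le> (\<Sum>i\<in>{1..m}. cmod (E $ i) * cmod (w k) ^ (m - i))"
    by (rule order_trans[OF norm_sum]) (simp add: norm_mult norm_power)
  also have "\<dots> \<le> (\<Sum>i\<in>{1..m}. (cmod (w k) / 2) ^ i * cmod (w k) ^ (m - i))"
    using wT assms(3) by (intro sum_mono mult_right_mono order_trans[OF E] power_mono) auto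
  also have "\<dots> = (\<Sum>i\<in>{1..m}. (1 / 2) ^ i * cmod (w k) ^ m)"
    by (rule sum.cong) (auto simp: power_divide simp flip: power_add)
  also have "\<dots> = (\<Sum>i\<in>{1..m}. (1 / 2) ^ i) * cmod (w k) ^ m"
    by (simp add: sum_distrib_right)
  also have "(\<Sum>i\<in>{1..m}. (1 / 2) ^ i) = 1 - (1 / 2 :: real) ^ m"
    by (induction m) auto
  finally have "cmod (w k) ^ m * (1 / 2) ^ m \<le> 0" by (simp add: algebra_simps)
  moreover have "0 < cmod (w k) ^ m * (1 / 2) ^ m" using w0 by simp
  ultimately show False by linarith
qed

text \<open>The first bound takes \<open>T = h\<close> in the preceding lemma, since
  \<open>h\<close> dominates each single \<open>|p_r|^(1/r)\<close>. The second is the triangle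
  inequality for each power sum.\<close>

lemma power_sums_comparable:
  fixes w :: "'k \<Rightarrow> complex"
  assumes "finite S"
  defines "h \<equiv> \<Sum>r=1..card S. cmod (\<Sum>k\<in>S. w k ^ r) powr (1 / real r)"
  shows "(\<Sum>k\<in>S. cmod (w k)) \<le> 2 * real (card S) * h"
    and "h \<le> real (card S) * real (card S) * (\<Sum>k\<in>S. cmod (w k))"
proof -
  have h0: "0 \<le> h" unfolding h_def by (intro sum_nonneg) auto
  have "cmod (w k) \<le> 2 * h" if k: "k \<in> S" for k
  proof (rule root_le_of_power_sums_le[OF assms(1) k h0])
    fix r assume r: "1 \<le> r" "r \<le> card S"
    define a where "a = cmod (\<Sum>k\<in>S. w k ^ r)"
    have "a powr (1 / real r) \<le> h" unfolding h_def a_def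
      by (rule member_le_sum) (use r in auto)
    then have "(a powr (1 / real r)) ^ r \<le> h ^ r" by (intro power_mono) auto
    moreover have "(a powr (1 / real r)) ^ r = a"
    proof (cases "a = 0")
      case False
      then have "a > 0" by (simp add: a_def)
      then show ?thesis using r by (simp add: powr_powr flip: powr_realpow)
    qed (use r in auto)
    ultimately show "cmod (\<Sum>k\<in>S. w k ^ r) \<le> h ^ r" by (simp add: a_def)
  qed
  then have "(\<Sum>k\<in>S. cmod (w k)) \<le> (\<Sum>k\<in>S. 2 * h)" by (intro sum_mono)
  then show "(\<Sum>k\<in>S. cmod (w k)) \<le> 2 * real (card S) * h" by simp
  define f where "f = (\<Sum>k\<in>S. cmod (w k))"
  have f0: "0 \<le> f" unfolding f_def by (intro sum_nonneg) auto
  have "cmod (\<Sum>k\<in>S. w k ^ r) powr (1 / real r) \<le> real (card S) * f" if r: "r \<in> {1..card S}" for r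
  proof -
    have c1: "1 \<le> real (card S)" using r by auto
    have "cmod (\<Sum>k\<in>S. w k ^ r) \<le> (\<Sum>k\<in>S. cmod (w k) ^ r)"
      by (rule order_trans[OF norm_sum]) (simp add: norm_power)
    also have "\<dots> \<le> (\<Sum>k\<in>S. f ^ r)"
      unfolding f_def using assms(1) by (intro sum_mono power_mono member_le_sum) auto
    also have "\<dots> = real (card S) * f ^ r" by simp
    also have "\<dots> \<le> (real (card S) * f) ^ r"
      using c1 r f0 self_le_power[OF c1, of r]
        by (auto simp: power_mult_distrib intro!: mult_right_mono)
    finally have "cmod (\<Sum>k\<in>S. w k ^ r) powr (1 / real r)
      \<le> ((real (card S) * f) ^ r) powr (1 / real r)"
      by (intro powr_mono2) auto
    also have "\<dots> = real (card S) * f"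
    proof (cases "f = 0")
      case False
      then have "real (card S) * f > 0" using c1 f0 by auto
      then show ?thesis using r by (simp add: powr_powr flip: powr_realpow)
    qed (use r in auto)
    finally show ?thesis .
  qed
  then have "h \<le> (\<Sum>r=1..card S. real (card S) * f)" unfolding h_def by (intro sum_mono)
  then show "h \<le> real (card S) * real (card S) * (\<Sum>k\<in>S. cmod (w k))" by (simp add: f_def)
qed

section \<open>Symmetric sums over arrangements of roots\<close>

lemma poly_eq_sum_le:
  fixes p :: "complex poly"
  assumes "degree p \<le> d"
  shows "poly p x = (\<Sum>i\<le>d. coeff p i * x ^ i)"
  unfolding poly_altdef
  by (rule sum.mono_neutral_left) (use assms in \<open>auto simp: coeff_eq_0\<close>)

lemma polyfun_coeff_mult:
  fixes P Q :: "('v \<Rightarrow> complex) \<Rightarrow> complex poly"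
  assumes "\<And>i. (\<lambda>x. coeff (P x) i) \<in> polyfun \<int> V" "\<And>i. (\<lambda>x. coeff (Q x) i) \<in> polyfun \<int> V"
  shows "(\<lambda>x. coeff (P x * Q x) i) \<in> polyfun \<int> V"
  unfolding coeff_mult by (intro polyfun_sum polyfun.mult assms)

text \<open>Isolates one variable. The degree bound is uniform in \<open>x\<close>, so that later a
  single power of the leading coefficient clears the denominators of all power sums that
  occur.\<close>

lemma polyfun_as_poly:
  assumes "\<phi> \<in> polyfun \<int> W"
  shows "\<exists>P d. (\<forall>j. (\<lambda>x. coeff (P x) j) \<in> polyfun \<int> (W - {v})) \<and>
    (\<forall>x. degree (P x) \<le> d \<and> \<phi> x = poly (P x) (x v :: complex))"
  using assms
proof induction
  case (const c)
  then show ?case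
    by (intro exI[of _ "\<lambda>x. [:c:]"] exI[of _ 0])
       (auto simp: coeff_pCons split: nat.split intro!: polyfun.intros)
next
  case (var u)
  show ?case
  proof (cases "u = v")
    case True
    then show ?thesis
      by (intro exI[of _ "\<lambda>x. [:0, 1:]"] exI[of _ 1])
         (auto simp: coeff_pCons split: nat.split intro!: polyfun.intros)
  next
    case False
    have "(\<lambda>x. coeff [:x u:] j) \<in> polyfun \<int> (W - {v})" for j
      using var False by (cases j) (auto intro!: polyfun.intros)
    then show ?thesis
      by (intro exI[of _ "\<lambda>x. [:x u:]"] exI[of _ 0]) auto
  qed
next
  case (add p q)
  then obtain P d Q e where *: "\<And>j. (\<lambda>x. coeff (P x) j) \<in> polyfun \<int> (W - {v})"
     "\<And>x. degree (P x) \<le> d \<and> p x = poly (P x) (x v)"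
     "\<And>j. (\<lambda>x. coeff (Q x) j) \<in> polyfun \<int> (W - {v})"
     "\<And>x. degree (Q x) \<le> e \<and> q x = poly (Q x) (x v)" by metis
  have "degree (P x + Q x) \<le> max d e" for x
    using degree_add_le_max[of "P x" "Q x"] *(2,4)[of x] by linarith
  then show ?case
    by (intro exI[of _ "\<lambda>x. P x + Q x"] exI[of _ "max d e"])
       (use * in \<open>auto intro!: polyfun.intros\<close>)
next
  case (mult p q)
  then obtain P d Q e where *: "\<And>j. (\<lambda>x. coeff (P x) j) \<in> polyfun \<int> (W - {v})"
     "\<And>x. degree (P x) \<le> d \<and> p x = poly (P x) (x v)"
     "\<And>j. (\<lambda>x. coeff (Q x) j) \<in> polyfun \<int> (W - {v})"
     "\<And>x. degree (Q x) \<le> e \<and> q x = poly (Q x) (x v)" by metis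
  have "degree (P x * Q x) \<le> d + e" for x
    using degree_mult_le[of "P x" "Q x"] *(2,4)[of x] by linarith
  then show ?case
    by (intro exI[of _ "\<lambda>x. P x * Q x"] exI[of _ "d + e"])
       (use * in \<open>auto intro!: polyfun_coeff_mult\<close>)
qed

text \<open>If \<open>coeff p n = 0\<close>, this just says \<open>p = 0\<close>.\<close>
definition splits :: "nat \<Rightarrow> complex poly \<Rightarrow> (nat \<Rightarrow> complex) \<Rightarrow> bool" where
  "splits n p \<alpha> \<longleftrightarrow> p = smult (coeff p n) (\<Prod>k<n. [:- \<alpha> k, 1:])"

text \<open>Let \<open>g\<close> be the coefficient of degree \<open>n\<close>. Then
  \<open>g * E $ i\<close> is a coefficient of \<open>G x\<close>, and Newton's identity multiplied
  by \<open>g ^ r\<close> becomes polynomial: each term splits as \<open>g ^ (i - 1)\<close> times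
  \<open>g * E $ i\<close> times \<open>g ^ (r - i)\<close> times a lower power sum. The resulting
  polynomial does not depend on the chosen roots.\<close>

lemma power_sum_polyfun:
  fixes G :: "('v \<Rightarrow> complex) \<Rightarrow> complex poly"
  assumes "\<And>i. (\<lambda>x. coeff (G x) i) \<in> polyfun \<int> V"
  shows "\<exists>t\<in>polyfun \<int> V. \<forall>x \<alpha>. splits n (G x) \<alpha> \<longrightarrow> coeff (G x) n ^ r * (\<Sum>k<n. \<alpha> k ^ r) = t x"
proof (induction r rule: less_induct)
  case (less r)
  show ?case
  proof (cases "r = 0")
    case True
    then show ?thesis by (intro bexI[of _ "\<lambda>x. of_nat n"]) (auto intro: polyfun.intros)
  next
    case False
    define a where "a i x = (if i \<le> n then coeff (G x) (n - i) else 0)" for i x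
    have a: "a i \<in> polyfun \<int> V" for i
      by (cases "i \<le> n") (auto simp: a_def[abs_def] intro!: assms polyfun.const)
    obtain t where t: "\<And>q. q < r \<Longrightarrow> t q \<in> polyfun \<int> V"
      "\<And>q x \<alpha>. q < r \<Longrightarrow> splits n (G x) \<alpha> \<Longrightarrow> coeff (G x) n ^ q * (\<Sum>k<n. \<alpha> k ^ q) = t q x"
      using less.IH by metis
    define u where "u x = - (of_nat r * coeff (G x) n ^ (r - 1) * a r x
        + (\<Sum>i\<in>{1..<r}. coeff (G x) n ^ (i - 1) * a i x * t (r - i) x))" for x
    have "(\<lambda>x. 0 - (of_nat r * coeff (G x) n ^ (r - 1) * a r x
        + (\<Sum>i\<in>{1..<r}. coeff (G x) n ^ (i - 1) * a i x * t (r - i) x))) \<in> polyfun \<int> V"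
      by (intro polyfun_minus polyfun.add polyfun.mult polyfun_sum polyfun.const polyfun_power
        assms a t) auto
    then have "u \<in> polyfun \<int> V" by (simp add: u_def[abs_def])
    moreover have "coeff (G x) n ^ r * (\<Sum>k<n. \<alpha> k ^ r) = u x" if sp: "splits n (G x) \<alpha>" for x \<alpha>
    proof -
      define g where "g = coeff (G x) n"
      define E where "E = (\<Prod>k<n. 1 - fps_const (\<alpha> k) * fps_X)"
      have gE: "g * E $ i = a i x" for i
      proof (cases "i \<le> n")
        case True
        then have "g * E $ i = g * coeff (\<Prod>k<n. [:- \<alpha> k, 1:]) (n - i)"
          by (simp add: E_def fps_nth_prod_linear)
        also have "\<dots> = coeff (smult g (\<Prod>k<n. [:- \<alpha> k, 1:])) (n - i)" by simp
        also have "smult g (\<Prod>k<n. [:- \<alpha> k, 1:]) = G x"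
          using sp unfolding splits_def g_def by (rule sym)
        finally show ?thesis using True by (simp add: a_def)
      qed (simp add: a_def E_def fps_nth_prod_linear)
      have r1: "1 \<le> r" using False by simp
      have split: "{..<r} = insert 0 {1..<r}" using r1 by auto
      have "of_nat r * E $ r = - (\<Sum>i<r. E $ i * (\<Sum>k<n. \<alpha> k ^ (r - i)))"
        using newton_coeff[of "{..<n}" r \<alpha>] r1 by (simp add: E_def)
      also have "\<dots> = - ((\<Sum>k<n. \<alpha> k ^ r) + (\<Sum>i\<in>{1..<r}. E $ i * (\<Sum>k<n. \<alpha> k ^ (r - i))))"
        using newton_fps_nth_0[of "{..<n}" \<alpha>] by (simp add: split E_def)
      finally have s: "(\<Sum>k<n. \<alpha> k ^ r) = - (of_nat r * E $ r + (\<Sum>i\<in>{1..<r}. E $ i * (\<Sum>k<n. \<alpha> k ^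
        (r - i))))"
        by (simp add: algebra_simps)
      have "g ^ r * (\<Sum>k<n. \<alpha> k ^ r) = - (of_nat r * (g ^ r * E $ r)
          + (\<Sum>i\<in>{1..<r}. g ^ r * (E $ i * (\<Sum>k<n. \<alpha> k ^ (r - i)))))"
        unfolding s by (simp add: algebra_simps sum_distrib_left)
      also have "g ^ r * E $ r = g ^ (r - 1) * a r x"
        using r1 by (simp add: power_eq_if flip: gE)
      also have "(\<Sum>i\<in>{1..<r}. g ^ r * (E $ i * (\<Sum>k<n. \<alpha> k ^ (r - i))))
        = (\<Sum>i\<in>{1..<r}. g ^ (i - 1) * a i x * t (r - i) x)"
      proof (rule sum.cong)
        fix i assume i: "i \<in> {1..<r}"
        have "g ^ r = g ^ (i - 1) * g * g ^ (r - i)"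
          using i by (simp flip: power_Suc2 power_add)
        then have "g ^ r * (E $ i * (\<Sum>k<n. \<alpha> k ^ (r - i))) =
           g ^ (i - 1) * (g * E $ i) * (g ^ (r - i) * (\<Sum>k<n. \<alpha> k ^ (r - i)))"
          by (simp only: ac_simps)
        then show "g ^ r * (E $ i * (\<Sum>k<n. \<alpha> k ^ (r - i))) = g ^ (i - 1) * a i x * t (r - i) x"
          using t(2)[of "r - i" x \<alpha>] i sp by (simp only: gE) (simp add: g_def)
      qed simp
      finally show ?thesis by (simp add: u_def g_def algebra_simps)
    qed
    ultimately show ?thesis by blast
  qed
qed

text \<open>For \<open>q = n\<close> these are the permutations of the root indices; smaller
  \<open>q\<close> occurs only in the induction that removes one index at a time.\<close>

definition dlists :: "nat \<Rightarrow> nat \<Rightarrow> nat list set" where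
  "dlists n q = {ks. length ks = q \<and> distinct ks \<and> set ks \<subseteq> {..<n}}"

lemma finite_dlists: "finite (dlists n q)"
  by (rule finite_subset[OF _ finite_lists_length_eq[of "{..<n}" q]]) (auto simp: dlists_def)

lemma sum_dlists_Suc:
  "(\<Sum>ks\<in>dlists n (Suc q). f ks) = (\<Sum>ks\<in>dlists n q. \<Sum>k\<in>{..<n} - set ks. f (ks @ [k]))"
proof -
  have "(\<Sum>ks\<in>dlists n q. \<Sum>k\<in>{..<n} - set ks. f (ks @ [k]))
     = (\<Sum>(ks, k)\<in>Sigma (dlists n q) (\<lambda>ks. {..<n} - set ks). f (ks @ [k]))"
    by (rule sum.Sigma) (auto simp: finite_dlists)
  also have "\<dots> = (\<Sum>ks\<in>dlists n (Suc q). f ks)"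
  proof (rule sum.reindex_bij_witness[of _ "\<lambda>ks. (butlast ks, last ks)" "\<lambda>(ks, k). ks @ [k]"])
    fix ks assume "ks \<in> dlists n (Suc q)"
    moreover obtain xs x where "ks = xs @ [x]"
      using calculation by (cases ks rule: rev_cases) (auto simp: dlists_def)
    ultimately show "(butlast ks, last ks) \<in> Sigma (dlists n q) (\<lambda>ks. {..<n} - set ks)"
      "(case (butlast ks, last ks) of (ks, k) \<Rightarrow> ks @ [k]) = ks"
      by (auto simp: dlists_def)
  qed (auto simp: dlists_def)
  finally show ?thesis ..
qed

text \<open>A sum over injective index tuples is reduced to one over shorter tuples: let the last index
  run over
  all roots, which gives power sums, and subtract the terms where it repeats an earlier index.\<close>
lemma dlists_sum_polyfun:
  fixes G :: "('v \<Rightarrow> complex) \<Rightarrow> complex poly" and \<phi> :: "('v + nat \<Rightarrow> complex) \<Rightarrow> complex"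
  assumes G: "\<And>i. (\<lambda>x. coeff (G x) i) \<in> polyfun \<int> V"
    and \<phi>: "\<phi> \<in> polyfun \<int> (Inl ` V \<union> Inr ` {..<q})"
  shows "\<exists>\<psi>\<in>polyfun \<int> V. \<exists>e. \<forall>b \<alpha>. splits n (G b) \<alpha> \<longrightarrow>
    coeff (G b) n ^ e * (\<Sum>ks\<in>dlists n q. \<phi> (case_sum b (\<lambda>i. \<alpha> (ks ! i)))) = \<psi> b"
  using \<phi>
proof (induction q arbitrary: \<phi>)
  case 0
  have "(\<lambda>b. \<phi> (case_sum b (\<lambda>i. 0))) \<in> polyfun \<int> V"
    using 0 by (rule polyfun_reindex) (auto intro: polyfun.intros)
  moreover have "\<phi> (case_sum b (\<lambda>i. \<alpha> ([] ! i))) = \<phi> (case_sum b (\<lambda>i. 0))" for b and \<alpha> ::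
    "nat \<Rightarrow> complex"
    by (rule polyfun_cong[OF 0]) auto
  moreover have "dlists n 0 = {[]}" by (auto simp: dlists_def)
  ultimately show ?case
    by (intro bexI[of _ "\<lambda>b. \<phi> (case_sum b (\<lambda>i. 0))"] exI[of _ 0]) auto
next
  case (Suc q)
  define W where "W = Inl ` V \<union> Inr ` {..<q}"
  have W: "(Inl ` V \<union> Inr ` {..<Suc q}) - {Inr q} = W"
    by (auto simp: W_def less_Suc_eq)
  obtain P d where P: "\<And>j. (\<lambda>x. coeff (P x) j) \<in> polyfun \<int> W"
    "\<And>x. degree (P x) \<le> d" "\<And>x. \<phi> x = poly (P x) (x (Inr q))"
    using polyfun_as_poly[OF Suc.prems, of "Inr q"] unfolding W by metis
  obtain t where t: "\<And>j. t j \<in> polyfun \<int> V"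
    "\<And>j x \<alpha>. splits n (G x) \<alpha> \<Longrightarrow> coeff (G x) n ^ j * (\<Sum>k<n. \<alpha> k ^ j) = t j x"
    using power_sum_polyfun[OF G] by metis
  have lift: "(\<lambda>x. p (\<lambda>v. x (Inl v))) \<in> polyfun \<int> W"
    if "p \<in> polyfun \<int> V" for p :: "('v \<Rightarrow> complex) \<Rightarrow> complex"
    using that by (rule polyfun_reindex) (auto intro!: polyfun.intros simp: W_def)
  define g where "g b = coeff (G b) n" for b
  define \<phi>1 where "\<phi>1 x = (\<Sum>j\<le>d. coeff (P x) j * (g (\<lambda>v. x (Inl v)) ^ (d - j) * t j (\<lambda>v. x
    (Inl v))))" for x
  define \<phi>2 where "\<phi>2 x = (\<Sum>i<q. \<phi> (x(Inr q := x (Inr i))))" for x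
  define \<phi>' where "\<phi>' x = \<phi>1 x - g (\<lambda>v. x (Inl v)) ^ d * \<phi>2 x" for x
  have gl: "(\<lambda>x. g (\<lambda>v. x (Inl v))) \<in> polyfun \<int> W" unfolding g_def by (rule lift[OF G])
  have "(\<lambda>x. \<phi> (x(Inr q := x (Inr i)))) \<in> polyfun \<int> W" if "i < q" for i
    using Suc.prems that by (intro polyfun_reindex[OF Suc.prems])
      (auto intro!: polyfun.intros simp: W_def less_Suc_eq)
  then have \<phi>': "\<phi>' \<in> polyfun \<int> (Inl ` V \<union> Inr ` {..<q})"
    unfolding \<phi>'_def \<phi>1_def \<phi>2_def W_def[symmetric]
    by (intro polyfun_minus polyfun_sum polyfun.mult P polyfun_power gl lift t) auto
  obtain \<psi> e where \<psi>: "\<psi> \<in> polyfun \<int> V"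
    "\<And>b \<alpha>. splits n (G b) \<alpha> \<Longrightarrow> g b ^ e * (\<Sum>ks\<in>dlists n q. \<phi>' (case_sum b (\<lambda>i. \<alpha> (ks ! i)))) = \<psi> b"
    using Suc.IH[OF \<phi>'] unfolding g_def by metis
  have "g b ^ (e + d) * (\<Sum>ks\<in>dlists n (Suc q). \<phi> (case_sum b (\<lambda>i. \<alpha> (ks ! i)))) = \<psi> b"
    if sp: "splits n (G b) \<alpha>" for b \<alpha>
  proof -
    have "g b ^ d * (\<Sum>k\<in>{..<n} - set ks. \<phi> (case_sum b (\<lambda>i. \<alpha> ((ks @ [k]) ! i))))
       = \<phi>' (case_sum b (\<lambda>i. \<alpha> (ks ! i)))" if ks: "ks \<in> dlists n q" for ks
    proof -
      define x where "x = case_sum b (\<lambda>i. \<alpha> (ks ! i))"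
      have len: "length ks = q" using ks by (simp add: dlists_def)
      have 1: "\<phi> (case_sum b (\<lambda>i. \<alpha> ((ks @ [k]) ! i))) = \<phi> (x(Inr q := \<alpha> k))" for k
        by (rule polyfun_cong[OF Suc.prems]) (use len in \<open>auto simp: x_def nth_append less_Suc_eq\<close>)
      have 2: "(\<Sum>k\<in>{..<n} - set ks. \<phi> (x(Inr q := \<alpha> k))) =
        (\<Sum>k<n. \<phi> (x(Inr q := \<alpha> k))) - (\<Sum>k\<in>set ks. \<phi> (x(Inr q := \<alpha> k)))"
        using ks by (intro sum_diff) (auto simp: dlists_def)
      have 3: "(\<Sum>k\<in>set ks. \<phi> (x(Inr q := \<alpha> k))) = \<phi>2 x"
      proof -
        have "(\<Sum>k\<in>set ks. \<phi> (x(Inr q := \<alpha> k))) = (\<Sum>i<q. \<phi> (x(Inr q := \<alpha> (ks ! i))))"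
          by (rule sum.reindex_bij_betw[symmetric, OF bij_betw_nth])
            (use ks in \<open>auto simp: dlists_def\<close>)
        then show ?thesis by (simp add: \<phi>2_def x_def)
      qed
      have xl: "(\<lambda>v. x (Inl v)) = b" by (simp add: x_def)
      have Px: "P (x(Inr q := c)) = P x" for c
      proof (rule poly_eqI)
        fix j
        show "coeff (P (x(Inr q := c))) j = coeff (P x) j"
          by (rule polyfun_cong[OF P(1)]) (auto simp: W_def)
      qed
      have "(\<Sum>k<n. \<phi> (x(Inr q := \<alpha> k))) = (\<Sum>k<n. \<Sum>j\<le>d. coeff (P x) j * \<alpha> k ^ j)"
        by (simp add: P(3) Px poly_eq_sum_le[OF P(2)])
      also have "\<dots> = (\<Sum>j\<le>d. coeff (P x) j * (\<Sum>k<n. \<alpha> k ^ j))"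
        by (subst sum.swap) (simp add: sum_distrib_left)
      finally have "g b ^ d * (\<Sum>k<n. \<phi> (x(Inr q := \<alpha> k))) =
         (\<Sum>j\<le>d. coeff (P x) j * (g b ^ d * (\<Sum>k<n. \<alpha> k ^ j)))"
        by (simp add: sum_distrib_left algebra_simps)
      also have "\<dots> = \<phi>1 x"
        unfolding \<phi>1_def xl
      proof (rule sum.cong)
        fix j assume "j \<in> {..d}"
        then have "g b ^ d = g b ^ (d - j) * g b ^ j" by (simp flip: power_add)
        then show "coeff (P x) j * (g b ^ d * (\<Sum>k<n. \<alpha> k ^ j))
          = coeff (P x) j * (g b ^ (d - j) * t j b)"
          using t(2)[OF sp, of j] by (simp add: g_def mult.assoc)
      qed simp
      finally show ?thesis
        unfolding 1 2 3 x_def[symmetric] \<phi>'_def xl by (simp add: right_diff_distrib)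
    qed
    then have "g b ^ d * (\<Sum>ks\<in>dlists n (Suc q). \<phi> (case_sum b (\<lambda>i. \<alpha> (ks ! i))))
      = (\<Sum>ks\<in>dlists n q. \<phi>' (case_sum b (\<lambda>i. \<alpha> (ks ! i))))"
      by (simp add: sum_dlists_Suc sum_distrib_left cong: sum.cong)
    then show ?thesis using \<psi>(2)[OF sp] by (simp add: power_add mult.assoc)
  qed
  then show ?case using \<psi>(1) unfolding g_def by blast
qed

section \<open>Eliminating roots from absolute polynomial powers\<close>

lemma comp_on_sum_powr:
  assumes "finite T" "0 \<le> a" "\<And>i x. i \<in> T \<Longrightarrow> x \<in> \<Omega> \<Longrightarrow> 0 \<le> f i x"
  shows "comp_on \<Omega> (\<lambda>x. (\<Sum>i\<in>T. f i x) powr a) (\<lambda>x. \<Sum>i\<in>T. f i x powr a)"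
  using assms(1,3)
proof induction
  case empty
  then show ?case by (simp add: comp_on_refl)
next
  case (insert i T)
  have "comp_on \<Omega> (\<lambda>x. (f i x + (\<Sum>i\<in>T. f i x)) powr a) (\<lambda>x. f i x powr a + (\<Sum>i\<in>T. f i x) powr a)"
    using insert.prems assms(2) by (intro comp_on_add_powr) (auto intro!: sum_nonneg)
  moreover have "comp_on \<Omega> (\<lambda>x. f i x powr a + (\<Sum>i\<in>T. f i x) powr a) (\<lambda>x. f i x powr a +
    (\<Sum>i\<in>T. f i x powr a))"
    using insert by (intro comp_on_add comp_on_refl) (auto intro!: sum_nonneg)
  ultimately show ?case using insert comp_on_trans by auto
qed

lemma comp_on_sum:
  assumes "finite T" "\<And>i. i \<in> T \<Longrightarrow> comp_on \<Omega> (f i) (g i)" "\<And>i x. i \<in> T \<Longrightarrow> x \<in> \<Omega> \<Longrightarrow> 0 \<le> g i x"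
  shows "comp_on \<Omega> (\<lambda>x. \<Sum>i\<in>T. f i x) (\<lambda>x. \<Sum>i\<in>T. g i x)"
  using assms by induction (auto intro!: comp_on_refl comp_on_add sum_nonneg)

lemma comp_on_compose:
  assumes "comp_on \<Omega> f g" "\<And>x. x \<in> \<Omega>' \<Longrightarrow> h x \<in> \<Omega>"
  shows "comp_on \<Omega>' (\<lambda>x. f (h x)) (\<lambda>x. g (h x))"
  using assms unfolding comp_on_def by blast

context
  fixes G :: "('v \<Rightarrow> complex) \<Rightarrow> complex poly" and V :: "'v set" and \<Omega> :: "('v \<Rightarrow> complex) set"
    and rt :: "('v \<Rightarrow> complex) \<Rightarrow> nat \<Rightarrow> complex" and n :: nat and lo hi :: real
  assumes G: "\<And>i. (\<lambda>x. coeff (G x) i) \<in> polyfun \<int> V"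
    and roots: "\<And>b. b \<in> \<Omega> \<Longrightarrow> splits n (G b) (rt b)"
    and lo: "0 < lo" "\<And>b. b \<in> \<Omega> \<Longrightarrow> lo \<le> cmod (coeff (G b) n)"
    and hi: "\<And>b. b \<in> \<Omega> \<Longrightarrow> cmod (coeff (G b) n) \<le> hi"
begin

text \<open>The power sums of the values of \<open>p\<close> over all arrangements are symmetric in
  the roots, hence integer polynomials up to powers of the leading coefficient. The bounds
  \<open>lo\<close> and \<open>hi\<close> make these powers harmless, and
  \<open>power_sums_comparable\<close> returns from power sums to the sum of moduli.\<close>

lemma app_eliminate_norm:
  assumes p: "p \<in> polyfun \<int> (Inl ` V \<union> Inr ` {..<n})"
  shows "app V \<Omega> (\<lambda>b. \<Sum>ks\<in>dlists n n. cmod (p (case_sum b (\<lambda>i. rt b (ks ! i)))))"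
proof -
  define S where "S = dlists n n"
  have fin: "finite S" by (simp add: S_def finite_dlists)
  have 1: "app V \<Omega> (\<lambda>b. cmod (\<Sum>ks\<in>S. p (case_sum b (\<lambda>i. rt b (ks ! i))) ^ r))" for r
  proof -
    have "(\<lambda>x. p x ^ r) \<in> polyfun \<int> (Inl ` V \<union> Inr ` {..<n})"
      using p by (rule polyfun_power)
    then obtain \<psi> e where \<psi>: "\<psi> \<in> polyfun \<int> V"
      "\<And>b \<alpha>. splits n (G b) \<alpha> \<Longrightarrow>
         coeff (G b) n ^ e * (\<Sum>ks\<in>S. p (case_sum b (\<lambda>i. \<alpha> (ks ! i))) ^ r) = \<psi> b"
      using dlists_sum_polyfun[OF G, of "\<lambda>x. p x ^ r" n n] unfolding S_def by metis
    have "comp_on \<Omega> (\<lambda>b. cmod (\<psi> b)) (\<lambda>b. cmod (\<Sum>ks\<in>S. p (case_sum b (\<lambda>i. rt b (ks ! i))) ^ r))"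
      unfolding comp_on_def
    proof (intro exI[of _ "1 / lo ^ e + \<bar>hi\<bar> ^ e"] conjI ballI)
      fix b assume b: "b \<in> \<Omega>"
      define s where "s = cmod (\<Sum>ks\<in>S. p (case_sum b (\<lambda>i. rt b (ks ! i))) ^ r)"
      define g where "g = cmod (coeff (G b) n)"
      have eq: "cmod (\<psi> b) = g ^ e * s"
        using \<psi>(2)[OF roots[OF b]] by (simp add: s_def g_def norm_mult norm_power flip: \<psi>(2)[OF
          roots[OF b]])
      have "g ^ e \<le> \<bar>hi\<bar> ^ e" using hi[OF b] by (intro power_mono) (auto simp: g_def)
      then have "g ^ e * s \<le> \<bar>hi\<bar> ^ e * s" by (intro mult_right_mono) (auto simp: s_def)
      moreover have "0 \<le> 1 / lo ^ e * s" using lo by (auto simp: s_def)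
      ultimately show "cmod (\<psi> b) \<le> (1 / lo ^ e + \<bar>hi\<bar> ^ e) * cmod (\<Sum>ks\<in>S. p (case_sum b (\<lambda>i. rt b
        (ks ! i))) ^ r)"
        unfolding eq s_def[symmetric] distrib_right by linarith
      have "lo ^ e \<le> g ^ e" using lo b by (intro power_mono) (auto simp: g_def)
      then have "1 * s \<le> (1 / lo ^ e * g ^ e) * s" 
        using lo by (intro mult_right_mono) (auto simp: s_def field_simps)
      moreover have "0 \<le> \<bar>hi\<bar> ^ e * (g ^ e * s)" by (auto simp: s_def g_def)
      ultimately show "cmod (\<Sum>ks\<in>S. p (case_sum b (\<lambda>i. rt b (ks ! i))) ^ r)
        \<le> (1 / lo ^ e + \<bar>hi\<bar> ^ e) * cmod (\<psi> b)"
        unfolding eq s_def[symmetric] distrib_right by linarith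
    qed (use lo in \<open>auto intro!: add_pos_nonneg\<close>)
    then show ?thesis using app_comp_on app_norm[OF \<psi>(1)] by blast
  qed
  have "app V \<Omega> (\<lambda>b. \<Sum>r=1..card S. cmod (\<Sum>ks\<in>S. p (case_sum b (\<lambda>i. rt b (ks ! i))) ^ r) powr (1
    / real r))"
    by (intro app_sum app_powr 1) auto
  moreover have "comp_on \<Omega> (\<lambda>b. \<Sum>r=1..card S. cmod (\<Sum>ks\<in>S. p (case_sum b (\<lambda>i. rt b
    (ks ! i))) ^ r) powr (1 / real r))
     (\<lambda>b. \<Sum>ks\<in>S. cmod (p (case_sum b (\<lambda>i. rt b (ks ! i)))))"
    unfolding comp_on_def
  proof (intro exI[of _ "2 * real (card S) + real (card S) * real (card S) + 1"] conjI ballI)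
    fix b
    define s where "s = (\<Sum>ks\<in>S. cmod (p (case_sum b (\<lambda>i. rt b (ks ! i)))))"
    define h where "h = (\<Sum>r=1..card S. cmod (\<Sum>ks\<in>S. p (case_sum b (\<lambda>i. rt b (ks ! i))) ^ r) powr
      (1 / real r))"
    have nn: "0 \<le> s" "0 \<le> h" unfolding s_def h_def by (auto intro!: sum_nonneg)
    note * = power_sums_comparable[OF fin, of "\<lambda>ks. p (case_sum b (\<lambda>i. rt b
      (ks ! i)))", folded s_def h_def]
    have p: "0 \<le> 2 * real (card S) * s" "0 \<le> 2 * real (card S) * h" "0
      \<le> real (card S) * real (card S) * s"
       "0 \<le> real (card S) * real (card S) * h" using nn by auto
    show "h \<le> (2 * real (card S) + real (card S) * real (card S) + 1) * s"
      "s \<le> (2 * real (card S) + real (card S) * real (card S) + 1) * h"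
      using * p nn unfolding distrib_right by linarith+
  qed (auto intro!: add_nonneg_pos)
  ultimately show ?thesis unfolding S_def by (rule app_comp_on)
qed

text \<open>Sums of powers and powers of sums are comparable. So the root \<open>1 / m\<close> can
  be taken after summation, each \<open>|p|^2\<close> replaced by the square of a sum of
  \<open>|p|\<close>, and everything reduces to \<open>app_eliminate_norm\<close>.\<close>

lemma app_eliminate:
  assumes f: "app (Inl ` V \<union> Inr ` {..<n}) \<Omega>' f"
    and \<Omega>': "\<And>b ks. b \<in> \<Omega> \<Longrightarrow> ks \<in> dlists n n \<Longrightarrow> case_sum b (\<lambda>i. rt b (ks ! i)) \<in> \<Omega>'"
  shows "app V \<Omega> (\<lambda>b. \<Sum>ks\<in>dlists n n. f (case_sum b (\<lambda>i. rt b (ks ! i))))"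
proof -
  define S where "S = dlists n n"
  have fin: "finite S" by (simp add: S_def finite_dlists)
  obtain g m where g: "is_sos (Inl ` V \<union> Inr ` {..<n}) g" "m \<ge> (1::nat)"
    "comp_on \<Omega>' f (\<lambda>x. g x powr (1 / real m))"
    using f by (auto simp: app_def)
  obtain ps where ps: "set ps \<subseteq> polyfun \<int> (Inl ` V \<union> Inr ` {..<n})" "g
    = (\<lambda>x. \<Sum>p\<leftarrow>ps. (cmod (p x))\<^sup>2)"
    using g(1) by (auto simp: is_sos_def)
  have sq: "app V \<Omega> (\<lambda>b. \<Sum>ks\<in>S. (cmod (p (case_sum b (\<lambda>i. rt b (ks ! i)))))\<^sup>2)"
    if "p \<in> polyfun \<int> (Inl ` V \<union> Inr ` {..<n})" for p
  proof -
    have "app V \<Omega> (\<lambda>b. (\<Sum>ks\<in>S. cmod (p (case_sum b (\<lambda>i. rt b (ks ! i))))) powr 2)"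
      unfolding S_def by (intro app_powr app_eliminate_norm that) auto
    moreover have "comp_on \<Omega> (\<lambda>b. (\<Sum>ks\<in>S. cmod (p (case_sum b (\<lambda>i. rt b (ks ! i))))) powr 2)
       (\<lambda>b. \<Sum>ks\<in>S. cmod (p (case_sum b (\<lambda>i. rt b (ks ! i)))) powr 2)"
      by (intro comp_on_sum_powr fin) auto
    ultimately show ?thesis
      using app_comp_on by (fastforce simp: powr_numeral)
  qed
  have "app V \<Omega> (\<lambda>b. \<Sum>ks\<in>S. \<Sum>p\<leftarrow>ps. (cmod (p (case_sum b (\<lambda>i. rt b (ks ! i)))))\<^sup>2)"
    using ps(1) by (induction ps) (auto simp: sum.distrib intro!: app_0 app_add sq)
  then have "app V \<Omega> (\<lambda>b. (\<Sum>ks\<in>S. g (case_sum b (\<lambda>i. rt b (ks ! i)))) powr (1 / real m))"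
    unfolding ps(2) by (rule app_powr) (use g in auto)
  moreover have "comp_on \<Omega> (\<lambda>b. (\<Sum>ks\<in>S. g (case_sum b (\<lambda>i. rt b (ks ! i)))) powr (1 / real m))
     (\<lambda>b. \<Sum>ks\<in>S. g (case_sum b (\<lambda>i. rt b (ks ! i))) powr (1 / real m))"
    by (intro comp_on_sum_powr fin) (auto intro: is_sos_nonneg[OF g(1)])
  moreover have "comp_on \<Omega> (\<lambda>b. \<Sum>ks\<in>S. g (case_sum b (\<lambda>i. rt b (ks ! i))) powr (1 / real m))
    (\<lambda>b. \<Sum>ks\<in>S. f (case_sum b (\<lambda>i. rt b (ks ! i))))"
    by (rule comp_on_sym, rule comp_on_sum[OF fin], rule comp_on_compose[OF g(3)])
      (auto intro: \<Omega>' simp: S_def)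
  ultimately show ?thesis unfolding S_def using app_comp_on by blast
qed

end

section \<open>Stratified quotients\<close>

type_synonym 'p quot = "('p \<Rightarrow> real) \<times> ('p \<Rightarrow> real)"

text \<open>Comparability of \<open>F\<close> with \<open>K / L\<close>, where \<open>K > 0\<close> and \<open>K / 0 = \<infinity>\<close>.\<close>
definition quot_rel :: "real \<Rightarrow> real \<Rightarrow> real \<Rightarrow> ennreal \<Rightarrow> bool" where
  "quot_rel C K L F \<longleftrightarrow> K > 0 \<and> (F = top \<and> L = 0 \<or>
     (\<exists>f\<ge>0. F = ennreal f \<and> L > 0 \<and> K \<le> C * (f * L) \<and> f * L \<le> C * K))"

text \<open>The pointwise form of the chain in the theorem: a pair \<open>(0, 0)\<close> means that
  \<open>x\<close> belongs to a deeper stratum, and a point at which the list is exhausted has no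
  description.\<close>

primrec strat :: "real \<Rightarrow> 'p quot list \<Rightarrow> 'p \<Rightarrow> ennreal \<Rightarrow> bool" where
  "strat C [] x F = False"
| "strat C (T # Ts) x F = (quot_rel C (fst T x) (snd T x) F \<or> fst T x = 0 \<and> snd T x = 0
  \<and> strat C Ts x F)"

lemma quot_rel_mono:
  assumes "quot_rel C K L F" "C \<le> C'"
  shows "quot_rel C' K L F"
proof -
  have "K \<le> C' * (f * L)" if "K \<le> C * (f * L)" "0 \<le> f" "0 < L" for f
    using that assms(2) mult_right_mono[of C C' "f * L"] by simp
  moreover have "f * L \<le> C' * K" if "f * L \<le> C * K" "K > 0" for f
    using that assms(2) mult_right_mono[of C C' K] by linarith
  ultimately show ?thesis using assms(1) unfolding quot_rel_def by blast
qed

lemma strat_mono: "strat C Ts x F \<Longrightarrow> C \<le> C' \<Longrightarrow> strat C' Ts x F"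
  by (induction Ts) (auto intro: quot_rel_mono)

lemma strat_append1: "strat C Ts x F \<Longrightarrow> strat C (Ts @ Ts') x F"
  by (induction Ts) auto

lemma strat_append2: "(\<And>T. T \<in> set Ts \<Longrightarrow> fst T x = 0 \<and> snd T x = 0) \<Longrightarrow> strat C Ts' x F
  \<Longrightarrow> strat C (Ts @ Ts') x F"
  by (induction Ts) auto

lemma quot_rel_comparable:
  assumes "quot_rel C K L F" "F \<le> ennreal D * F'" "F' \<le> ennreal D * F" "1 \<le> D" "0 \<le> C"
  shows "quot_rel (C * D) K L F'"
proof -
  have K: "K > 0" using assms(1) by (simp add: quot_rel_def)
  show ?thesis
  proof (cases "F = top")
    case True
    then have "F' = top" using assms(2,4) by (auto simp: top_unique ennreal_mult_eq_top_iff)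
    then show ?thesis using assms(1) True by (auto simp: quot_rel_def)
  next
    case False
    then obtain f where f: "0 \<le> f" "F = ennreal f" "L > 0" "K \<le> C * (f * L)" "f * L \<le> C * K"
      using assms(1) by (auto simp: quot_rel_def)
    have "F' < top" using assms(3) f by (simp add: ennreal_mult_less_top flip: ennreal_mult'') 
        (metis ennreal_less_top ennreal_mult'' order.strict_trans1)
    then obtain f' where f': "0 \<le> f'" "F' = ennreal f'" by (cases F') auto
    have 1: "f \<le> D * f'" and 2: "f' \<le> D * f"
      using assms(2-4) f f' by (simp_all flip: ennreal_mult)
    have "C * (f * L) \<le> C * (D * f' * L)" using 1 f assms(5)
      by (intro mult_left_mono mult_right_mono) auto
    then have "K \<le> C * D * (f' * L)" using f(4) by (simp add: algebra_simps)
    moreover have "f' * L \<le> D * (f * L)" using 2 f mult_right_mono[of f' "D * f" L]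
      by (simp add: algebra_simps)
    moreover have "D * (f * L) \<le> D * (C * K)" using f assms(4) by (intro mult_left_mono) auto
    ultimately have "K \<le> C * D * (f' * L)" "f' * L \<le> C * D * K" by (simp_all add: algebra_simps)
    then show ?thesis using f f' K by (auto simp: quot_rel_def)
  qed
qed

lemma strat_comparable:
  assumes "strat C Ts x F" "F \<le> ennreal D * F'" "F' \<le> ennreal D * F" "1 \<le> D" "0 \<le> C"
  shows "strat (C * D) Ts x F'"
  using assms by (induction Ts) (auto intro: quot_rel_comparable)

text \<open>The second pair takes over where both summands are infinite, so that the first numerator
  vanishes.\<close>
definition pair_sum :: "'p quot \<Rightarrow> 'p quot \<Rightarrow> 'p quot list" where
  "pair_sum T T' = [(\<lambda>x. fst T x * snd T' x + fst T' x * snd T x, \<lambda>x. snd T x * snd T' x),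
     (\<lambda>x. fst T x * fst T' x, \<lambda>x. 0)]"

definition row_sum :: "'p quot \<Rightarrow> 'p quot list \<Rightarrow> 'p quot list" where
  "row_sum T Ts' = concat (map (pair_sum T) Ts')"

definition strat_sum :: "'p quot list \<Rightarrow> 'p quot list \<Rightarrow> 'p quot list" where
  "strat_sum Ts Ts' = concat (map (\<lambda>T. row_sum T Ts') Ts)"

lemma strat_pair_sum:
  assumes "quot_rel C (fst T x) (snd T x) F" "quot_rel C (fst T' x) (snd T' x) F'"
  shows "strat C (pair_sum T T') x (F + F')"
proof -
  define K L K' L' where defs: "K = fst T x" "L = snd T x" "K' = fst T' x" "L' = snd T' x"
  have rel: "quot_rel C K L F" "quot_rel C K' L' F'" using assms by (simp_all add: defs)
  then have K: "K > 0" "K' > 0" by (auto simp: quot_rel_def)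
  consider "L = 0" "L' = 0" "F = top" | "L = 0" "L' > 0" "F = top" | "L > 0" "L' = 0" "F' = top" |
    "L > 0" "L' > 0"
    using rel by (auto simp: quot_rel_def)
  then have "quot_rel C (K * L' + K' * L) (L * L') (F + F') \<or>
     (K * L' + K' * L = 0 \<and> L * L' = 0 \<and> quot_rel C (K * K') 0 (F + F'))"
  proof cases
    case 4
    obtain f where f: "0 \<le> f" "F = ennreal f" "K \<le> C * (f * L)" "f * L \<le> C * K"
      using rel(1) 4 by (auto simp: quot_rel_def)
    obtain f' where f': "0 \<le> f'" "F' = ennreal f'" "K' \<le> C * (f' * L')" "f' * L' \<le> C * K'"
      using rel(2) 4 by (auto simp: quot_rel_def)
    have "K * L' \<le> C * (f * L) * L'" "K' * L \<le> C * (f' * L') * L"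
         "f * L * L' \<le> C * K * L'" "f' * L' * L \<le> C * K' * L"
      using f f' 4 by (auto intro!: mult_right_mono)
    then have "K * L' + K' * L \<le> C * ((f + f') * (L * L'))" "(f + f') * (L * L')
      \<le> C * (K * L' + K' * L)"
      by (simp_all add: algebra_simps)
    moreover have "K * L' + K' * L > 0" using K 4 by (simp add: add_pos_pos)
    ultimately show ?thesis
      using 4 f f' unfolding quot_rel_def by (auto intro!: exI[of _ "f + f'"])
  qed (use K in \<open>auto simp: quot_rel_def\<close>)
  then show ?thesis by (simp add: pair_sum_def defs)
qed

text \<open>If one factor pair is \<open>(0, 0)\<close> at \<open>x\<close>, then every entry of its
  blocks vanishes there, so these blocks are skipped. In lexicographic order the first surviving
  block combines the valid pairs of the two lists.\<close>

lemma strat_row_sum: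
  assumes "quot_rel C (fst T x) (snd T x) F" "strat C Ts' x F'"
  shows "strat C (row_sum T Ts') x (F + F')"
  using assms(2)
proof (induction Ts')
  case (Cons T' Ts')
  show ?case
  proof (cases "quot_rel C (fst T' x) (snd T' x) F'")
    case True
    then show ?thesis using strat_pair_sum[OF assms(1) True]
      by (simp add: row_sum_def strat_append1)
  next
    case False
    then show ?thesis using Cons
      by (auto simp: row_sum_def pair_sum_def intro: strat_append2)
  qed
qed simp

lemma strat_strat_sum:
  assumes "strat C Ts x F" "strat C Ts' x F'"
  shows "strat C (strat_sum Ts Ts') x (F + F')"
  using assms(1)
proof (induction Ts)
  case (Cons T Ts)
  show ?case
  proof (cases "quot_rel C (fst T x) (snd T x) F")
    case True
    then show ?thesis using strat_row_sum[OF True assms(2)]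
      by (simp add: strat_sum_def strat_append1)
  next
    case False
    then show ?thesis using Cons
      by (auto simp: strat_sum_def row_sum_def pair_sum_def intro!: strat_append2)
  qed
qed simp

section \<open>Functions comparable to stratified quotients\<close>

definition stratifiable :: "'v set \<Rightarrow> ('v \<Rightarrow> complex) set \<Rightarrow> (('v \<Rightarrow> complex) \<Rightarrow> ennreal) \<Rightarrow> bool" where
  "stratifiable V \<Omega> F \<longleftrightarrow> (\<exists>Ts C. C \<ge> 1 \<and> (\<forall>T\<in>set Ts. app V \<Omega> (fst T) \<and> app V \<Omega> (snd T)) \<and>
     (\<forall>x\<in>\<Omega>. strat C Ts x (F x)))"

lemma stratifiable_add:
  assumes "stratifiable V \<Omega> F" "stratifiable V \<Omega> F'"
  shows "stratifiable V \<Omega> (\<lambda>x. F x + F' x)"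
proof -
  obtain Ts C where 1: "C \<ge> 1" "\<And>T. T \<in> set Ts \<Longrightarrow> app V \<Omega> (fst T) \<and> app V \<Omega> (snd T)"
     "\<And>x. x \<in> \<Omega> \<Longrightarrow> strat C Ts x (F x)" using assms(1) by (auto simp: stratifiable_def)
  obtain Ts' C' where 2: "C' \<ge> 1" "\<And>T. T \<in> set Ts' \<Longrightarrow> app V \<Omega> (fst T) \<and> app V \<Omega> (snd T)"
     "\<And>x. x \<in> \<Omega> \<Longrightarrow> strat C' Ts' x (F' x)" using assms(2) by (auto simp: stratifiable_def)
  have "strat (max C C') (strat_sum Ts Ts') x (F x + F' x)" if "x \<in> \<Omega>" for x
    using 1(3)[OF that] 2(3)[OF that] by (intro strat_strat_sum) (auto intro: strat_mono)
  moreover have "app V \<Omega> (fst T) \<and> app V \<Omega> (snd T)" if "T \<in> set (strat_sum Ts Ts')" for T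
    using that 1(2) 2(2) by (auto simp: strat_sum_def row_sum_def pair_sum_def intro!: app_add
      app_mult app_0)
  ultimately show ?thesis unfolding stratifiable_def using 1(1)
    by (intro exI[of _ "strat_sum Ts Ts'"] exI[of _ "max C C'"]) auto
qed

lemma stratifiable_sum:
  assumes "finite S" "S \<noteq> {}" "\<And>i. i \<in> S \<Longrightarrow> stratifiable V \<Omega> (F i)"
  shows "stratifiable V \<Omega> (\<lambda>x. \<Sum>i\<in>S. F i x)"
  using assms by (induction rule: finite_ne_induct) (auto intro: stratifiable_add)

lemma stratifiable_comparable:
  assumes "stratifiable V \<Omega> F" "1 \<le> D"
    "\<And>x. x \<in> \<Omega> \<Longrightarrow> F x \<le> ennreal D * F' x" "\<And>x. x \<in> \<Omega> \<Longrightarrow> F' x \<le> ennreal D * F x"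
  shows "stratifiable V \<Omega> F'"
proof -
  obtain Ts C where 1: "C \<ge> 1" "\<And>T. T \<in> set Ts \<Longrightarrow> app V \<Omega> (fst T) \<and> app V \<Omega> (snd T)"
     "\<And>x. x \<in> \<Omega> \<Longrightarrow> strat C Ts x (F x)" using assms(1) by (auto simp: stratifiable_def)
  have "strat (C * D) Ts x (F' x)" if "x \<in> \<Omega>" for x
    using 1 assms that by (intro strat_comparable[of C Ts x "F x"]) auto
  moreover have "1 \<le> C * D" using 1 assms(2) mult_mono[of 1 C 1 D] by simp
  ultimately show ?thesis unfolding stratifiable_def using 1 by blast
qed

text \<open>Where \<open>n\<close> and \<open>d\<close> both vanish, the extended reals give
  \<open>0 / 0 = 0\<close> and the value is \<open>p\<close>, which is what the second pair
  \<open>(p, 1)\<close> records. The positive summand \<open>p\<close> keeps the numerator of the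
  first pair positive as soon as \<open>d > 0\<close>, even if \<open>n = 0\<close>.\<close>

lemma stratifiable_base:
  assumes "app V \<Omega> p" "app V \<Omega> n" "app V \<Omega> d" "\<And>x. x \<in> \<Omega> \<Longrightarrow> 0 < p x"
  shows "stratifiable V \<Omega> (\<lambda>x. ennreal (p x) + ennreal (n x) / ennreal (d x))"
  unfolding stratifiable_def
proof (intro exI[of _ "[(\<lambda>x. p x * d x + n x, d), (p, \<lambda>x. 1)]"] exI[of _ 1] conjI ballI)
  fix x assume x: "x \<in> \<Omega>"
  have nn: "0 \<le> n x" "0 \<le> d x" "0 < p x" using assms x by (auto intro: app_nonneg)
  consider "d x = 0" "n x = 0" | "d x = 0" "n x > 0" | "d x > 0" using nn by linarith
  then show "strat 1 [(\<lambda>x. p x * d x + n x, d), (p, \<lambda>x. 1)] x (ennreal (p x) + ennreal (n x)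
    / ennreal (d x))"
  proof cases
    case 3
    then have "ennreal (p x) + ennreal (n x) / ennreal (d x) = ennreal (p x + n x / d x)"
      using nn by (simp add: divide_ennreal)
    moreover have "(p x + n x / d x) * d x = p x * d x + n x" using 3 by (simp add: algebra_simps)
    moreover have "p x * d x + n x > 0" using nn 3 by (simp add: add_pos_nonneg)
    ultimately show ?thesis using 3 nn by (auto simp: quot_rel_def intro!: exI[of _
      "p x + n x / d x"])
  qed (use nn in \<open>auto simp: quot_rel_def ennreal_divide_zero intro!: exI[of _ "p x"]\<close>)
qed (use assms in \<open>auto intro!: app_add app_mult app_1\<close>)

text \<open>A mediant argument: numerators comparable to \<open>F\<close> times their denominators
  remain so after summation, and points \<open>h k\<close> at which the pair is
  \<open>(0, 0)\<close> add nothing. If the pair vanishes at all these points, all of them move on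
  to the next pair together.\<close>

lemma strat_average:
  assumes "finite S" "S \<noteq> {}" "\<And>k. k \<in> S \<Longrightarrow> strat C Ts (h k) F"
  shows "strat C (map (\<lambda>T. (\<lambda>x. \<Sum>k\<in>S. fst T (h k), \<lambda>x. \<Sum>k\<in>S. snd T (h k))) Ts) x F"
  using assms(3)
proof (induction Ts)
  case Nil
  then show ?case using assms(2) by auto
next
  case (Cons T Ts)
  show ?case
  proof (cases "\<exists>k\<in>S. fst T (h k) > 0")
    case True
    have *: "quot_rel C (fst T (h k)) (snd T (h k)) F \<or> fst T (h k) = 0 \<and> snd T (h k) = 0"
      if "k \<in> S" for k
      using Cons.prems[OF that] by auto
    then have nn: "0 \<le> fst T (h k)" "0 \<le> snd T (h k)" if "k \<in> S" for k
      using that by (force simp: quot_rel_def)+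
    have K: "(\<Sum>k\<in>S. fst T (h k)) > 0"
      using True nn assms(1) by (auto intro: sum_pos2)
    show ?thesis
    proof (cases "F = top")
      case top: True
      have "snd T (h k) = 0" if "k \<in> S" for k
        using *[OF that] top by (auto simp: quot_rel_def)
      then show ?thesis using K top by (simp add: quot_rel_def)
    next
      case False
      then obtain f where f: "0 \<le> f" "F = ennreal f" by (cases F) auto
      have **: "fst T (h k) \<le> C * (f * snd T (h k))" "f * snd T (h k) \<le> C * fst T (h k)"
        if "k \<in> S" for k
        using *[OF that] f by (auto simp: quot_rel_def)
      obtain k where k: "k \<in> S" "fst T (h k) > 0" using True by blast
      have "snd T (h k) > 0" using *[OF k(1)] k f by (auto simp: quot_rel_def)
      then have L: "(\<Sum>k\<in>S. snd T (h k)) > 0"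
        using k nn assms(1) by (auto intro: sum_pos2)
      have "(\<Sum>k\<in>S. fst T (h k)) \<le> C * (f * (\<Sum>k\<in>S. snd T (h k)))" "f * (\<Sum>k\<in>S. snd T (h k))
        \<le> C * (\<Sum>k\<in>S. fst T (h k))"
        unfolding sum_distrib_left by (intro sum_mono **; simp)+
      then show ?thesis using K L f by (auto simp: quot_rel_def)
    qed
  next
    case False
    then have "fst T (h k) = 0 \<and> snd T (h k) = 0 \<and> strat C Ts (h k) F" if "k \<in> S" for k
      using Cons.prems[OF that] that by (auto simp: quot_rel_def)
    then show ?thesis using Cons.IH by simp
  qed
qed

text \<open>\<open>F\<close> does not see the roots, so the descriptions at all arrangements of the
  roots describe one and the same value and may be averaged. The averaged entries are symmetric in
  the roots, so that \<open>app_eliminate\<close> applies.\<close>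

lemma stratifiable_eliminate:
  fixes G :: "('v \<Rightarrow> complex) \<Rightarrow> complex poly" and rt :: "('v \<Rightarrow> complex) \<Rightarrow> nat \<Rightarrow> complex"
    and lo hi :: real
  assumes G: "\<And>i. (\<lambda>x. coeff (G x) i) \<in> polyfun \<int> V"
    and roots: "\<And>b. b \<in> \<Omega> \<Longrightarrow> splits n (G b) (rt b)"
    and lo: "0 < lo" "\<And>b. b \<in> \<Omega> \<Longrightarrow> lo \<le> cmod (coeff (G b) n)"
    and hi: "\<And>b. b \<in> \<Omega> \<Longrightarrow> cmod (coeff (G b) n) \<le> hi"
    and \<Omega>': "\<And>b \<alpha>. b \<in> \<Omega> \<Longrightarrow> splits n (G b) \<alpha> \<Longrightarrow> case_sum b \<alpha> \<in> \<Omega>'"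
    and F: "stratifiable (Inl ` V \<union> Inr ` {..<n}) \<Omega>' (\<lambda>x. F (\<lambda>v. x (Inl v)))"
  shows "stratifiable V \<Omega> F"
proof -
  let ?arr = "\<lambda>b ks. case_sum b (\<lambda>i. rt b (ks ! i))"
  have sp: "splits n (G b) (\<lambda>i. rt b (ks ! i))" if "b \<in> \<Omega>" "ks \<in> dlists n n" for b ks
  proof -
    have "card (set ks) = n" using that(2) by (simp add: dlists_def distinct_card)
    then have "set ks = {..<n}" using that(2) by (intro card_subset_eq) (auto simp: dlists_def)
    then have "bij_betw ((!) ks) {..<n} {..<n}"
      using that(2) by (intro bij_betw_nth) (auto simp: dlists_def)
    then have "(\<Prod>k<n. [:- rt b (ks ! k), 1:]) = (\<Prod>k<n. [:- rt b k, 1:])"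
      by (rule prod.reindex_bij_betw)
    then show ?thesis using roots[OF that(1)] by (simp add: splits_def)
  qed
  have mem: "?arr b ks \<in> \<Omega>'" if "b \<in> \<Omega>" "ks \<in> dlists n n" for b ks
    using \<Omega>'[OF that(1) sp[OF that]] .
  obtain Ts C where Ts: "C \<ge> 1"
     "\<And>T. T \<in> set Ts \<Longrightarrow> app (Inl ` V \<union> Inr ` {..<n}) \<Omega>' (fst T)
       \<and> app (Inl ` V \<union> Inr ` {..<n}) \<Omega>' (snd T)"
     "\<And>x. x \<in> \<Omega>' \<Longrightarrow> strat C Ts x (F (\<lambda>v. x (Inl v)))" using F by (auto simp: stratifiable_def)
  let ?Ts = "map (\<lambda>T. (\<lambda>b. \<Sum>ks\<in>dlists n n. fst T (?arr b ks), \<lambda>b. \<Sum>ks\<in>dlists n n. snd T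
    (?arr b ks))) Ts"
  note el = app_eliminate[of G V \<Omega> n rt lo hi, OF G roots lo hi _ mem]
  have "app V \<Omega> (fst T) \<and> app V \<Omega> (snd T)" if "T \<in> set ?Ts" for T
    using that Ts(2) by (auto intro!: el)
  moreover have "strat C ?Ts b (F b)" if b: "b \<in> \<Omega>" for b
  proof -
    have "strat C Ts (?arr b ks) (F b)" if "ks \<in> dlists n n" for ks
      using Ts(3)[OF mem[OF b that]] by simp
    moreover have "[0..<n] \<in> dlists n n" by (auto simp: dlists_def)
    ultimately have "strat C (map (\<lambda>T. (\<lambda>x. \<Sum>k\<in>dlists n n. fst T
      (?arr b k), \<lambda>x. \<Sum>k\<in>dlists n n. snd T (?arr b k))) Ts) b (F b)"
      by (intro strat_average finite_dlists) auto
    moreover have "strat C (map (\<lambda>T. (\<lambda>x. \<Sum>k\<in>dlists n n. fst T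
      (?arr b k), \<lambda>x. \<Sum>k\<in>dlists n n. snd T (?arr b k))) Ts) b F'
       = strat C ?Ts b F'" for F'
      by (induction Ts) auto
    ultimately show ?thesis by simp
  qed
  ultimately show ?thesis unfolding stratifiable_def using Ts(1) by blast
qed

section \<open>From quotients to absolute rational powers\<close>

definition pre_ARP :: "'v set \<Rightarrow> 'v arp \<Rightarrow> bool" where
  "pre_ARP V T = (case T of (Ps, e, Qs, d) \<Rightarrow>
      set Ps \<subseteq> polyfun \<int> V \<and> set Qs \<subseteq> polyfun \<int> V \<and> e > 0 \<and> d \<ge> 0)"

text \<open>With a positive exponent the convention \<open>apow 0 0 = 1\<close> does not intervene,
  so the zero set of the numerator is an algebraic variety. This is how the sets of the chain become
  algebraic.\<close>

lemma arpK_eq_0_iff: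
  assumes "pre_ARP V (Ps, e, Qs, d)"
  shows "arpK (Ps, e, Qs, d) x = 0 \<longleftrightarrow> (\<forall>p\<in>set Ps. p x = 0)"
proof -
  have "arpK (Ps, e, Qs, d) x = 0 \<longleftrightarrow> (\<Sum>p\<leftarrow>Ps. (cmod (p x))\<^sup>2) = 0"
    using assms by (auto simp: pre_ARP_def arpK_def abs_poly_power_def apow_def)
  also have "\<dots> \<longleftrightarrow> (\<forall>p\<in>set Ps. p x = 0)"
    by (subst sum_list_nonneg_eq_0_iff) auto
  finally show ?thesis .
qed

definition comparable :: "real \<Rightarrow> ennreal \<Rightarrow> ennreal \<Rightarrow> bool" where
  "comparable D F G \<longleftrightarrow> G \<le> ennreal D * F \<and> F \<le> ennreal D * G"

lemma comparable_ge:
  assumes "comparable D F G" "D > 0"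
  shows "ennreal (1 / D) * G \<le> F"
proof -
  have "ennreal (1 / D) * G \<le> ennreal (1 / D) * (ennreal D * F)"
    using assms by (intro mult_left_mono) (auto simp: comparable_def)
  also have "\<dots> = F" using assms(2) by (simp flip: mult.assoc ennreal_mult)
  finally show ?thesis .
qed

lemma comparable_mono:
  assumes "comparable D F G" "D \<le> D'"
  shows "comparable D' F G"
proof -
  have "ennreal D * H \<le> ennreal D' * H" for H
    using assms(2) by (intro mult_right_mono ennreal_leI) auto
  then show ?thesis using assms(1) unfolding comparable_def by (meson order_trans)
qed

text \<open>The pair is represented by \<open>K\<^sup>2 / (L K)\<close>, so that the denominator vanishes with the numerator
  on the whole parameter space and not only on \<open>\<Omega>\<close>.\<close>
lemma arp_of_pair:
  assumes "app V \<Omega> K" "app V \<Omega> L" "C \<ge> 1"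
  shows "\<exists>T D. D \<ge> 1 \<and> pre_ARP V T \<and> (\<forall>b. arpK T b = 0 \<longrightarrow> arpL T b = 0) \<and>
    (\<forall>b\<in>\<Omega>. K b = 0 \<longrightarrow> arpK T b = 0) \<and>
    (\<forall>b\<in>\<Omega>. \<forall>F. quot_rel C (K b) (L b) F \<longrightarrow> arpK T b \<noteq> 0 \<and> comparable D F (arp_val T b))"
proof -
  obtain gK gL m where g: "is_sos V gK" "is_sos V gL" "m \<ge> (1::nat)"
    "comp_on \<Omega> K (\<lambda>x. gK x powr (1 / real m))" "comp_on \<Omega> L (\<lambda>x. gL x powr (1 / real m))"
    using assms(1,2) by (rule app_common)
  obtain ps where ps: "set ps \<subseteq> polyfun \<int> V" "gK = (\<lambda>x. \<Sum>p\<leftarrow>ps. (cmod (p x))\<^sup>2)"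
    using g(1) by (auto simp: is_sos_def)
  obtain qs where qs: "set qs \<subseteq> polyfun \<int> V" "(\<lambda>x. gL x * gK x) = (\<lambda>x. \<Sum>p\<leftarrow>qs. (cmod (p x))\<^sup>2)"
    using is_sos_mult[OF g(2,1)] by (auto simp: is_sos_def)
  define k where "k x = gK x powr (1 / real m)" for x
  define l where "l x = gL x powr (1 / real m)" for x
  \<comment> \<open>\<open>apow\<close> halves its exponent: \<open>4 / m\<close> yields
    \<open>gK powr (2 / m)\<close>, the square of \<open>k\<close>, and \<open>2 / m\<close> yields
    \<open>(gL gK) powr (1 / m)\<close>, the product \<open>l k\<close>.\<close>
  define T where "T = (ps, 4 / of_nat m :: rat, qs, 2 / of_nat m :: rat)"
  have nn: "0 \<le> k x" "0 \<le> l x" for x by (simp_all add: k_def l_def)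
  have K: "arpK T x = (k x)\<^sup>2" for x
  proof -
    have "arpK T x = gK x powr (2 / real m)"
      using g(3) by (simp add: T_def arpK_def abs_poly_power_def apow_def ps of_rat_divide)
    also have "\<dots> = k x powr 2" by (simp add: k_def powr_powr)
    finally show ?thesis using nn by (simp add: powr_numeral)
  qed
  have L: "arpL T x = l x * k x" for x
  proof -
    have "arpL T x = (gL x * gK x) powr (1 / real m)"
      using g(3) by (simp add: T_def arpL_def abs_poly_power_def apow_def of_rat_divide flip:
        fun_cong[OF qs(2), of x])
    then show ?thesis using is_sos_nonneg[OF g(1)] is_sos_nonneg[OF g(2)]
      by (simp add: k_def l_def powr_mult)
  qed
  obtain C1 where C1: "C1 > 0" "\<And>x. x \<in> \<Omega> \<Longrightarrow> K x \<le> C1 * k x \<and> k x \<le> C1 * K x"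
    using g(4) by (auto simp: comp_on_def k_def)
  obtain C2 where C2: "C2 > 0" "\<And>x. x \<in> \<Omega> \<Longrightarrow> L x \<le> C2 * l x \<and> l x \<le> C2 * L x"
    using g(5) by (auto simp: comp_on_def l_def)
  define D where "D = max 1 (C * C1 * C2)"
  have main: "arpK T b \<noteq> 0 \<and> comparable D F (arp_val T b)"
    if b: "b \<in> \<Omega>" and rel: "quot_rel C (K b) (L b) F" for b F
  proof -
    have Kb: "K b > 0" using rel by (simp add: quot_rel_def)
    then have k: "k b > 0" using C1(2)[OF b] C1(1) by (smt (verit) mult_nonneg_nonpos)
    have "comparable D F (arp_val T b)"
    proof (cases "F = top")
      case True
      then have "L b = 0" using rel by (auto simp: quot_rel_def)
      then have "l b = 0" using C2(2)[OF b] nn[of b] by simp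
      then have "arp_val T b = top" using k by (simp add: arp_val_def K L ennreal_divide_zero)
      then show ?thesis using True by (simp add: comparable_def D_def ennreal_mult_top)
    next
      case False
      then obtain f where f: "0 \<le> f" "F = ennreal f" "L b > 0" "K b \<le> C * (f * L b)" "f * L b
        \<le> C * K b"
        using rel by (auto simp: quot_rel_def)
      have l: "l b > 0" using C2(2)[OF b] C2(1) f(3) by (smt (verit) mult_nonneg_nonpos)
      have val: "arp_val T b = ennreal (k b / l b)"
        using k l by (simp add: arp_val_def K L divide_ennreal power2_eq_square)
      have "k b \<le> C1 * K b" using C1(2)[OF b] by simp
      also have "\<dots> \<le> C1 * (C * (f * (C2 * l b)))"
        using f(4) C1 assms(3) f(1) C2(2)[OF b]
        by (intro mult_left_mono order_trans[OF f(4)]) auto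
      finally have "k b / l b \<le> (C * C1 * C2) * f" using l by (simp add: field_simps)
      also have "\<dots> \<le> D * f" using f by (intro mult_right_mono) (auto simp: D_def)
      finally have 1: "k b / l b \<le> D * f" .
      have "f * l b \<le> f * (C2 * L b)" using C2(2)[OF b] f by (intro mult_left_mono) auto
      also have "\<dots> = C2 * (f * L b)" by simp
      also have "\<dots> \<le> C2 * (C * (C1 * k b))"
        using C2 C1(2)[OF b] assms(3) by (intro mult_left_mono order_trans[OF f(5)]) auto
      finally have "f \<le> (C * C1 * C2) * (k b / l b)" using l by (simp add: field_simps)
      also have "\<dots> \<le> D * (k b / l b)" using k l by (intro mult_right_mono) (auto simp: D_def)
      finally have 2: "f \<le> D * (k b / l b)" .
      have D0: "0 \<le> D" by (simp add: D_def)
      show ?thesis unfolding comparable_def val f(2)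
        using ennreal_leI[OF 1] ennreal_leI[OF 2]
          ennreal_mult[OF D0 f(1)] ennreal_mult[OF D0, of "k b / l b"] k l
            by (simp del: ennreal_le_iff)
    qed
    then show ?thesis using k by (simp add: K)
  qed
  show ?thesis
  proof (intro exI[of _ T] exI[of _ D] conjI ballI allI impI)
    show "pre_ARP V T" using ps qs g by (auto simp: pre_ARP_def T_def)
    show "arpL T b = 0" if "arpK T b = 0" for b using that by (simp add: K L)
    show "arpK T b = 0" if "b \<in> \<Omega>" "K b = 0" for b
      using C1(2)[OF that(1)] that(2) nn[of b] by (simp add: K)
  qed (use main in \<open>auto simp: D_def\<close>)
qed

text \<open>The counterpart of \<open>strat\<close> on the whole parameter set: outside
  \<open>\<Omega>\<close> only the pattern of zeros is prescribed, because the chain must exhaust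
  all parameters while the estimate concerns \<open>\<Omega>\<close> alone.\<close>

primrec resolves :: "real \<Rightarrow> ('v \<Rightarrow> complex) set \<Rightarrow> (('v \<Rightarrow> complex) \<Rightarrow> ennreal) \<Rightarrow> 'v arp list \<Rightarrow>
  ('v \<Rightarrow> complex) \<Rightarrow> bool" where
  "resolves D \<Omega> F [] b = False"
| "resolves D \<Omega> F (T # Ts) b = (arpK T b \<noteq> 0 \<and> (b \<in> \<Omega> \<longrightarrow> comparable D (F b) (arp_val T b)) \<or>
     arpK T b = 0 \<and> arpL T b = 0 \<and> resolves D \<Omega> F Ts b)"

lemma resolves_mono: "resolves D \<Omega> F Ts b \<Longrightarrow> D \<le> D' \<Longrightarrow> resolves D' \<Omega> F Ts b"
  by (induction Ts) (auto intro: comparable_mono)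

lemma arps_of_strat:
  assumes "\<forall>T\<in>set Ts. app V \<Omega> (fst T) \<and> app V \<Omega> (snd T)" "C \<ge> 1"
  shows "\<exists>As D. (\<forall>A\<in>set As. pre_ARP V A) \<and> (\<forall>b. b \<notin> \<Omega> \<or> strat C Ts b (F b) \<longrightarrow> resolves D \<Omega> F As b)"
  using assms(1)
proof (induction Ts)
  case Nil
  show ?case
  \<comment> \<open>The numerator 1 closes the list at points outside \<open>\<Omega>\<close> where
    all earlier pairs vanish; inside \<open>\<Omega>\<close> an exhausted list cannot occur.\<close>
  proof (intro exI[of _ "[([\<lambda>x. 1], 1, [], 1)]"] exI[of _ 1] conjI ballI allI impI)
    fix b assume "b \<notin> \<Omega> \<or> strat C [] b (F b)"
    then show "resolves 1 \<Omega> F [([\<lambda>x. 1], 1, [], 1)] b"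
      by (simp add: arpK_def abs_poly_power_def apow_def)
  qed (auto simp: pre_ARP_def intro: polyfun.intros)
next
  case (Cons T Ts)
  then obtain As D where 1: "\<forall>A\<in>set As. pre_ARP V A"
    "\<And>b. b \<notin> \<Omega> \<or> strat C Ts b (F b) \<Longrightarrow> resolves D \<Omega> F As b" by auto
  obtain A D' where 2: "D' \<ge> 1" "pre_ARP V A" "\<And>b. arpK A b = 0 \<Longrightarrow> arpL A b = 0"
    "\<And>b. b \<in> \<Omega> \<Longrightarrow> fst T b = 0 \<Longrightarrow> arpK A b = 0"
    "\<And>b F. b \<in> \<Omega> \<Longrightarrow> quot_rel C (fst T b) (snd T b) F \<Longrightarrow> arpK A b \<noteq> 0 \<and> comparable D' F (arp_val A b)"
    using arp_of_pair[of V \<Omega> "fst T" "snd T" C] Cons.prems assms(2) by auto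
  have "resolves (max D D') \<Omega> F (A # As) b" if b: "b \<notin> \<Omega> \<or> strat C (T # Ts) b (F b)" for b
  proof (cases "b \<in> \<Omega>")
    case True
    then have "quot_rel C (fst T b) (snd T b) (F b) \<or> fst T b = 0 \<and> snd T b = 0
      \<and> strat C Ts b (F b)"
      using b by auto
    then show ?thesis
    proof
      assume "quot_rel C (fst T b) (snd T b) (F b)"
      from 2(5)[OF True this] show ?thesis by (auto intro: comparable_mono)
    next
      assume "fst T b = 0 \<and> snd T b = 0 \<and> strat C Ts b (F b)"
      then have "resolves D \<Omega> F As b" "arpK A b = 0" "arpL A b = 0" using 2(3,4) True 1(2) by auto
      then show ?thesis by (simp add: resolves_mono[of D])
    qed
  next
    case False
    then show ?thesis using 1(2)[of b] 2(3)[of b] by (auto intro: resolves_mono)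
  qed
  then show ?case using 1 2 by (intro exI[of _ "A # As"] exI[of _ "max D D'"]) auto
qed

section \<open>The chain of algebraic subsets\<close>

definition is_chain :: "'v set \<Rightarrow> ('v \<Rightarrow> complex) set \<Rightarrow> ('v \<Rightarrow> complex) set \<Rightarrow>
  (('v \<Rightarrow> complex) \<Rightarrow> ennreal) \<Rightarrow> real \<Rightarrow>
    ('v \<Rightarrow> complex) set \<Rightarrow> nat \<Rightarrow> (nat \<Rightarrow> ('v \<Rightarrow> complex) set) \<Rightarrow> (nat \<Rightarrow> 'v arp) \<Rightarrow> bool" where
  "is_chain V B \<Omega> F D U NN Us T \<longleftrightarrow> Us 0 = U \<and> Us NN = {} \<and> (\<forall>k<NN. Us (Suc k) \<subset> Us k) \<and>
    (\<forall>k\<le>NN. \<exists>S. is_variety V S \<and> Us k = B \<inter> S) \<and> (\<forall>k<NN. is_ARP \<int> V (T k)) \<and>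
    (\<forall>k<NN. \<forall>b\<in>Us k - Us (Suc k). arpK (T k) b \<noteq> 0) \<and>
    (\<forall>k<NN. \<forall>b\<in>Us k - Us (Suc k). b \<in> \<Omega> \<longrightarrow> comparable D (F b) (arp_val (T k) b)) \<and>
    (\<forall>k<NN. Us (Suc k) = {b \<in> Us k. arpK (T k) b = 0} \<and>
      Us (Suc k) = {b \<in> Us k. arpK (T k) b = 0 \<and> arpL (T k) b = 0})"

text \<open>Each ARP cuts out the zeros of its numerator. If this removes nothing from
  \<open>U\<close>, the ARP is dropped, which keeps the inclusions strict; otherwise some point of
  \<open>U\<close> shows that a numerator polynomial is nonzero, as \<open>is_ARP\<close> demands.
  The start \<open>U\<close> is kept apart from \<open>B\<close> so that the induction can resume at
  the smaller set.\<close>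

lemma chain_of_resolves:
  assumes "\<forall>A\<in>set As. pre_ARP V A" "is_variety V S" "U = B \<inter> S" "\<forall>b\<in>U. resolves D \<Omega> F As b"
  shows "\<exists>(NN::nat) Us T. is_chain V B \<Omega> F D U NN Us T"
  using assms
proof (induction As arbitrary: U S)
  case Nil
  then have "U = {}" by auto
  show ?case unfolding is_chain_def
    by (rule exI[of _ 0], rule exI[of _ "\<lambda>_. U"], rule exI[of _ "\<lambda>_. undefined"])
       (use \<open>U = {}\<close> Nil.prems(2,3) in auto)
next
  case (Cons A As)
  obtain Ps e Qs d where A: "A = (Ps, e, Qs, d)" by (cases A)
  define U' where "U' = {b \<in> U. arpK A b = 0}"
  have pre: "pre_ARP V (Ps, e, Qs, d)" using Cons.prems(1) A by simp
  obtain ps where ps: "set ps \<subseteq> polyfun UNIV V" "S = {x. \<forall>p\<in>set ps. p x = 0}"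
    using Cons.prems(2) by (auto simp: is_variety_def)
  define S' where "S' = {x. \<forall>p\<in>set (ps @ Ps). p x = 0}"
  have S': "is_variety V S'"
    unfolding is_variety_def S'_def
    by (rule exI[of _ "ps @ Ps"]) (use ps(1) pre in \<open>auto simp: pre_ARP_def intro: polyfun_mono\<close>)
  have U': "U' = B \<inter> S'"
    unfolding U'_def Cons.prems(3) A arpK_eq_0_iff[OF pre] ps(2) S'_def by auto
  have res: "\<forall>b\<in>U'. resolves D \<Omega> F As b" and U'L: "\<forall>b\<in>U'. arpL A b = 0"
    using Cons.prems(4) by (auto simp: U'_def)
  have IH: "\<exists>(NN::nat) Us T. is_chain V B \<Omega> F D U' NN Us T"
    by (rule Cons.IH[OF _ S' U' res]) (use Cons.prems in auto)
  show ?case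
  proof (cases "U' = U")
    case True
    show ?thesis using IH unfolding True .
  next
    case False
    then have sub: "U' \<subset> U" by (auto simp: U'_def)
    then obtain b where "b \<in> U" "arpK A b \<noteq> 0" by (auto simp: U'_def)
    then have "\<exists>p\<in>set Ps. p b \<noteq> 0" using arpK_eq_0_iff[OF pre] A by auto
    then obtain p where "p \<in> set Ps" "p b \<noteq> 0" by blast
    then have "\<exists>p\<in>set Ps. p \<noteq> (\<lambda>_. 0)" by (intro bexI[of _ p]) (auto dest: fun_cong[of _ _ b])
    then have arp: "is_ARP \<int> V A" using pre A by (simp add: is_ARP_def pre_ARP_def)
    have est: "\<forall>b\<in>U - U'. arpK A b \<noteq> 0" "\<forall>b\<in>U - U'. b \<in> \<Omega> \<longrightarrow> comparable D (F b) (arp_val A b)"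
      using Cons.prems(4) by (auto simp: U'_def)
    have eq: "U' = {b \<in> U. arpK A b = 0} \<and> U' = {b \<in> U. arpK A b = 0 \<and> arpL A b = 0}"
      using U'L by (auto simp: U'_def)
    obtain NN :: nat and Us T where *: "Us 0 = U'" "Us NN = {}" "\<forall>k<NN. Us (Suc k) \<subset> Us k"
      "\<forall>k\<le>NN. \<exists>S. is_variety V S \<and> Us k = B \<inter> S" "\<forall>k<NN. is_ARP \<int> V (T k)"
      "\<forall>k<NN. \<forall>b\<in>Us k - Us (Suc k). arpK (T k) b \<noteq> 0"
      "\<forall>k<NN. \<forall>b\<in>Us k - Us (Suc k). b \<in> \<Omega> \<longrightarrow> comparable D (F b) (arp_val (T k) b)"
      "\<forall>k<NN. Us (Suc k) = {b \<in> Us k. arpK (T k) b = 0} \<and>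
      Us (Suc k) = {b \<in> Us k. arpK (T k) b = 0 \<and> arpL (T k) b = 0}"
      using IH unfolding is_chain_def by (elim exE conjE) (rule that)
    let ?Us = "case_nat U Us" and ?T = "case_nat A T"
    have c1: "?Us (Suc k) \<subset> ?Us k" if "k < Suc NN" for k using that *(1,3) sub by (cases k) auto
    have c2: "is_ARP \<int> V (?T k)" if "k < Suc NN" for k using that *(5) arp by (cases k) auto
    have c3: "\<forall>b\<in>?Us k - ?Us (Suc k). arpK (?T k) b \<noteq> 0" if "k < Suc NN" for k
      using that *(1,6) est(1) by (cases k) auto
    have c4: "\<forall>b\<in>?Us k - ?Us (Suc k). b \<in> \<Omega> \<longrightarrow> comparable D (F b) (arp_val (?T k) b)"
      if "k < Suc NN" for k
      using that *(1,7) est(2) by (cases k) auto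
    have c5: "?Us (Suc k) = {b \<in> ?Us k. arpK (?T k) b = 0} \<and>
       ?Us (Suc k) = {b \<in> ?Us k. arpK (?T k) b = 0 \<and> arpL (?T k) b = 0}" if "k < Suc NN" for k
    proof (cases k)
      case 0
      then have eqs: "?Us (Suc k) = U'" "?Us k = U" "?T k = A" using *(1) by simp_all
      show ?thesis unfolding eqs by (rule eq)
    next
      case (Suc j)
      then have eqs: "?Us (Suc k) = Us (Suc j)" "?Us k = Us j" "?T k = T j" and j: "j < NN"
        using that by simp_all
      show ?thesis unfolding eqs using *(8) j by blast
    qed
    have c6: "\<exists>S. is_variety V S \<and> ?Us k = B \<inter> S" if "k \<le> Suc NN" for k
      using that *(4) Cons.prems(2,3) by (cases k) auto
    have c7: "?Us 0 = U" "?Us (Suc NN) = {}" using *(2) by simp_all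
    show ?thesis unfolding is_chain_def
    proof (rule exI[of _ "Suc NN"], rule exI[of _ ?Us], rule exI[of _ ?T], intro conjI)
      show "\<forall>k<Suc NN. ?Us (Suc k) = {b \<in> ?Us k. arpK (?T k) b = 0} \<and>
         ?Us (Suc k) = {b \<in> ?Us k. arpK (?T k) b = 0 \<and> arpL (?T k) b = 0}"
        by (intro allI impI c5)
    qed (intro allI impI c1 c2 c3 c4 c6 c7; assumption)+
  qed
qed

lemma chain_of_stratifiable:
  assumes "stratifiable V \<Omega> F"
  shows "\<exists>NN Us T D. D > 0 \<and> is_chain V B \<Omega> F D B NN Us T"
proof -
  obtain Ts C where Ts: "C \<ge> 1" "\<forall>T\<in>set Ts. app V \<Omega> (fst T) \<and> app V \<Omega> (snd T)"
     "\<And>x. x \<in> \<Omega> \<Longrightarrow> strat C Ts x (F x)" using assms by (auto simp: stratifiable_def)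
  obtain As D where As: "\<forall>A\<in>set As. pre_ARP V A"
    "\<And>b. b \<notin> \<Omega> \<or> strat C Ts b (F b) \<Longrightarrow> resolves D \<Omega> F As b"
    using arps_of_strat[OF Ts(2,1), of F] by blast
  define D' where "D' = max 1 D"
  have res: "\<forall>b\<in>B. resolves D' \<Omega> F As b"
  proof
    fix b
    have "resolves D \<Omega> F As b" by (rule As(2)) (use Ts(3) in blast)
    then show "resolves D' \<Omega> F As b" by (rule resolves_mono) (simp add: D'_def)
  qed
  have "is_variety V (UNIV :: ('a \<Rightarrow> complex) set)"
    unfolding is_variety_def by (rule exI[of _ "[]"]) auto
  from chain_of_resolves[OF As(1) this Int_UNIV_right[symmetric] res]
  show ?thesis by (metis D'_def max.strict_coboundedI1 zero_less_one)
qed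

section \<open>Local size of polynomials\<close>

text \<open>Unlike \<open>powr\<close>, this satisfies \<open>pw 0 0 = 1\<close>.\<close>
definition pw :: "real \<Rightarrow> real \<Rightarrow> real" where
  "pw x e = (if e = 0 then 1 else x powr e)"

lemma pw_nonneg: "0 \<le> pw x e"
  by (simp add: pw_def)

lemma pw_mono: "0 \<le> x \<Longrightarrow> x \<le> y \<Longrightarrow> 0 \<le> e \<Longrightarrow> pw x e \<le> pw y e"
  by (simp add: pw_def powr_mono2)

lemma pw_mult: "0 \<le> x \<Longrightarrow> 0 \<le> y \<Longrightarrow> pw (x * y) e = pw x e * pw y e"
  by (simp add: pw_def powr_mult)

lemma pw_pos: "0 < x \<Longrightarrow> pw x e = x powr e"
  by (simp add: pw_def)

lemma pw_sum_le:
  assumes "finite S" "S \<noteq> {}" "\<And>i. i \<in> S \<Longrightarrow> 0 \<le> x i" "0 \<le> e"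
  shows "pw (\<Sum>i\<in>S. x i) e \<le> real (card S) powr e * (\<Sum>i\<in>S. pw (x i) e)"
proof -
  have c: "0 < real (card S)" using assms by (simp add: card_gt_0_iff)
  obtain i where i: "i \<in> S" "\<And>j. j \<in> S \<Longrightarrow> x j \<le> x i"
    using obtains_MAX[OF assms(1,2)] by (metis Max_ge assms(1) finite_imageI image_eqI)
  have "(\<Sum>i\<in>S. x i) \<le> real (card S) * x i" using i by (intro sum_bounded_above) auto
  then have "pw (\<Sum>i\<in>S. x i) e \<le> pw (real (card S) * x i) e"
    using assms by (intro pw_mono sum_nonneg) auto
  also have "\<dots> = real (card S) powr e * pw (x i) e"
    using c assms(3)[OF i(1)] by (simp add: pw_mult pw_pos)
  also have "\<dots> \<le> real (card S) powr e * (\<Sum>i\<in>S. pw (x i) e)"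
    using assms i by (intro mult_left_mono member_le_sum) (auto simp: pw_nonneg)
  finally show ?thesis .
qed

section \<open>Taylor coefficients as a measure of local size\<close>

definition peval :: "nat \<Rightarrow> (nat \<Rightarrow> complex) \<Rightarrow> complex \<Rightarrow> complex" where
  "peval D f z = (\<Sum>i\<le>D. f i * z ^ i)"

text \<open>The \<open>l\<close>-th derivative at \<open>x\<close> divided by \<open>l!\<close>. The
  truncated subtraction in the exponent does no harm, because the binomial coefficient is zero for
  \<open>i < l\<close>.\<close>

definition tay :: "nat \<Rightarrow> (nat \<Rightarrow> complex) \<Rightarrow> nat \<Rightarrow> complex \<Rightarrow> complex" where
  "tay D f l x = (\<Sum>i\<le>D. of_nat (i choose l) * f i * x ^ (i - l))"

definition taysum :: "nat \<Rightarrow> (nat \<Rightarrow> complex) \<Rightarrow> complex \<Rightarrow> real \<Rightarrow> real" where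
  "taysum D f x r = (\<Sum>l\<le>D. cmod (tay D f l x) * r ^ l)"

lemma peval_shift: "peval D f (x + w) = (\<Sum>l\<le>D. tay D f l x * w ^ l)"
proof -
  have "(x + w) ^ i = (\<Sum>l\<le>D. of_nat (i choose l) * x ^ (i - l) * w ^ l)" if "i \<le> D" for i
  proof -
    have "(x + w) ^ i = (\<Sum>l\<le>i. of_nat (i choose l) * w ^ l * x ^ (i - l))"
      using binomial_ring[of w x i] by (simp add: add.commute)
    also have "\<dots> = (\<Sum>l\<le>D. of_nat (i choose l) * w ^ l * x ^ (i - l))"
      by (rule sum.mono_neutral_left) (use that in auto)
    finally show ?thesis by (simp add: mult_ac)
  qed
  then have "peval D f (x + w) = (\<Sum>i\<le>D. \<Sum>l\<le>D. of_nat (i choose l) * f i * x ^ (i - l) * w ^ l)"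
    by (simp add: peval_def sum_distrib_left mult_ac)
  also have "\<dots> = (\<Sum>l\<le>D. tay D f l x * w ^ l)"
    by (subst sum.swap) (simp add: tay_def sum_distrib_right)
  finally show ?thesis .
qed

lemma cmod_peval_le: "cmod (peval D f (x + w)) \<le> taysum D f x (cmod w)"
  unfolding peval_shift taysum_def by (rule order_trans[OF norm_sum])
    (simp add: norm_mult norm_power)

lemma tay_top: "tay D f D x = f D"
proof -
  have "tay D f D x = (\<Sum>i\<in>{D}. of_nat (i choose D) * f i * x ^ (i - D))"
    unfolding tay_def by (rule sum.mono_neutral_right) auto
  then show ?thesis by simp
qed

lemma tay_0: "l \<le> D \<Longrightarrow> tay D f l 0 = f l"
proof -
  assume l: "l \<le> D"
  have "tay D f l 0 = (\<Sum>i\<in>{l}. of_nat (i choose l) * f i * 0 ^ (i - l))"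
    unfolding tay_def by (rule sum.mono_neutral_right) (use l in \<open>auto simp: power_0_left not_le\<close>)
  then show ?thesis by simp
qed

lemma tay_linear: "tay D (\<lambda>i. c * f i + g i) l x = c * tay D f l x + tay D g l x"
  by (simp add: tay_def algebra_simps sum.distrib sum_distrib_left)

lemma peval_linear: "peval D (\<lambda>i. c * f i + g i) x = c * peval D f x + peval D g x"
  by (simp add: peval_def algebra_simps sum.distrib sum_distrib_left)

lemma cmod_tay_le:
  assumes "cmod x \<le> 1"
  shows "cmod (tay D f l x) \<le> 2 ^ D * (\<Sum>i\<le>D. cmod (f i))"
proof -
  have "cmod (tay D f l x) \<le> (\<Sum>i\<le>D. real (i choose l) * cmod (f i) * cmod x ^ (i - l))"
    unfolding tay_def by (rule order_trans[OF norm_sum]) (simp add: norm_mult norm_power)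
  also have "\<dots> \<le> (\<Sum>i\<le>D. 2 ^ D * cmod (f i) * 1)"
  proof (intro sum_mono mult_mono)
    fix i assume "i \<in> {..D}"
    have "i choose l \<le> 2 ^ i" by (rule binomial_le_pow2)
    also have "(2::nat) ^ i \<le> 2 ^ D" using \<open>i \<in> {..D}\<close> by (intro power_increasing) auto
    finally have "real (i choose l) \<le> real (2 ^ D)" by (rule of_nat_mono)
    then show "real (i choose l) \<le> 2 ^ D" by simp
    show "cmod x ^ (i - l) \<le> 1" using assms by (intro power_le_one) auto
  qed auto
  finally show ?thesis by (simp add: sum_distrib_left)
qed

text \<open>Multiplying by one linear factor enlarges the weighted coefficient sum by at most
  \<open>|x - y| + r\<close>. Since \<open>z\<close> is no farther from \<open>x\<close> than from
  \<open>y\<close>, the triangle inequality bounds this by \<open>3 |z - y|\<close>.\<close>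

lemma prod_linear_coeff_sum_le:
  fixes x z :: complex
  assumes "\<And>y. y \<in># Y \<Longrightarrow> cmod (z - x) \<le> cmod (z - y)"
  defines "r \<equiv> cmod (z - x)"
  shows "(\<forall>l>size Y. coeff (\<Prod>y\<in>#Y. [:x - y, 1:]) l = 0) \<and>
    (\<Sum>l\<le>size Y. cmod (coeff (\<Prod>y\<in>#Y. [:x - y, 1:]) l) * r ^ l) \<le> 3 ^ size Y * (\<Prod>y\<in>#Y. cmod (z - y))"
  using assms(1)
proof (induction Y)
  case empty
  then show ?case by (auto simp: coeff_eq_0)
next
  case (add y Y)
  define q where "q = (\<Prod>y\<in>#Y. [:x - y, 1:])"
  define n where "n = size Y"
  have IH: "\<And>l. l > n \<Longrightarrow> coeff q l = 0"
     "(\<Sum>l\<le>n. cmod (coeff q l) * r ^ l) \<le> 3 ^ n * (\<Prod>y\<in>#Y. cmod (z - y))"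
    using add by (auto simp: q_def n_def)
  have r0: "0 \<le> r" by (simp add: r_def)
  have cf: "coeff ([:x - y, 1:] * q) l = (x - y) * coeff q l + coeff (pCons 0 q) l" for l
    by simp
  have zero: "coeff ([:x - y, 1:] * q) l = 0" if "l > Suc n" for l
    unfolding cf using that IH(1) by (cases l) auto
  have ry: "cmod (x - y) + r \<le> 3 * cmod (z - y)"
  proof -
    have "cmod (x - y) \<le> cmod (z - x) + cmod (z - y)"
      using norm_triangle_ineq4[of "z - y" "z - x"] by (simp add: algebra_simps)
    moreover have "r \<le> cmod (z - y)" using add.prems by (simp add: r_def)
    ultimately show ?thesis by (simp add: r_def)
  qed
  have "(\<Sum>l\<le>Suc n. cmod (coeff ([:x - y, 1:] * q) l) * r ^ l)
     \<le> (\<Sum>l\<le>Suc n. cmod (x - y) * (cmod (coeff q l) * r ^ l) + cmod (coeff (pCons 0 q) l) * r ^ l)"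
  proof (rule sum_mono)
    fix l
    have "cmod (coeff ([:x - y, 1:] * q) l) \<le> cmod (x - y) * cmod (coeff q l) + cmod (coeff
      (pCons 0 q) l)"
      unfolding cf by (rule order_trans[OF norm_triangle_ineq]) (simp add: norm_mult)
    from mult_right_mono[OF this, of "r ^ l"]
    show "cmod (coeff ([:x - y, 1:] * q) l) * r ^ l
      \<le> cmod (x - y) * (cmod (coeff q l) * r ^ l) + cmod (coeff (pCons 0 q) l) * r ^ l"
      using r0 by (simp add: algebra_simps)
  qed
  also have "\<dots> = cmod (x - y) * (\<Sum>l\<le>Suc n. cmod (coeff q l) * r ^ l) + (\<Sum>l\<le>Suc n. cmod (coeff
    (pCons 0 q) l) * r ^ l)"
    by (simp only: sum.distrib sum_distrib_left)
  also have "(\<Sum>l\<le>Suc n. cmod (coeff q l) * r ^ l) = (\<Sum>l\<le>n. cmod (coeff q l) * r ^ l)"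
    using IH(1)[of "Suc n"] by simp
  also have "(\<Sum>l\<le>Suc n. cmod (coeff (pCons 0 q) l) * r ^ l) = r * (\<Sum>l\<le>n. cmod (coeff q l) * r ^ l)"
    by (subst sum.atMost_Suc_shift) (simp add: sum_distrib_left mult_ac)
  also have "cmod (x - y) * (\<Sum>l\<le>n. cmod (coeff q l) * r ^ l) + r * (\<Sum>l\<le>n. cmod (coeff q l) * r ^ l)
     = (cmod (x - y) + r) * (\<Sum>l\<le>n. cmod (coeff q l) * r ^ l)" by (simp add: algebra_simps)
  also have "\<dots> \<le> (3 * cmod (z - y)) * (3 ^ n * (\<Prod>y\<in>#Y. cmod (z - y)))"
    using r0 by (intro mult_mono ry IH(2)) (auto intro!: sum_nonneg)
  finally show ?case using zero by (simp add: q_def n_def mult_ac)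
qed

text \<open>After factoring and moving the origin to \<open>x\<close>, the Taylor coefficients are
  those of a product of factors \<open>W + x - y\<close>. The product bound just proved says that
  near the closest center these terms do not cancel beyond the factor \<open>3 ^ D\<close>.\<close>

lemma taysum_le_peval:
  assumes "f D \<noteq> 0" "\<And>y. peval D f y = 0 \<Longrightarrow> cmod (z - x) \<le> cmod (z - y)"
  shows "taysum D f x (cmod (z - x)) \<le> 3 ^ D * cmod (peval D f z)"
proof -
  define p where "p = (\<Sum>i\<le>D. monom (f i) i)"
  have cp: "coeff p i = (if i \<le> D then f i else 0)" for i
    by (simp add: p_def coeff_sum)
  have pp: "poly p y = peval D f y" for y
    by (simp add: p_def peval_def poly_sum poly_monom)
  have deg: "degree p = D"
    by (rule antisym) (auto simp: cp assms(1) intro!: degree_le le_degree)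
  have p0: "p \<noteq> 0" using cp[of D] assms(1) by auto
  obtain Y where Y: "size Y = D" "p = smult (f D) (\<Prod>y\<in>#Y. [:-y, 1:])"
    using alg_closed_imp_factorization[OF p0] deg cp[of D] by auto
  have val: "cmod (peval D f z) = cmod (f D) * (\<Prod>y\<in>#Y. cmod (z - y))" for z
  proof -
    have "poly (\<Prod>y\<in>#Y. [:-y, 1:]) z = (\<Prod>y\<in>#Y. z - y)" by (induction Y) (auto simp: algebra_simps)
    moreover have "cmod (\<Prod>y\<in>#Y. z - y) = (\<Prod>y\<in>#Y. cmod (z - y))"
      by (induction Y) (auto simp: norm_mult)
    ultimately show ?thesis by (simp add: norm_mult Y(2) flip: pp)
  qed
  have roots: "cmod (z - x) \<le> cmod (z - y)" if "y \<in># Y" for y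
  proof -
    have "(\<Prod>u\<in>#Y. cmod (y - u)) = 0" using that by (auto simp: prod_mset_zero_iff)
    then have "cmod (peval D f y) = 0" unfolding val by (simp only: mult_zero_right)
    then have "peval D f y = 0" by simp
    then show ?thesis by (rule assms(2))
  qed
  have "pcompose p [:x, 1:] = (\<Sum>l\<le>D. monom (tay D f l x) l)"
  proof -
    have "poly (pcompose p [:x, 1:]) = poly (\<Sum>l\<le>D. monom (tay D f l x) l)"
    proof
      fix w
      show "poly (pcompose p [:x, 1:]) w = poly (\<Sum>l\<le>D. monom (tay D f l x) l) w"
        by (simp add: poly_pcompose pp poly_sum poly_monom peval_shift)
    qed
    then show ?thesis by (simp add: poly_eq_poly_eq_iff)
  qed
  moreover have "pcompose p [:x, 1:] = smult (f D) (\<Prod>y\<in>#Y. [:x - y, 1:])"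
  proof -
    have "pcompose (\<Prod>y\<in>#Y. [:-y, 1:]) [:x, 1:] = (\<Prod>y\<in>#Y. [:x - y, 1:])"
    proof (subst poly_eq_poly_eq_iff[symmetric], rule ext)
      fix w
      have "poly (\<Prod>y\<in>#Y. [:-y, 1:]) (x + w) = poly (\<Prod>y\<in>#Y. [:x - y, 1:]) w"
        by (induction Y) (simp_all add: algebra_simps)
      then show "poly (pcompose (\<Prod>y\<in>#Y. [:-y, 1:]) [:x, 1:]) w = poly (\<Prod>y\<in>#Y. [:x - y, 1:]) w"
        by (simp add: poly_pcompose)
    qed
    then show ?thesis by (simp add: Y(2) pcompose_smult)
  qed
  ultimately have "(\<Sum>l\<le>D. monom (tay D f l x) l) = smult (f D) (\<Prod>y\<in>#Y. [:x - y, 1:])"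
    by simp
  then have cf: "coeff (\<Sum>l\<le>D. monom (tay D f l x) l) l = f D * coeff (\<Prod>y\<in>#Y. [:x - y, 1:]) l" for l
    by simp
  have tay: "tay D f l x = f D * coeff (\<Prod>y\<in>#Y. [:x - y, 1:]) l" if "l \<le> D" for l
    using cf[of l] that by (simp add: coeff_sum)
  have "taysum D f x (cmod (z - x)) = cmod (f D) * (\<Sum>l\<le>size Y. cmod (coeff
    (\<Prod>y\<in>#Y. [:x - y, 1:]) l) * cmod (z - x) ^ l)"
    by (simp add: taysum_def tay Y(1) norm_mult sum_distrib_left mult.assoc)
  also have "\<dots> \<le> cmod (f D) * (3 ^ size Y * (\<Prod>y\<in>#Y. cmod (z - y)))"
    using prod_linear_coeff_sum_le[OF roots] by (intro mult_left_mono) auto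
  also have "\<dots> = 3 ^ D * cmod (peval D f z)" by (simp add: val Y(1))
  finally show ?thesis .
qed

text \<open>In \<open>f(w) - 2^(D+1) f(w/2)\<close> the coefficient of degree \<open>D + 1\<close>
  cancels, while every lower one is multiplied by a number of modulus at least 1. The induction
  hypothesis then bounds the lower coefficients, and the value at \<open>w = 1\<close> bounds the
  top one.\<close>

lemma coeff_sum_le_max:
  "\<exists>C\<ge>1. \<forall>(d::nat \<Rightarrow> complex) m. (\<forall>w. cmod w \<le> 1 \<longrightarrow> cmod (\<Sum>l\<le>D. d l * w ^ l) \<le> m) \<longrightarrow>
     (\<Sum>l\<le>D. cmod (d l)) \<le> C * m"
proof (induction D)
  case 0
  have "cmod (d 0) \<le> m" if "\<forall>w. cmod w \<le> 1 \<longrightarrow> cmod (d 0) \<le> m" for d :: "nat \<Rightarrow> complex" and m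
    using that[rule_format, of 0] by simp
  then show ?case by (intro exI[of _ 1]) auto
next
  case (Suc D)
  then obtain C where C: "C \<ge> 1" "\<And>(d::nat \<Rightarrow> complex) m. (\<And>w. cmod w \<le> 1
    \<Longrightarrow> cmod (\<Sum>l\<le>D. d l * w ^ l) \<le> m) \<Longrightarrow>
     (\<Sum>l\<le>D. cmod (d l)) \<le> C * m" by blast
  define B :: real where "B = 1 + 2 ^ Suc D"
  have "(\<Sum>l\<le>Suc D. cmod (d l)) \<le> (1 + 2 * (C * B)) * m"
    if m: "\<And>w. cmod w \<le> 1 \<Longrightarrow> cmod (\<Sum>l\<le>Suc D. d l * w ^ l) \<le> m" for d :: "nat \<Rightarrow> complex" and m
  proof -
    define e where "e l = d l * (1 - 2 ^ (Suc D - l))" for l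
    have "cmod (\<Sum>l\<le>D. e l * w ^ l) \<le> B * m" if w: "cmod w \<le> 1" for w
    proof -
      have "d l * w ^ l - 2 ^ Suc D * (d l * (w / 2) ^ l) = e l * w ^ l" if "l \<le> Suc D" for l
      proof -
        have "(2::complex) ^ Suc D = 2 ^ (Suc D - l) * 2 ^ l" using that by (simp flip: power_add)
        then show ?thesis by (simp add: e_def power_divide algebra_simps del: power_Suc)
      qed
      then have "(\<Sum>l\<le>Suc D. d l * w ^ l) - 2 ^ Suc D * (\<Sum>l\<le>Suc D. d l * (w / 2) ^ l)
        = (\<Sum>l\<le>Suc D. e l * w ^ l)"
        unfolding sum_distrib_left sum_subtractf[symmetric] by (intro sum.cong) auto
      also have "\<dots> = (\<Sum>l\<le>D. e l * w ^ l)" by (simp add: e_def)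
      finally have "cmod (\<Sum>l\<le>D. e l * w ^ l) \<le> cmod (\<Sum>l\<le>Suc D. d l * w ^ l) + cmod (2 ^ Suc D *
        (\<Sum>l\<le>Suc D. d l * (w / 2) ^ l))"
        by (metis norm_triangle_ineq4)
      also have "\<dots> \<le> m + 2 ^ Suc D * m"
        using m[OF w] m[of "w / 2"] w by (intro add_mono)
          (auto simp: norm_mult norm_power norm_divide simp del: sum.atMost_Suc)
      finally show ?thesis by (simp add: B_def algebra_simps)
    qed
    then have "(\<Sum>l\<le>D. cmod (e l)) \<le> C * (B * m)" by (rule C(2))
    moreover have "(\<Sum>l\<le>D. cmod (d l)) \<le> (\<Sum>l\<le>D. cmod (e l))"
    proof (rule sum_mono)
      fix l assume "l \<in> {..D}"
      then have "(2::real) ^ 1 \<le> 2 ^ (Suc D - l)" by (intro power_increasing) auto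
      moreover have "cmod (1 - 2 ^ (Suc D - l)) = \<bar>1 - 2 ^ (Suc D - l)\<bar>"
        by (metis norm_of_real of_real_1 of_real_diff of_real_numeral of_real_power)
      ultimately have "1 \<le> cmod (1 - 2 ^ (Suc D - l))" by simp
      then show "cmod (d l) \<le> cmod (e l)"
        unfolding e_def norm_mult using mult_left_mono[of 1 "cmod (1 - 2 ^ (Suc D - l))"
          "cmod (d l)"] by simp
    qed
    ultimately have 1: "(\<Sum>l\<le>D. cmod (d l)) \<le> C * (B * m)" by linarith
    have "d (Suc D) = (\<Sum>l\<le>Suc D. d l * 1 ^ l) - (\<Sum>l\<le>D. d l)" by simp
    then have "cmod (d (Suc D)) \<le> cmod (\<Sum>l\<le>Suc D. d l * 1 ^ l) + cmod (\<Sum>l\<le>D. d l)"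
      by (metis norm_triangle_ineq4)
    also have "\<dots> \<le> m + (\<Sum>l\<le>D. cmod (d l))" by (intro add_mono m norm_sum) auto
    finally show ?thesis using 1 by (simp add: algebra_simps)
  qed
  moreover have "0 \<le> C * B" using C(1) by (auto simp: B_def)
  ultimately show ?case by (intro exI[of _ "1 + 2 * (C * B)"]) (simp del: sum.atMost_Suc)
qed

text \<open>A polynomial cannot be small on the whole disc of radius \<open>1 / 2\<close> compared
  with its coefficients, and it is Lipschitz with constant \<open>D\<close> times the coefficient
  sum. So it stays large on a ball whose radius depends on \<open>D\<close> only.\<close>

lemma large_on_ball_unit:
  "\<exists>\<eta>>0. \<eta> \<le> 1 / 2 \<and> (\<forall>d::nat \<Rightarrow> complex. \<exists>w0. cmod w0 \<le> 1 / 2 \<and>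
     (\<forall>w. cmod (w - w0) < \<eta> \<longrightarrow> \<eta> * (\<Sum>l\<le>D. cmod (d l)) \<le> cmod (\<Sum>l\<le>D. d l * w ^ l)))"
proof -
  obtain C where C: "C \<ge> 1" "\<And>(d::nat \<Rightarrow> complex) m. (\<And>w. cmod w \<le> 1 \<Longrightarrow> cmod (\<Sum>l\<le>D. d l * w ^ l)
    \<le> m) \<Longrightarrow>
     (\<Sum>l\<le>D. cmod (d l)) \<le> C * m" using coeff_sum_le_max[of D] by blast
  \<comment> \<open>Rescaling the disc to radius \<open>1 / 2\<close> costs \<open>2 ^ D\<close> in
    the coefficient sum, and a further factor 2 makes the inequality at \<open>w1\<close> strict.
    Then \<open>\<eta>\<close> satisfies \<open>D \<eta> + \<eta> \<le> \<kappa>\<close>, where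
    \<open>D \<eta>\<close> pays for the variation over the ball.\<close>
  define \<kappa> where "\<kappa> = 1 / (2 ^ (D + 1) * C)"
  define \<eta> where "\<eta> = min (1 / 2) (\<kappa> / (real D + 1))"
  have \<kappa>: "\<kappa> > 0" using C(1) by (simp add: \<kappa>_def)
  then have \<eta>: "0 < \<eta>" "\<eta> \<le> 1 / 2" "real D * \<eta> + \<eta> \<le> \<kappa>"
  proof -
    have "\<eta> \<le> \<kappa> / (real D + 1)" by (simp add: \<eta>_def)
    then have "\<eta> * (real D + 1) \<le> \<kappa>" by (simp add: pos_le_divide_eq)
    then show "real D * \<eta> + \<eta> \<le> \<kappa>" by (simp add: algebra_simps)
  qed (use \<kappa> in \<open>auto simp: \<eta>_def min_def\<close>)
  have "\<exists>w0. cmod w0 \<le> 1 / 2 \<and>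
     (\<forall>w. cmod (w - w0) < \<eta> \<longrightarrow> \<eta> * (\<Sum>l\<le>D. cmod (d l)) \<le> cmod (\<Sum>l\<le>D. d l * w ^ l))" for d ::
       "nat \<Rightarrow> complex"
  proof (cases "(\<Sum>l\<le>D. cmod (d l)) = 0")
    case True
    then show ?thesis by (intro exI[of _ 0]) auto
  next
    case False
    define S where "S = (\<Sum>l\<le>D. cmod (d l))"
    have S: "S > 0" using False by (auto simp: S_def less_le intro!: sum_nonneg)
    have "\<exists>w. cmod w \<le> 1 \<and> cmod (\<Sum>l\<le>D. (d l * (1 / 2) ^ l) * w ^ l) > \<kappa> * S"
    proof (rule ccontr)
      assume "\<not> ?thesis"
      then have "(\<Sum>l\<le>D. cmod (d l * (1 / 2) ^ l)) \<le> C * (\<kappa> * S)" by (intro C(2)) force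
      moreover have "(1 / 2) ^ D * S \<le> (\<Sum>l\<le>D. cmod (d l * (1 / 2) ^ l))"
        unfolding S_def sum_distrib_left
      proof (rule sum_mono)
        fix l assume "l \<in> {..D}"
        then have "(1 / 2 :: real) ^ D \<le> (1 / 2) ^ l" by (intro power_decreasing) auto
        then show "(1 / 2) ^ D * cmod (d l) \<le> cmod (d l * (1 / 2) ^ l)"
          by (simp add: norm_mult norm_power norm_divide mult_left_mono mult.commute)
      qed
      moreover have "C * (\<kappa> * S) = (1 / 2) ^ D * S / 2" using C(1) by (simp add: \<kappa>_def power_divide)
      moreover have "0 < (1 / 2) ^ D * S" using S by simp
      ultimately show False by linarith
    qed
    then obtain w1 where w1: "cmod w1 \<le> 1" "cmod (\<Sum>l\<le>D. (d l * (1 / 2) ^ l) * w1 ^ l) > \<kappa> * S"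
      by blast
    define w0 where "w0 = w1 / 2"
    have w0: "cmod w0 \<le> 1 / 2" "cmod (\<Sum>l\<le>D. d l * w0 ^ l) > \<kappa> * S"
      using w1 by (auto simp: w0_def norm_divide power_divide mult.assoc)
    have "\<eta> * S \<le> cmod (\<Sum>l\<le>D. d l * w ^ l)" if w: "cmod (w - w0) < \<eta>" for w
    proof -
      have w': "cmod w \<le> 1" using norm_triangle_ineq[of "w - w0" w0] w w0(1) \<eta>(2) by simp
      have "cmod ((\<Sum>l\<le>D. d l * w ^ l) - (\<Sum>l\<le>D. d l * w0 ^ l))
        \<le> (\<Sum>l\<le>D. cmod (d l) * cmod (w ^ l - w0 ^ l))"
        unfolding sum_subtractf[symmetric] right_diff_distrib[symmetric]
        by (rule order_trans[OF norm_sum]) (simp add: norm_mult)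
      also have "\<dots> \<le> (\<Sum>l\<le>D. cmod (d l) * (real D * \<eta>))"
      proof (intro sum_mono mult_left_mono)
        fix l assume "l \<in> {..D}"
        have "cmod (w ^ l - w0 ^ l) \<le> real l * cmod (w - w0)"
          using w' w0(1) by (intro norm_power_diff) auto
        also have "\<dots> \<le> real D * \<eta>" using \<open>l \<in> {..D}\<close> w by (intro mult_mono) auto
        finally show "cmod (w ^ l - w0 ^ l) \<le> real D * \<eta>" .
      qed auto
      also have "\<dots> = real D * \<eta> * S" by (simp add: S_def mult.commute flip: sum_distrib_right)
      finally have "cmod (\<Sum>l\<le>D. d l * w0 ^ l) \<le> cmod (\<Sum>l\<le>D. d l * w ^ l) + real D * \<eta> * S"
        by (smt (verit) norm_minus_commute norm_triangle_ineq2)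
      moreover have "(real D * \<eta> + \<eta>) * S \<le> \<kappa> * S" using S \<eta>(3) by (intro mult_right_mono) auto
      ultimately show ?thesis using w0(2) by (simp add: algebra_simps)
    qed
    then show ?thesis using w0(1) by (auto simp: S_def)
  qed
  then show ?thesis using \<eta> by blast
qed

lemma large_on_ball:
  "\<exists>\<eta>>0. \<eta> \<le> 1 / 2 \<and> (\<forall>f x r. r > 0 \<longrightarrow> (\<exists>w0. cmod w0 \<le> r / 2 \<and>
     (\<forall>w. cmod (w - w0) < \<eta> * r \<longrightarrow> \<eta> * taysum D f x r \<le> cmod (peval D f (x + w)))))"
proof -
  obtain \<eta> where \<eta>: "\<eta> > 0" "\<eta> \<le> 1 / 2" "\<And>d::nat \<Rightarrow> complex. \<exists>w0. cmod w0 \<le> 1 / 2 \<and>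
     (\<forall>w. cmod (w - w0) < \<eta> \<longrightarrow> \<eta> * (\<Sum>l\<le>D. cmod (d l)) \<le> cmod (\<Sum>l\<le>D. d l * w ^ l))"
    using large_on_ball_unit[of D] by blast
  have "\<exists>w0. cmod w0 \<le> r / 2 \<and>
     (\<forall>w. cmod (w - w0) < \<eta> * r \<longrightarrow> \<eta> * taysum D f x r \<le> cmod (peval D f (x + w)))"
    if r: "r > 0" for f x and r :: real
  proof -
    obtain u where u: "cmod u \<le> 1 / 2"
      "\<And>w. cmod (w - u) < \<eta> \<Longrightarrow> \<eta> * (\<Sum>l\<le>D. cmod (tay D f l x * of_real r ^ l))
        \<le> cmod (\<Sum>l\<le>D. (tay D f l x * of_real r ^ l) * w ^ l)"
      using \<eta>(3)[of "\<lambda>l. tay D f l x * of_real r ^ l"] by blast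
    show ?thesis
    proof (intro exI[of _ "of_real r * u"] conjI allI impI)
      show "cmod (of_real r * u) \<le> r / 2" using u(1) r by (simp add: norm_mult)
      fix w assume w: "cmod (w - of_real r * u) < \<eta> * r"
      have "w / of_real r - u = (w - of_real r * u) / of_real r" using r by (simp add: field_simps)
      then have "cmod (w / of_real r - u) < \<eta>" using w r
        by (simp add: norm_divide pos_divide_less_eq)
      from u(2)[OF this] show "\<eta> * taysum D f x r \<le> cmod (peval D f (x + w))"
        using r by (simp add: taysum_def peval_shift norm_mult norm_power power_divide)
    qed
  qed
  then show ?thesis using \<eta> by blast
qed

lemma ennreal_divide_le_divide:
  assumes "a \<le> a'" "b' \<le> b" "0 < b" "0 \<le> a"
  shows "ennreal a / ennreal b \<le> ennreal a' / ennreal b'"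
proof (cases "b' \<le> 0")
  case True
  then have b': "ennreal b' = 0" by (simp add: ennreal_neg)
  show ?thesis
  proof (cases "a' = 0")
    case True
    then show ?thesis using assms by simp
  next
    case False
    then show ?thesis using assms unfolding b' by (simp add: ennreal_eq_0_iff)
  qed
next
  case False
  then show ?thesis using assms by (simp add: divide_ennreal frac_le)
qed

section \<open>A radial kernel concentrated at one scale\<close>

definition kern :: "real \<Rightarrow> real \<Rightarrow> real \<Rightarrow> real" where
  "kern \<kappa> r0 r = (if r = 0 then 0 else min ((r / r0) powr \<kappa>) ((r0 / r) powr \<kappa>) / r\<^sup>2)"

lemma ex_dyadic:
  assumes "(x::real) \<ge> 1"
  shows "\<exists>k. 2 ^ k \<le> x \<and> x \<le> 2 ^ Suc k"
proof -
  define n where "n = (LEAST n. x < 2 ^ n)"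
  have n: "x < 2 ^ n" unfolding n_def
    using real_arch_pow[of 2 x] by (auto intro: LeastI)
  then obtain k where k: "n = Suc k" using assms by (cases n) auto
  then have "\<not> x < 2 ^ k" unfolding n_def by (metis lessI not_less_Least)
  then show ?thesis using n k by (intro exI[of _ k]) auto
qed

text \<open>Relative to the scale invariant measure \<open>dV / r^2\<close> the kernel decays
  geometrically on both sides of \<open>r0\<close>. Hence its integral is bounded independently of
  the scale \<open>r0\<close> and of the center \<open>a\<close>.\<close>

lemma nn_integral_kern_le:
  assumes "\<kappa> > 0"
  shows "\<exists>K>0. \<forall>r0>0. \<forall>a::complex. (\<integral>\<^sup>+z. ennreal (kern \<kappa> r0 (cmod (z - a))) \<partial>lborel) \<le> ennreal K"
proof -
  define q where "q = 2 powr (- \<kappa>)"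
  have q: "0 < q" "q < 1" using assms by (auto simp: q_def powr_less_one)
  have qk: "q ^ k = (2 ^ k) powr (- \<kappa>)" for k :: nat
    by (simp add: q_def powr_powr mult.commute flip: powr_realpow)
  \<comment> \<open>In the dyadic majorant \<open>u k\<close> below, each of the two discs
    contributes \<open>4 pi q ^ k\<close>: its area is \<open>4 pi\<close> times the square of the
    radius in the denominator.\<close>
  define K where "K = 8 * pi * (1 / (1 - q))"
  have "(\<integral>\<^sup>+z. ennreal (kern \<kappa> r0 (cmod (z - a))) \<partial>lborel) \<le> ennreal K"
    if r0: "r0 > 0" for r0 and a :: complex
  proof -
    define u where "u k z = ennreal (q ^ k / (r0 / 2 ^ Suc k)\<^sup>2) * indicator (cball a (r0
      / 2 ^ k)) z
       + ennreal (q ^ k / (r0 * 2 ^ k)\<^sup>2) * indicator (cball a (r0 * 2 ^ Suc k)) z" for k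
         and z :: complex
    have pt: "ennreal (kern \<kappa> r0 (cmod (z - a))) \<le> (\<Sum>k. u k z)" for z
    proof -
      define r where "r = cmod (z - a)"
      have "\<exists>k. ennreal (kern \<kappa> r0 r) \<le> u k z"
      proof -
        consider "r = 0" | "0 < r" "r \<le> r0" | "r0 < r" by (auto simp: r_def) fastforce
        then show ?thesis
        proof cases
          case 1
          then show ?thesis by (simp add: kern_def)
        next
          case 2
          obtain k where k: "2 ^ k \<le> r0 / r" "r0 / r \<le> 2 ^ Suc k" using ex_dyadic[of "r0 / r"] 2
            by auto
          have rk: "r0 / 2 ^ Suc k \<le> r" "r \<le> r0 / 2 ^ k" using k 2 by (simp_all add: field_simps)
          have "(r / r0) powr \<kappa> = (r0 / r) powr (- \<kappa>)"
            using 2 r0 by (simp add: powr_divide powr_minus field_simps)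
          also have "\<dots> \<le> q ^ k" unfolding qk
            using k(1) assms by (intro powr_mono2') auto
          finally have "min ((r / r0) powr \<kappa>) ((r0 / r) powr \<kappa>) \<le> q ^ k" by simp
          then have "kern \<kappa> r0 r \<le> q ^ k / (r0 / 2 ^ Suc k)\<^sup>2"
            using 2 rk r0 q unfolding kern_def by (auto intro!: frac_le power_mono)
          moreover have "z \<in> cball a (r0 / 2 ^ k)" using rk(2)
            by (simp add: r_def dist_norm norm_minus_commute)
          ultimately have "ennreal (kern \<kappa> r0 r) \<le> u k z"
            unfolding u_def by (simp add: add_increasing2 ennreal_leI del: power_Suc)
          then show ?thesis ..
        next
          case 3
          then obtain k where k: "2 ^ k \<le> r / r0" "r / r0 \<le> 2 ^ Suc k"
            using ex_dyadic[of "r / r0"] r0 by auto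
          have rk: "r0 * 2 ^ k \<le> r" "r \<le> r0 * 2 ^ Suc k" using k r0 by (simp_all add: field_simps)
          have "(r0 / r) powr \<kappa> = (r / r0) powr (- \<kappa>)"
            using 3 r0 by (simp add: powr_divide powr_minus field_simps)
          also have "\<dots> \<le> q ^ k" unfolding qk
            using k(1) assms by (intro powr_mono2') auto
          finally have "min ((r / r0) powr \<kappa>) ((r0 / r) powr \<kappa>) \<le> q ^ k" by simp
          then have "kern \<kappa> r0 r \<le> q ^ k / (r0 * 2 ^ k)\<^sup>2"
            using 3 rk r0 q unfolding kern_def by (auto intro!: frac_le power_mono)
          moreover have "z \<in> cball a (r0 * 2 ^ Suc k)" using rk(2)
            by (simp add: r_def dist_norm norm_minus_commute)
          ultimately have "ennreal (kern \<kappa> r0 r) \<le> u k z"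
            unfolding u_def by (simp add: add_increasing ennreal_leI del: power_Suc)
          then show ?thesis ..
        qed
      qed
      then obtain k where "ennreal (kern \<kappa> r0 r) \<le> u k z" ..
      also have "u k z \<le> (\<Sum>k. u k z)" 
        using sum_le_suminf[of "\<lambda>k. u k z" "{k}"] by auto
      finally show ?thesis by (simp add: r_def)
    qed
    have "(\<integral>\<^sup>+z. ennreal (kern \<kappa> r0 (cmod (z - a))) \<partial>lborel) \<le> (\<integral>\<^sup>+z. (\<Sum>k. u k z) \<partial>lborel)"
      by (intro nn_integral_mono pt)
    also have "\<dots> = (\<Sum>k. \<integral>\<^sup>+z. u k z \<partial>lborel)"
    proof (rule nn_integral_suminf)
      have [measurable]: "cball a t \<in> sets borel" for t by simp
      show "u k \<in> borel_measurable lborel" for k unfolding u_def by measurable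
    qed
    also have "(\<lambda>k. \<integral>\<^sup>+z. u k z \<partial>lborel) = (\<lambda>k. ennreal (8 * pi * q ^ k))"
    proof
      fix k
      have 1: "emeasure lborel (cball a (r0 / 2 ^ k)) = ennreal (pi * (r0 / 2 ^ k)\<^sup>2)"
         "emeasure lborel (cball a (r0 * 2 ^ Suc k)) = ennreal (pi * (r0 * 2 ^ Suc k)\<^sup>2)"
        using r0 by (subst emeasure_cball; simp add: unit_ball_vol_2)+
      have "(\<integral>\<^sup>+z. u k z \<partial>lborel) = ennreal (q ^ k / (r0 / 2 ^ Suc k)\<^sup>2) * emeasure lborel
        (cball a (r0 / 2 ^ k))
         + ennreal (q ^ k / (r0 * 2 ^ k)\<^sup>2) * emeasure lborel (cball a (r0 * 2 ^ Suc k))"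
        unfolding u_def
      proof (subst nn_integral_add)
        have [measurable]: "cball a t \<in> sets borel" for t by simp
        show "(\<lambda>z. ennreal (q ^ k / (r0 / 2 ^ Suc k)\<^sup>2) * indicator (cball a (r0
          / 2 ^ k)) z) \<in> borel_measurable lborel"
          "(\<lambda>z. ennreal (q ^ k / (r0 * 2 ^ k)\<^sup>2) * indicator (cball a (r0
            * 2 ^ Suc k)) z) \<in> borel_measurable lborel"
          by measurable
      qed (simp add: nn_integral_cmult_indicator)
      also have "\<dots> = ennreal (q ^ k / (r0 / 2 ^ Suc k)\<^sup>2 * (pi * (r0 / 2 ^ k)\<^sup>2) + q ^ k / (r0
        * 2 ^ k)\<^sup>2 * (pi * (r0 * 2 ^ Suc k)\<^sup>2))"
        unfolding 1 using q by (subst ennreal_plus) (auto simp flip: ennreal_mult)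
      also have "q ^ k / (r0 / 2 ^ Suc k)\<^sup>2 * (pi * (r0 / 2 ^ k)\<^sup>2) + q ^ k / (r0 * 2 ^ k)\<^sup>2 * (pi
        * (r0 * 2 ^ Suc k)\<^sup>2) = 8 * pi * q ^ k"
        using r0 by (simp add: field_simps power2_eq_square)
      finally show "(\<integral>\<^sup>+z. u k z \<partial>lborel) = ennreal (8 * pi * q ^ k)" .
    qed
    also have "(\<Sum>k. ennreal (8 * pi * q ^ k)) = ennreal K"
      unfolding K_def using q by (intro suminf_ennreal_eq sums_mult geometric_sums) auto
    finally show ?thesis .
  qed
  moreover have "K > 0" using q by (simp add: K_def)
  ultimately show ?thesis by blast
qed

section \<open>Balanced radii\<close>

definition expo_x :: "real \<Rightarrow> real \<Rightarrow> nat \<Rightarrow> nat \<Rightarrow> real" where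
  "expo_x a \<delta> l m = (real m * \<delta> - a) / (real m - real l)"

definition expo_y :: "real \<Rightarrow> real \<Rightarrow> nat \<Rightarrow> nat \<Rightarrow> real" where
  "expo_y a \<delta> l m = (a - real l * \<delta>) / (real m - real l)"

definition gpairs :: "real \<Rightarrow> real \<Rightarrow> nat set \<Rightarrow> (nat \<times> nat) set" where
  "gpairs a \<delta> \<Lambda> = {l \<in> \<Lambda>. real l * \<delta> < a} \<times> {m \<in> \<Lambda>. a < real m * \<delta>}"

text \<open>A sum in place of the maximum of the overview: sums preserve \<open>app\<close>, and the
  two differ by at most the number of pairs.\<close>

definition gap :: "real \<Rightarrow> real \<Rightarrow> nat set \<Rightarrow> (nat \<Rightarrow> real) \<Rightarrow> real" where
  "gap a \<delta> \<Lambda> c = (\<Sum>(l, m)\<in>gpairs a \<delta> \<Lambda>. c l powr expo_x a \<delta> l m * c m powr expo_y a \<delta> l m)"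

lemma gpairs_less: "0 < \<delta> \<Longrightarrow> (l, m) \<in> gpairs a \<delta> \<Lambda> \<Longrightarrow> l < m"
  by (auto simp: gpairs_def) (metis mult_less_cancel_right_pos of_nat_less_iff order.strict_trans)

lemma expo_pos:
  assumes "0 < \<delta>" "(l, m) \<in> gpairs a \<delta> \<Lambda>"
  shows "0 < expo_x a \<delta> l m" "0 < expo_y a \<delta> l m"
  using gpairs_less[OF assms] assms by (auto simp: gpairs_def expo_x_def expo_y_def)

lemma expo_sum:
  assumes "l < m"
  shows "expo_x a \<delta> l m + expo_y a \<delta> l m = \<delta>"
    "real l * expo_x a \<delta> l m + real m * expo_y a \<delta> l m = a"
proof -
  have k: "real m - real l \<noteq> 0" using assms by simp
  have "expo_x a \<delta> l m + expo_y a \<delta> l m = (real m - real l) * \<delta> / (real m - real l)"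
    unfolding expo_x_def expo_y_def add_divide_distrib[symmetric] by (simp add: algebra_simps)
  then show "expo_x a \<delta> l m + expo_y a \<delta> l m = \<delta>" using k by simp
  have "real l * expo_x a \<delta> l m + real m * expo_y a \<delta> l m
    = (real m - real l) * a / (real m - real l)"
    unfolding expo_x_def expo_y_def times_divide_eq_right add_divide_distrib[symmetric]
      by (simp add: algebra_simps)
  then show "real l * expo_x a \<delta> l m + real m * expo_y a \<delta> l m = a" using k by simp
qed

text \<open>Homogeneity: since \<open>l * expo_x + m * expo_y = a\<close>, replacing each
  \<open>c l\<close> by \<open>c l * r ^ l\<close> multiplies every term by the same
  \<open>r powr a\<close>. Terms may therefore be compared at any radius.\<close>

lemma gap_term_scale:
  assumes "0 \<le> cl" "0 \<le> cm" "0 < r" "l < m"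
  shows "cl powr expo_x a \<delta> l m * cm powr expo_y a \<delta> l m =
    (cl * r ^ l) powr expo_x a \<delta> l m * (cm * r ^ m) powr expo_y a \<delta> l m * r powr (- a)"
proof -
  have "(r ^ l) powr expo_x a \<delta> l m * (r ^ m) powr expo_y a \<delta> l m = r powr a"
    using assms expo_sum(2)[OF assms(4), of a \<delta>]
      by (simp add: powr_powr powr_add[symmetric] flip: powr_realpow)
  then have "(cl * r ^ l) powr expo_x a \<delta> l m * (cm * r ^ m) powr expo_y a \<delta> l m =
    cl powr expo_x a \<delta> l m * cm powr expo_y a \<delta> l m * r powr a"
    using assms by (simp add: powr_mult mult_ac)
  moreover have "r powr a * r powr (- a) = 1" using assms(3) by (simp flip: powr_add)
  ultimately show ?thesis by (simp add: mult.assoc)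
qed

lemma gap_nonneg: "0 \<le> gap a \<delta> \<Lambda> c"
  by (auto simp: gap_def intro!: sum_nonneg)

lemma finite_gpairs: "finite \<Lambda> \<Longrightarrow> finite (gpairs a \<delta> \<Lambda>)"
  by (simp add: gpairs_def)

text \<open>At the radius \<open>r\<close> where the two extremal monomials \<open>c l r\<^sup>l\<close> and \<open>c m r\<^sup>m\<close> balance,
  they dominate all others.\<close>
lemma balanced_radius:
  assumes "finite \<Lambda>" "\<And>l. 0 \<le> c l" "0 < \<delta>" "0 < gap a \<delta> \<Lambda> c"
  obtains r \<tau> l m where "r > 0" "\<tau> > 0" "(l, m) \<in> gpairs a \<delta> \<Lambda>" "c l * r ^ l = \<tau>" "c m * r ^ m = \<tau>"
    "\<And>l' m'. (l', m') \<in> gpairs a \<delta> \<Lambda> \<Longrightarrow> c l' * r ^ l' \<le> \<tau> \<and> c m' * r ^ m' \<le> \<tau>"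
    "\<tau> powr \<delta> * r powr (- a) \<le> gap a \<delta> \<Lambda> c"
    "gap a \<delta> \<Lambda> c \<le> real (card (gpairs a \<delta> \<Lambda>)) * (\<tau> powr \<delta> * r powr (- a))"
proof -
  define P where "P = gpairs a \<delta> \<Lambda>"
  define t where "t l m = c l powr expo_x a \<delta> l m * c m powr expo_y a \<delta> l m" for l m
  have fin: "finite P" using assms(1) by (simp add: P_def finite_gpairs)
  have gap: "gap a \<delta> \<Lambda> c = (\<Sum>(l, m)\<in>P. t l m)" by (simp add: gap_def P_def t_def)
  have "P \<noteq> {}" using assms(4) gap by auto
  then obtain p where p: "p \<in> P" "\<And>p'. p' \<in> P \<Longrightarrow> case_prod t p' \<le> case_prod t p"
    using fin by (metis (no_types, lifting) Max_ge Max_in finite_imageI imageE image_eqI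
      image_is_empty)
  obtain l m where lm: "p = (l, m)" by (cases p)
  have lm_in: "(l, m) \<in> P" and max: "\<And>l' m'. (l', m') \<in> P \<Longrightarrow> t l' m' \<le> t l m"
    using p lm by auto
  have le: "gap a \<delta> \<Lambda> c \<le> real (card P) * t l m"
    unfolding gap using max by (intro sum_bounded_above) auto
  then have tpos: "0 < t l m" using assms(4) by (smt (verit) mult_nonneg_nonpos of_nat_0_le_iff)
  then have cpos: "0 < c l" "0 < c m" using assms(2)[of l] assms(2)[of m]
    by (auto simp: t_def less_le)
  have less: "l < m" using gpairs_less[OF assms(3)] lm_in by (auto simp: P_def)
  \<comment> \<open>The solution of \<open>c l * r ^ l = c m * r ^ m\<close>.\<close>
  define r where "r = (c l / c m) powr (1 / (real m - real l))"
  have r: "r > 0" using cpos by (simp add: r_def)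
  have "r ^ (m - l) = c l / c m"
    using less cpos by (simp add: r_def powr_powr of_nat_diff flip: powr_realpow)
  then have "c m * (r ^ l * r ^ (m - l)) = c l * r ^ l" using cpos by (simp add: field_simps)
  then have eq: "c m * r ^ m = c l * r ^ l" using less by (simp flip: power_add)
  define \<tau> where "\<tau> = c l * r ^ l"
  have eq2: "c m * r ^ m = \<tau>" "c l * r ^ l = \<tau>" using eq by (simp_all add: \<tau>_def)
  have \<tau>: "\<tau> > 0" using cpos r by (simp add: \<tau>_def)
  have tscale: "t l' m' = (c l' * r ^ l') powr expo_x a \<delta> l' m' * (c m'
    * r ^ m') powr expo_y a \<delta> l' m' * r powr (- a)"
    if "(l', m') \<in> P" for l' m'
    unfolding t_def by (rule gap_term_scale) (use that r assms gpairs_less in \<open>auto simp: P_def\<close>)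
  have both: "\<tau> powr expo_x a \<delta> l' m' * \<tau> powr expo_y a \<delta> l' m' = \<tau> powr \<delta>"
    if "(l', m') \<in> P" for l' m'
    using expo_sum(1)[of l' m' a \<delta>] gpairs_less[OF assms(3)] that
      by (auto simp: P_def simp flip: powr_add)
  have tlm: "t l m = \<tau> powr \<delta> * r powr (- a)"
    using tscale[OF lm_in] both[OF lm_in] eq by (simp add: \<tau>_def)
  \<comment> \<open>Pairs form a product set, so \<open>l\<close> may be exchanged for
    \<open>l'\<close> with \<open>m\<close> kept. A monomial above \<open>\<tau>\<close> would then
    give a larger term than the maximal one.\<close>
  have 1: "c l' * r ^ l' \<le> \<tau>" if "(l', m') \<in> P" for l' m'
  proof (rule ccontr)
    assume "\<not> ?thesis"
    then have gt: "\<tau> < c l' * r ^ l'" by simp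
    have in': "(l', m) \<in> P" using that lm_in by (auto simp: P_def gpairs_def)
    have "\<tau> powr expo_x a \<delta> l' m < (c l' * r ^ l') powr expo_x a \<delta> l' m"
      using gt \<tau> expo_pos[OF assms(3)] in' by (intro powr_less_mono2) (auto simp: P_def)
    then have "\<tau> powr expo_x a \<delta> l' m * \<tau> powr expo_y a \<delta> l' m * r powr (- a) <
       (c l' * r ^ l') powr expo_x a \<delta> l' m * \<tau> powr expo_y a \<delta> l' m * r powr (- a)"
      using \<tau> r by simp
    then have "t l m < t l' m" unfolding tlm tscale[OF in'] eq2 both[OF in', symmetric] .
    then show False using max[OF in'] by simp
  qed
  have 2: "c m' * r ^ m' \<le> \<tau>" if "(l', m') \<in> P" for l' m'
  proof (rule ccontr)
    assume "\<not> ?thesis"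
    then have gt: "\<tau> < c m' * r ^ m'" by simp
    have in': "(l, m') \<in> P" using that lm_in by (auto simp: P_def gpairs_def)
    have "\<tau> powr expo_y a \<delta> l m' < (c m' * r ^ m') powr expo_y a \<delta> l m'"
      using gt \<tau> expo_pos[OF assms(3)] in' by (intro powr_less_mono2) (auto simp: P_def)
    then have "\<tau> powr expo_x a \<delta> l m' * \<tau> powr expo_y a \<delta> l m' * r powr (- a) <
       \<tau> powr expo_x a \<delta> l m' * (c m' * r ^ m') powr expo_y a \<delta> l m' * r powr (- a)"
      using \<tau> r by simp
    then have "t l m < t l m'" unfolding tlm tscale[OF in'] eq2 both[OF in', symmetric] .
    then show False using max[OF in'] by simp
  qed
  have "t l m \<le> gap a \<delta> \<Lambda> c"
    unfolding gap using fin lm_in member_le_sum[of "(l, m)" P "case_prod t"] by (auto simp: t_def)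
  then show ?thesis
    using r \<tau> eq2 1 2 le lm_in unfolding tlm P_def by (intro that[of r \<tau> l m]) auto
qed

text \<open>With \<open>\<rho> = r / r0\<close>, either of the two balanced monomials bounds the
  weight by a constant times \<open>\<rho> powr (a - k \<delta>) / r^2\<close>. The exponent is at
  least \<open>\<kappa>\<close> for \<open>k = l\<close> and at most \<open>-\<kappa>\<close> for
  \<open>k = m\<close>. Taking \<open>l\<close> inside the radius \<open>r0\<close> and
  \<open>m\<close> outside gives decay on both sides.\<close>

lemma weight_le_kern:
  assumes pos: "0 < r" "0 < r0" "0 < \<tau>" "0 < \<kappa>0" "0 < \<delta>" "0 < \<kappa>" "0 < g"
    and bal: "c l * r0 ^ l = \<tau>" "c m * r0 ^ m = \<tau>"
    and q: "\<kappa>0 * (c l * r ^ l) \<le> q" "\<kappa>0 * (c m * r ^ m) \<le> q"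
    and \<kappa>: "\<kappa> \<le> a - real l * \<delta>" "\<kappa> \<le> real m * \<delta> - a"
    and g: "g \<le> K * (\<tau> powr \<delta> * r0 powr (- a))"
  shows "r powr (a - 2) * q powr (- \<delta>) \<le> \<kappa>0 powr (- \<delta>) * K / g * kern \<kappa> r0 r"
proof -
  define \<rho> where "\<rho> = r / r0"
  have \<rho>: "\<rho> > 0" using pos by (simp add: \<rho>_def)
  have K: "\<tau> powr (- \<delta>) * r0 powr a \<le> K / g"
  proof -
    have "\<tau> powr (- \<delta>) * r0 powr a * g \<le> \<tau> powr (- \<delta>) * r0 powr a * (K * (\<tau> powr \<delta> * r0 powr
      (- a)))"
      using g by (intro mult_left_mono) auto
    also have "\<dots> = K * (\<tau> powr (- \<delta>) * \<tau> powr \<delta>) * (r0 powr a * r0 powr (- a))"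
      by (simp only: mult_ac)
    also have "\<dots> = K" using pos by (simp flip: powr_add)
    finally show ?thesis using pos by (simp add: pos_le_divide_eq)
  qed
  have r2: "r powr (a - 2) = r powr a / r\<^sup>2" using pos by (simp add: powr_diff powr_numeral)
  have ra: "r powr a = r0 powr a * \<rho> powr a" using pos by (simp add: \<rho>_def powr_divide)
  have main: "r powr (a - 2) * q powr (- \<delta>) \<le> \<kappa>0 powr (- \<delta>) * (\<tau> powr (- \<delta>) * r0 powr a) * (\<rho> powr
    (a - real k * \<delta>) / r\<^sup>2)"
    if "c k * r0 ^ k = \<tau>" "\<kappa>0 * (c k * r ^ k) \<le> q" for k
  proof -
    have "c k * r ^ k = \<tau> * \<rho> ^ k" using that(1) pos
      by (simp add: \<rho>_def power_divide field_simps flip: that(1))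
    then have "\<kappa>0 * (\<tau> * \<rho> ^ k) \<le> q" using that(2) by simp
    then have "q powr (- \<delta>) \<le> (\<kappa>0 * (\<tau> * \<rho> ^ k)) powr (- \<delta>)"
      using pos \<rho> by (intro powr_mono2') auto
    also have "\<dots> = \<kappa>0 powr (- \<delta>) * \<tau> powr (- \<delta>) * \<rho> powr (- (real k * \<delta>))"
      using pos \<rho> by (simp add: powr_mult powr_powr flip: powr_realpow)
    finally have "r powr (a - 2) * q powr (- \<delta>)
      \<le> r powr (a - 2) * (\<kappa>0 powr (- \<delta>) * \<tau> powr (- \<delta>) * \<rho> powr (- (real k * \<delta>)))"
      by (intro mult_left_mono) auto
    also have "\<dots> = \<kappa>0 powr (- \<delta>) * (\<tau> powr (- \<delta>) * r0 powr a) * ((\<rho> powr a * \<rho> powr (- (real k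
      * \<delta>))) / r\<^sup>2)"
      unfolding r2 ra by simp
    also have "\<rho> powr a * \<rho> powr (- (real k * \<delta>)) = \<rho> powr (a - real k * \<delta>)"
      by (simp flip: powr_add)
    finally show ?thesis .
  qed
  have inv: "(r0 / r) powr \<kappa> = \<rho> powr (- \<kappa>)" using pos
    by (simp add: \<rho>_def powr_divide powr_minus field_simps)
  have "\<exists>k\<in>{l, m}. \<rho> powr (a - real k * \<delta>) \<le> min (\<rho> powr \<kappa>) (\<rho> powr (- \<kappa>))"
  proof (cases "\<rho> \<le> 1")
    case True
    then have "\<rho> powr (a - real l * \<delta>) \<le> \<rho> powr \<kappa>" "\<rho> powr \<kappa> \<le> \<rho> powr (- \<kappa>)"
      using \<rho> \<kappa> pos by (auto intro!: powr_mono')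
    then show ?thesis by auto
  next
    case False
    then have "\<rho> powr (a - real m * \<delta>) \<le> \<rho> powr (- \<kappa>)" "\<rho> powr (- \<kappa>) \<le> \<rho> powr \<kappa>"
      using \<rho> \<kappa> pos by (auto intro!: powr_mono)
    then show ?thesis by auto
  qed
  then obtain k where k: "k \<in> {l, m}" "\<rho> powr (a - real k * \<delta>) \<le> min (\<rho> powr \<kappa>) (\<rho> powr (- \<kappa>))"
    by blast
  have kern: "kern \<kappa> r0 r = min (\<rho> powr \<kappa>) (\<rho> powr (- \<kappa>)) / r\<^sup>2"
    using pos inv by (simp add: kern_def \<rho>_def)
  have "r powr (a - 2) * q powr (- \<delta>) \<le> \<kappa>0 powr (- \<delta>) * (\<tau> powr (- \<delta>) * r0 powr a) * (\<rho> powr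
    (a - real k * \<delta>) / r\<^sup>2)"
    using k(1) bal q by (intro main) auto
  also have "\<dots> \<le> \<kappa>0 powr (- \<delta>) * (K / g) * kern \<kappa> r0 r"
    unfolding kern using K k(2) order_trans[OF _ K, of 0]
      by (intro mult_mono divide_right_mono mult_nonneg_nonneg) auto
  finally show ?thesis by simp
qed

section \<open>The integral over the disc\<close>

definition vnorm :: "nat \<Rightarrow> nat \<Rightarrow> (nat \<Rightarrow> nat \<Rightarrow> complex) \<Rightarrow> complex \<Rightarrow> real" where
  "vnorm n D f z = L2_set (\<lambda>i. cmod (peval D (f i) z)) {1..n}"

definition vcoef :: "nat \<Rightarrow> nat \<Rightarrow> (nat \<Rightarrow> nat \<Rightarrow> complex) \<Rightarrow> complex \<Rightarrow> nat \<Rightarrow> real" where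
  "vcoef n D f x l = (\<Sum>i=1..n. cmod (tay D (f i) l x))"

definition vsum :: "nat \<Rightarrow> nat \<Rightarrow> (nat \<Rightarrow> nat \<Rightarrow> complex) \<Rightarrow> complex \<Rightarrow> real \<Rightarrow> real" where
  "vsum n D f x r = (\<Sum>l\<le>D. vcoef n D f x l * r ^ l)"

definition disc_integral :: "real \<Rightarrow> real \<Rightarrow> nat \<Rightarrow> nat \<Rightarrow> (nat \<Rightarrow> nat \<Rightarrow> complex) \<Rightarrow> nat \<Rightarrow> nat \<Rightarrow>
  (nat \<Rightarrow> nat \<Rightarrow> complex) \<Rightarrow> ennreal" where
  "disc_integral e \<delta> I M pc J N qc =
     (\<integral>\<^sup>+z\<in>ball 0 1. ennreal (pw (vnorm I M pc z) e) / ennreal (pw (vnorm J N qc z) \<delta>) \<partial>lborel)"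

lemma vcoef_nonneg: "0 \<le> vcoef n D f x l"
  by (auto simp: vcoef_def intro!: sum_nonneg)

lemma vsum_nonneg: "0 \<le> r \<Longrightarrow> 0 \<le> vsum n D f x r"
  by (auto simp: vsum_def intro!: sum_nonneg mult_nonneg_nonneg vcoef_nonneg)

lemma vsum_mono: "0 \<le> r \<Longrightarrow> r \<le> r' \<Longrightarrow> vsum n D f x r \<le> vsum n D f x r'"
  by (auto simp: vsum_def intro!: sum_mono mult_left_mono power_mono vcoef_nonneg)

lemma vsum_eq: "vsum n D f x r = (\<Sum>i=1..n. taysum D (f i) x r)"
  unfolding vsum_def vcoef_def taysum_def sum_distrib_right by (rule sum.swap)

lemma vcoef_le_vsum: "l \<le> D \<Longrightarrow> 0 \<le> r \<Longrightarrow> vcoef n D f x l * r ^ l \<le> vsum n D f x r"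
  unfolding vsum_def by (rule member_le_sum) (auto intro!: mult_nonneg_nonneg vcoef_nonneg)

lemma vnorm_nonneg: "0 \<le> vnorm n D f z"
  by (simp add: vnorm_def)

lemma vnorm_le_vsum: "vnorm n D f z \<le> vsum n D f x (cmod (z - x))"
proof -
  have "vnorm n D f z \<le> (\<Sum>i=1..n. cmod (peval D (f i) z))"
    unfolding vnorm_def by (rule L2_set_le_sum) auto
  also have "\<dots> \<le> (\<Sum>i=1..n. taysum D (f i) x (cmod (z - x)))"
    using cmod_peval_le[of D _ x "z - x"] by (intro sum_mono) simp
  finally show ?thesis by (simp add: vsum_eq)
qed

lemma peval_le_vnorm: "i \<in> {1..n} \<Longrightarrow> cmod (peval D (f i) z) \<le> vnorm n D f z"
  unfolding vnorm_def by (rule member_le_L2_set) auto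

text \<open>The disc of radius \<open>r\<close> about \<open>x\<close> lies in the unit disc. There
  the denominator is at most its Taylor majorant at radius \<open>r\<close>, and on a subdisc of
  radius \<open>\<eta> r\<close> the numerator is at least a fixed multiple of its own
  majorant.\<close>

lemma disc_integral_ge:
  assumes "1 \<le> I" "0 \<le> e" "0 \<le> \<delta>"
  shows "\<exists>c>0. \<forall>pc J N qc x r. cmod x \<le> 1 / 2 \<longrightarrow> 0 < r \<longrightarrow> r \<le> 1 / 2 \<longrightarrow> 0 < vsum J N qc x r \<longrightarrow>
    ennreal (c * (r\<^sup>2 * pw (vsum I M pc x r) e / pw (vsum J N qc x r) \<delta>))
      \<le> disc_integral e \<delta> I M pc J N qc"
proof -
  obtain \<eta> where \<eta>: "\<eta> > 0" "\<eta> \<le> 1 / 2" "\<And>f x r. r > 0 \<Longrightarrow> (\<exists>w0. cmod w0 \<le> r / 2 \<and>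
     (\<forall>w. cmod (w - w0) < \<eta> * r \<longrightarrow> \<eta> * taysum M f x r \<le> cmod (peval M f (x + w))))"
    using large_on_ball[of M] by blast
  define c where "c = pi * \<eta>\<^sup>2 * (\<eta> / real I) powr e"
  have c: "c > 0" using \<eta> assms by (simp add: c_def)
  have "ennreal (c * (r\<^sup>2 * pw (vsum I M pc x r) e / pw (vsum J N qc x r) \<delta>))
    \<le> disc_integral e \<delta> I M pc J N qc"
    if x: "cmod x \<le> 1 / 2" and r: "0 < r" "r \<le> 1 / 2" and q: "0 < vsum J N qc x r" for pc J N qc x r
  proof -
    \<comment> \<open>By averaging, some component carries at least the share \<open>1 / I\<close>
      of the majorant; the subdisc is chosen for this component.\<close>
    have "\<exists>i\<in>{1..I}. vsum I M pc x r / real I \<le> taysum M (pc i) x r"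
    proof (rule ccontr)
      assume "\<not> ?thesis"
      then have "vsum I M pc x r < (\<Sum>i=1..I. vsum I M pc x r / real I)"
        unfolding vsum_eq[of I M pc x r] using assms(1)
          by (intro sum_strict_mono) (auto simp: vsum_eq not_le)
      then show False using assms(1) by simp
    qed
    then obtain i where i: "i \<in> {1..I}" "vsum I M pc x r / real I \<le> taysum M (pc i) x r" by blast
    obtain w0 where w0: "cmod w0 \<le> r / 2"
      "\<And>w. cmod (w - w0) < \<eta> * r \<Longrightarrow> \<eta> * taysum M (pc i) x r \<le> cmod (peval M (pc i) (x + w))"
      using \<eta>(3)[OF r(1)] by blast
    define v where "v = (\<eta> / real I) powr e * pw (vsum I M pc x r) e / pw (vsum J N qc x r) \<delta>"
    have v0: "0 \<le> v" by (simp add: v_def pw_nonneg)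
    have pt: "ennreal v * indicator (ball (x + w0) (\<eta> * r)) z \<le>
      ennreal (pw (vnorm I M pc z) e) / ennreal (pw (vnorm J N qc z) \<delta>) * indicator
        (ball 0 1) z" for z
    proof (cases "z \<in> ball (x + w0) (\<eta> * r)")
      case True
      have near: "cmod ((z - x) - w0) < \<eta> * r"
        using True by (simp add: dist_norm norm_minus_commute diff_diff_eq)
      have "\<eta> * r \<le> r / 2" using mult_right_mono[OF \<eta>(2), of r] r by simp
      then have zr: "cmod (z - x) < r" using norm_triangle_ineq[of "z - x - w0" w0] near w0(1)
        by simp
      have zb: "z \<in> ball 0 1" using norm_triangle_ineq[of "z - x" x] zr x r by simp
      have "\<eta> / real I * vsum I M pc x r \<le> \<eta> * taysum M (pc i) x r"
        using i(2) \<eta>(1) mult_left_mono[of "vsum I M pc x r / real I" "taysum M (pc i) x r" \<eta>]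
          by simp
      also have "\<dots> \<le> cmod (peval M (pc i) z)" using w0(2)[OF near] by simp
      also have "\<dots> \<le> vnorm I M pc z" using i(1) by (rule peval_le_vnorm)
      finally have "pw (\<eta> / real I * vsum I M pc x r) e \<le> pw (vnorm I M pc z) e"
        using assms(2) \<eta>(1) r by (intro pw_mono)
          (auto intro!: divide_nonneg_nonneg mult_nonneg_nonneg vsum_nonneg)
      moreover have "pw (\<eta> / real I * vsum I M pc x r) e
        = (\<eta> / real I) powr e * pw (vsum I M pc x r) e"
        using \<eta>(1) assms(1) r by (subst pw_mult) (auto simp: vsum_nonneg pw_pos)
      ultimately have P: "(\<eta> / real I) powr e * pw (vsum I M pc x r) e \<le> pw (vnorm I M pc z) e"
        by simp
      have "vnorm J N qc z \<le> vsum J N qc x r"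
        using vnorm_le_vsum[of J N qc z x] vsum_mono[of "cmod (z - x)" r J N qc x] zr by simp
      then have Q: "pw (vnorm J N qc z) \<delta> \<le> pw (vsum J N qc x r) \<delta>"
        using assms(3) by (intro pw_mono vnorm_nonneg) auto
      have Q0: "0 < pw (vsum J N qc x r) \<delta>" using q by (simp add: pw_pos)
      have "ennreal v = ennreal ((\<eta> / real I) powr e * pw (vsum I M pc x r) e) / ennreal (pw
        (vsum J N qc x r) \<delta>)"
        unfolding v_def by (rule divide_ennreal[symmetric]) (use Q0 in \<open>auto simp: pw_nonneg\<close>)
      also have "\<dots> \<le> ennreal (pw (vnorm I M pc z) e) / ennreal (pw (vnorm J N qc z) \<delta>)"
        by (rule ennreal_divide_le_divide[OF P Q Q0]) (simp add: pw_nonneg)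
      finally show ?thesis using zb True by simp
    qed simp
    have "ennreal v * emeasure lborel (ball (x + w0) (\<eta> * r))
      = (\<integral>\<^sup>+z. ennreal v * indicator (ball (x + w0) (\<eta> * r)) z \<partial>lborel)"
      by (simp add: nn_integral_cmult_indicator)
    also have "\<dots> \<le> disc_integral e \<delta> I M pc J N qc"
      unfolding disc_integral_def by (intro nn_integral_mono pt)
    finally have "ennreal v * emeasure lborel (ball (x + w0) (\<eta> * r))
      \<le> disc_integral e \<delta> I M pc J N qc" .
    moreover have "emeasure lborel (ball (x + w0) (\<eta> * r)) = ennreal (pi * (\<eta> * r)\<^sup>2)"
      using \<eta>(1) r by (subst emeasure_ball) (auto simp: unit_ball_vol_2)
    moreover have "v * (pi * (\<eta> * r)\<^sup>2) = c * (r\<^sup>2 * pw (vsum I M pc x r) e / pw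
      (vsum J N qc x r) \<delta>)"
      by (simp add: v_def c_def power_mult_distrib)
    ultimately show ?thesis using v0 by (simp flip: ennreal_mult)
  qed
  then show ?thesis using c by blast
qed

text \<open>The tolerance is half of the \<open>(1 / 2) ^ (N + 1)\<close> allowed in
  \<open>near_monic_root_le\<close>; the other half is reserved for the perturbation
  \<open>Q_j / h\<close>.\<close>

definition near_monic :: "real \<Rightarrow> nat \<Rightarrow> nat \<Rightarrow> (nat \<Rightarrow> nat \<Rightarrow> complex) \<Rightarrow> bool" where
  "near_monic C J N qc \<longleftrightarrow> (\<Sum>\<nu>\<le>N. cmod (qc 1 \<nu> - (if \<nu> = N then 1 else 0))) \<le> (1 / 2) ^ (N + 2) \<and>
     (\<forall>j\<in>{1..J}. (\<Sum>\<nu>\<le>N. cmod (qc j \<nu>)) \<le> C)"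

lemma near_monic_lead:
  assumes "near_monic C J N qc"
  shows "1 / 2 \<le> cmod (qc 1 N)"
proof -
  have "cmod (qc 1 N - 1) \<le> (\<Sum>\<nu>\<le>N. cmod (qc 1 \<nu> - (if \<nu> = N then 1 else 0)))"
    using member_le_sum[of N "{..N}" "\<lambda>\<nu>. cmod (qc 1 \<nu> - (if \<nu> = N then 1 else 0))"] by simp
  also have "\<dots> \<le> (1 / 2) ^ (N + 2)" using assms by (simp add: near_monic_def)
  also have "\<dots> \<le> (1 / 2) ^ 1" by (intro power_decreasing) auto
  finally show ?thesis using norm_triangle_ineq2[of 1 "1 - qc 1 N"]
    by (simp add: norm_minus_commute)
qed

lemma vcoef_le:
  assumes "near_monic C J N qc" "cmod x \<le> 1"
  shows "vcoef J N qc x l \<le> real J * (2 ^ N * C)"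
proof -
  have "vcoef J N qc x l \<le> (\<Sum>j=1..J. 2 ^ N * C)"
    unfolding vcoef_def
  proof (rule sum_mono)
    fix j assume "j \<in> {1..J}"
    then have "(\<Sum>\<nu>\<le>N. cmod (qc j \<nu>)) \<le> C" using assms(1) by (simp add: near_monic_def)
    then show "cmod (tay N (qc j) l x) \<le> 2 ^ N * C"
      using cmod_tay_le[OF assms(2), of N "qc j" l] by (smt (verit) mult_left_mono zero_le_power)
  qed
  then show ?thesis by simp
qed

text \<open>The Taylor coefficient of degree \<open>N\<close> of \<open>Q_1\<close> is its leading
  coefficient at every center, and this has modulus at least \<open>1 / 2\<close>. So the local size
  of the denominator is positive for every \<open>r > 0\<close>.\<close>

lemma vsum_ge:
  assumes "near_monic C J N qc" "1 \<le> J" "0 \<le> r"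
  shows "r ^ N / 2 \<le> vsum J N qc x r"
proof -
  have "1 / 2 \<le> cmod (tay N (qc 1) N x)" using near_monic_lead[OF assms(1)] by (simp add: tay_top)
  also have "\<dots> \<le> vcoef J N qc x N" unfolding vcoef_def using assms(2)
    by (intro member_le_sum) auto
  finally have "1 / 2 * r ^ N \<le> vcoef J N qc x N * r ^ N" using assms(3)
    by (intro mult_right_mono) auto
  also have "\<dots> \<le> vsum J N qc x r" using assms(3) by (intro vcoef_le_vsum) auto
  finally show ?thesis by simp
qed

text \<open>Applied to \<open>h Q_1 + Q_j\<close>, the bound \<open>taysum_le_peval\<close> is
  available because \<open>h \<ge> 4 C\<close> keeps the leading coefficient away from zero. The
  case \<open>j = 1\<close> is \<open>(h + 1) Q_1\<close> and so bounds \<open>Q_1\<close> itself;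
  subtracting \<open>h Q_1\<close> then bounds each \<open>Q_j\<close>.\<close>

lemma vsum_le_vnorm:
  fixes h :: nat
  assumes nm: "near_monic C J N qc" and J: "1 \<le> J" and C: "0 < C" and h: "C * 2 ^ (N + 2) \<le> real h"
    and roots: "\<And>j y. j \<in> {1..J} \<Longrightarrow> peval N (\<lambda>\<nu>. of_nat h * qc 1 \<nu> + qc j \<nu>) y = 0 \<Longrightarrow> cmod (z - x)
      \<le> cmod (z - y)"
  shows "vsum J N qc x (cmod (z - x)) \<le> real J * (3 ^ N * (2 * real h + 1)) * vnorm J N qc z"
proof -
  define r where "r = cmod (z - x)"
  have r0: "0 \<le> r" by (simp add: r_def)
  have h4: "4 * C \<le> real h"
  proof -
    have "(2::real) ^ 2 \<le> 2 ^ (N + 2)" by (intro power_increasing) auto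
    then have "C * 4 \<le> C * 2 ^ (N + 2)" using C by (intro mult_left_mono) auto
    then show ?thesis using h by simp
  qed
  have main: "taysum N (\<lambda>\<nu>. of_nat h * qc 1 \<nu> + qc j \<nu>) x r
    \<le> 3 ^ N * ((real h + 1) * vnorm J N qc z)"
    if j: "j \<in> {1..J}" for j
  proof -
    have "cmod (qc j N) \<le> (\<Sum>\<nu>\<le>N. cmod (qc j \<nu>))" by (rule member_le_sum) auto
    also have "\<dots> \<le> C" using nm j by (simp add: near_monic_def)
    finally have 1: "cmod (qc j N) \<le> C" .
    have 2: "2 * C \<le> cmod (of_nat h * qc 1 N)"
    proof -
      have "real h * (1 / 2) \<le> real h * cmod (qc 1 N)"
        using near_monic_lead[OF nm] by (intro mult_left_mono) auto
      then show ?thesis using h4 by (simp add: norm_mult)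
    qed
    have "of_nat h * qc 1 N + qc j N \<noteq> 0"
    proof
      assume "of_nat h * qc 1 N + qc j N = 0"
      then have "of_nat h * qc 1 N = - qc j N" by (simp add: eq_neg_iff_add_eq_0)
      then show False using 1 2 C by simp
    qed
    then have "taysum N (\<lambda>\<nu>. of_nat h * qc 1 \<nu> + qc j \<nu>) x r
      \<le> 3 ^ N * cmod (peval N (\<lambda>\<nu>. of_nat h * qc 1 \<nu> + qc j \<nu>) z)"
      unfolding r_def by (rule taysum_le_peval) (use roots j in auto)
    also have "\<dots> \<le> 3 ^ N * ((real h + 1) * vnorm J N qc z)"
    proof (rule mult_left_mono)
      have "cmod (peval N (\<lambda>\<nu>. of_nat h * qc 1 \<nu> + qc j \<nu>) z)
        \<le> real h * cmod (peval N (qc 1) z) + cmod (peval N (qc j) z)"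
        unfolding peval_linear by (rule order_trans[OF norm_triangle_ineq]) (simp add: norm_mult)
      also have "\<dots> \<le> real h * vnorm J N qc z + vnorm J N qc z"
        using J j by (intro add_mono mult_left_mono peval_le_vnorm) auto
      finally show "cmod (peval N (\<lambda>\<nu>. of_nat h * qc 1 \<nu> + qc j \<nu>) z)
        \<le> (real h + 1) * vnorm J N qc z"
        by (simp add: algebra_simps)
    qed simp
    finally show ?thesis .
  qed
  have first: "real h * taysum N (qc 1) x r \<le> 3 ^ N * (real h * vnorm J N qc z)"
  proof -
    have "tay N (\<lambda>\<nu>. of_nat h * qc 1 \<nu> + qc 1 \<nu>) l x = of_nat (h + 1) * tay N (qc 1) l x" for l
      by (subst tay_linear) (simp add: algebra_simps)
    then have "taysum N (\<lambda>\<nu>. of_nat h * qc 1 \<nu> + qc 1 \<nu>) x r = real (h + 1) * taysum N (qc 1) x r"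
      by (simp only: taysum_def norm_mult norm_of_nat sum_distrib_left mult.assoc)
    then have "taysum N (\<lambda>\<nu>. of_nat h * qc 1 \<nu> + qc 1 \<nu>) x r = (real h + 1) * taysum N (qc 1) x r"
      by (simp add: add.commute)
    then have "(real h + 1) * taysum N (qc 1) x r \<le> (real h + 1) * (3 ^ N * vnorm J N qc z)"
      using main[of 1] J by (simp add: algebra_simps)
    then have "taysum N (qc 1) x r \<le> 3 ^ N * vnorm J N qc z" by (simp add: mult_le_cancel_left_pos)
    then have "real h * taysum N (qc 1) x r \<le> real h * (3 ^ N * vnorm J N qc z)"
      by (intro mult_left_mono) auto
    then show ?thesis by (simp add: algebra_simps)
  qed
  have "taysum N (qc j) x r \<le> 3 ^ N * (2 * real h + 1) * vnorm J N qc z" if j: "j \<in> {1..J}" for j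
  proof -
    have "taysum N (qc j) x r \<le> taysum N (\<lambda>\<nu>. of_nat h * qc 1 \<nu> + qc j \<nu>) x r + real h * taysum N
      (qc 1) x r"
      unfolding taysum_def sum_distrib_left sum.distrib[symmetric]
    proof (rule sum_mono)
      fix l
      have "cmod (tay N (qc j) l x) \<le> cmod (tay N (\<lambda>\<nu>. of_nat h * qc 1 \<nu> + qc j \<nu>) l x) + real h
        * cmod (tay N (qc 1) l x)"
        using norm_triangle_ineq4[of "of_nat h * tay N (qc 1) l x + tay N (qc j) l x"
          "of_nat h * tay N (qc 1) l x"]
        by (simp add: tay_linear norm_mult)
      from mult_right_mono[OF this, of "r ^ l"]
      show "cmod (tay N (qc j) l x) * r ^ l \<le> cmod (tay N (\<lambda>\<nu>. of_nat h * qc 1 \<nu> + qc j \<nu>) l x)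
        * r ^ l + real h * (cmod (tay N (qc 1) l x) * r ^ l)"
        using r0 by (simp add: algebra_simps)
    qed
    then show ?thesis using main[OF j] first by (simp add: algebra_simps)
  qed
  then have "vsum J N qc x r \<le> (\<Sum>j=1..J. 3 ^ N * (2 * real h + 1) * vnorm J N qc z)"
    unfolding vsum_eq by (rule sum_mono)
  then show ?thesis by (simp add: r_def)
qed

text \<open>Center \<open>0\<close> and radius \<open>1 / 2\<close> in
  \<open>disc_integral_ge\<close>: there the numerator's majorant controls all coefficients, and the
  denominator is bounded by \<open>C\<close>, \<open>J\<close> and \<open>N\<close>.\<close>

lemma disc_integral_ge_norm:
  assumes "1 \<le> I" "0 \<le> e" "0 \<le> \<delta>" "1 \<le> J" "0 < C"
  shows "\<exists>D\<ge>1. \<forall>pc qc. near_monic C J N qc \<longrightarrow>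
    ennreal (pw (\<Sum>i=1..I. \<Sum>\<mu>\<le>M. cmod (pc i \<mu>)) e) \<le> ennreal D * disc_integral e \<delta> I M pc J N qc"
proof -
  obtain c where c: "c > 0" "\<And>pc J N qc x r. cmod x \<le> 1 / 2 \<Longrightarrow> 0 < r \<Longrightarrow> r \<le> 1 / 2 \<Longrightarrow> 0
    < vsum J N qc x r \<Longrightarrow>
    ennreal (c * (r\<^sup>2 * pw (vsum I M pc x r) e / pw (vsum J N qc x r) \<delta>))
      \<le> disc_integral e \<delta> I M pc J N qc"
    using disc_integral_ge[OF assms(1-3), of M] by blast
  define B where "B = real (Suc N) * (real J * (2 ^ N * C))"
  define D0 where "D0 = 4 / c * ((1 / 2) ^ M) powr (- e) * B powr \<delta>"
  define D where "D = max 1 D0"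
  have B: "B > 0" using assms by (simp add: B_def)
  have "ennreal (pw (\<Sum>i=1..I. \<Sum>\<mu>\<le>M. cmod (pc i \<mu>)) e) \<le> ennreal D * disc_integral e \<delta> I M pc J N qc"
    if nm: "near_monic C J N qc" for pc qc
  proof -
    define S where "S = (\<Sum>i=1..I. \<Sum>\<mu>\<le>M. cmod (pc i \<mu>))"
    have S0: "0 \<le> S" unfolding S_def by (intro sum_nonneg) auto
    define q where "q = vsum J N qc 0 (1 / 2)"
    have q0: "0 < q" using vsum_ge[OF nm assms(4), of "1 / 2" 0] unfolding q_def
      by (smt (verit) half_gt_zero zero_less_power)
    have qB: "q \<le> B"
    proof -
      have "vsum J N qc 0 (1 / 2) \<le> (\<Sum>l\<le>N. (real J * (2 ^ N * C)) * 1)"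
        unfolding vsum_def by (intro sum_mono mult_mono vcoef_le[OF nm] power_le_one)
          (use assms in auto)
      then show ?thesis by (simp add: q_def B_def)
    qed
    have P: "(1 / 2) ^ M * S \<le> vsum I M pc 0 (1 / 2)"
      unfolding vsum_eq S_def sum_distrib_left taysum_def
    proof (intro sum_mono)
      fix i \<mu> assume "\<mu> \<in> {..M}"
      then have "(1 / 2 :: real) ^ M \<le> (1 / 2) ^ \<mu>" by (intro power_decreasing) auto
      then show "(1 / 2) ^ M * cmod (pc i \<mu>) \<le> cmod (tay M (pc i) \<mu> 0) * (1 / 2) ^ \<mu>"
        using \<open>\<mu> \<in> {..M}\<close> by (simp add: tay_0 mult.commute mult_left_mono)
    qed
    have "((1 / 2) ^ M) powr e * pw S e = pw ((1 / 2) ^ M * S) e"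
      using S0 by (simp add: pw_mult pw_pos)
    also have "\<dots> \<le> pw (vsum I M pc 0 (1 / 2)) e"
      using P S0 assms by (intro pw_mono) auto
    finally have P': "((1 / 2) ^ M) powr e * pw S e \<le> pw (vsum I M pc 0 (1 / 2)) e" .
    have Q': "pw q \<delta> \<le> B powr \<delta>" using q0 qB assms B by (simp add: pw_pos powr_mono2)
    have "pw S e = D0 * (c * ((1 / 2)\<^sup>2 * (((1 / 2) ^ M) powr e * pw S e) / B powr \<delta>))"
    proof -
      have "((1 / 2::real) ^ M) powr (- e) * ((1 / 2) ^ M) powr e = 1" by (simp flip: powr_add)
      then show ?thesis using c(1) B by (simp add: D0_def field_simps)
    qed
    also have "\<dots> \<le> D * (c * ((1 / 2)\<^sup>2 * pw (vsum I M pc 0 (1 / 2)) e / pw q \<delta>))"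
      using P' Q' q0 c(1) B
      by (intro mult_mono frac_le) (auto simp: D_def D0_def pw_nonneg pw_pos)
    finally have "ennreal (pw S e) \<le> ennreal D * ennreal (c * ((1 / 2)\<^sup>2 * pw (vsum I M pc 0 (1
      / 2)) e / pw q \<delta>))"
      using c(1) by (subst ennreal_mult[symmetric]) (auto simp: D_def pw_nonneg ennreal_leI)
    also have "\<dots> \<le> ennreal D * disc_integral e \<delta> I M pc J N qc"
      using q0 unfolding q_def by (intro mult_left_mono c(2)) auto
    finally show ?thesis by (simp add: S_def)
  qed
  then show ?thesis by (intro exI[of _ D]) (auto simp: D_def)
qed

text \<open>For \<delta> = 0 the integrand is bounded by the coefficient norm of the numerator, so
  together with the preceding lower bound this case is settled without centers. The constant is the
  area of the disc.\<close>

lemma disc_integral_le_norm: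
  assumes "0 \<le> e"
  shows "disc_integral e 0 I M pc J N qc \<le> ennreal pi * ennreal (pw (\<Sum>i=1..I. \<Sum>\<mu>\<le>M. cmod
    (pc i \<mu>)) e)"
proof -
  define S where "S = (\<Sum>i=1..I. \<Sum>\<mu>\<le>M. cmod (pc i \<mu>))"
  have "vnorm I M pc z \<le> S" if "z \<in> ball 0 1" for z
  proof -
    have "vnorm I M pc z \<le> vsum I M pc 0 (cmod z)" using vnorm_le_vsum[of I M pc z 0] by simp
    also have "\<dots> \<le> (\<Sum>i=1..I. \<Sum>\<mu>\<le>M. cmod (pc i \<mu>) * 1)"
      unfolding vsum_eq taysum_def using that
      by (intro sum_mono mult_mono power_le_one) (auto simp: tay_0)
    finally show ?thesis by (simp add: S_def)
  qed
  then have "disc_integral e 0 I M pc J N qc \<le> (\<integral>\<^sup>+z. ennreal (pw S e) * indicator (ball 0 1)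
    (z::complex) \<partial>lborel)"
    unfolding disc_integral_def using assms
    by (intro nn_integral_mono) (auto simp: indicator_def pw_def[of _ 0] divide_ennreal_def
      intro!: ennreal_leI pw_mono vnorm_nonneg)
  also have "\<dots> = ennreal (pw S e) * ennreal pi"
    by (simp add: nn_integral_cmult_indicator emeasure_ball unit_ball_vol_2)
  finally show ?thesis by (simp add: S_def mult.commute)
qed

definition cext :: "nat \<Rightarrow> (nat \<Rightarrow> real) \<Rightarrow> nat \<Rightarrow> real" where
  "cext L c l = (if l = L then 1 else c l)"

text \<open>The denominator \<open>D\<close> attached to the center \<open>x\<close> and the exponent \<open>a\<close>. The artificial monomial
  \<open>r\<^sup>L\<close> encodes the restriction to bounded radii.\<close>
definition cdenom :: "real \<Rightarrow> nat \<Rightarrow> nat \<Rightarrow> nat \<Rightarrow> (nat \<Rightarrow> nat \<Rightarrow> complex) \<Rightarrow> complex \<Rightarrow> real \<Rightarrow> real" where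
  "cdenom \<delta> L J N qc x a = gap a \<delta> ({..N} \<union> {L}) (cext L (vcoef J N qc x))"

lemma cext_nonneg: "0 \<le> cext L (vcoef J N qc x) l"
  by (simp add: cext_def vcoef_nonneg)

lemma finite_lower_bound_pos:
  fixes f :: "'a \<Rightarrow> real"
  assumes "finite S" "\<And>s. s \<in> S \<Longrightarrow> 0 < f s"
  shows "\<exists>\<kappa>>0. \<forall>s\<in>S. \<kappa> \<le> f s"
  using assms
proof induction
  case empty
  then show ?case by (auto intro: exI[of _ 1])
next
  case (insert s S)
  then obtain \<kappa> where "\<kappa> > 0" "\<forall>s\<in>S. \<kappa> \<le> f s" by auto
  then show ?case using insert.prems[of s] by (intro exI[of _ "min \<kappa> (f s)"]) auto
qed

section \<open>Two-sided estimate of the integral by its centers\<close>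

context
  fixes I J M N L h :: nat and e \<delta> C :: real
  assumes I: "1 \<le> I" and J: "1 \<le> J" and e: "0 \<le> e" and \<delta>: "0 < \<delta>" and C: "0 < C"
    and L: "N < L" "real M * e + 2 < real L * \<delta>"
    and nondeg: "\<And>\<nu> l. \<nu> \<le> M \<Longrightarrow> l \<le> N \<Longrightarrow> real \<nu> * e + 2 \<noteq> real l * \<delta>"
    and h: "C * 2 ^ (N + 2) \<le> real h"
begin

text \<open>Only finitely many exponents occur and none is zero, by nondegeneracy for
  \<open>l \<le> N\<close> and by the choice of \<open>L\<close> for \<open>l = L\<close>. Their
  common margin \<open>\<kappa>\<close> is the decay rate in \<open>kern\<close>.\<close>

lemma spectral_gap: "\<exists>\<kappa>>0. \<forall>\<nu>\<le>M. \<forall>l\<in>{..N} \<union> {L}. \<kappa> \<le> \<bar>real \<nu> * e + 2 - real l * \<delta>\<bar>"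
proof -
  have "\<bar>real \<nu> * e + 2 - real l * \<delta>\<bar> > 0" if "\<nu> \<le> M" "l \<in> {..N} \<union> {L}" for \<nu> l
  proof (cases "l = L")
    case True
    have "real \<nu> * e \<le> real M * e" using that e by (intro mult_right_mono) auto
    then show ?thesis using L(2) True by simp
  next
    case False
    then show ?thesis using nondeg[of \<nu> l] that by auto
  qed
  then have "\<exists>\<kappa>>0. \<forall>(\<nu>, l)\<in>{..M} \<times> ({..N} \<union> {L}). \<kappa> \<le> \<bar>real \<nu> * e + 2 - real l * \<delta>\<bar>"
    using finite_lower_bound_pos[of "{..M} \<times> ({..N} \<union> {L})"
      "\<lambda>(\<nu>, l). \<bar>real \<nu> * e + 2 - real l * \<delta>\<bar>"] by auto
  then show ?thesis by auto
qed

text \<open>At each point the closest center alone gives a bound for the integrand by finitely many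
  kernels, one for each power \<open>\<nu>\<close> of the numerator. Summing over all centers
  removes the dependence on which one is closest, and each kernel has bounded integral.\<close>

lemma disc_integral_le:
  "\<exists>D\<ge>1. \<forall>pc qc K x. near_monic C J N qc \<longrightarrow> finite (K :: nat set) \<longrightarrow> K \<noteq> {} \<longrightarrow> (\<forall>k\<in>K. cmod (x k)
    \<le> 1 / 2) \<longrightarrow>
    (\<forall>j\<in>{1..J}. \<forall>y. peval N (\<lambda>\<nu>. of_nat h * qc 1 \<nu> + qc j \<nu>) y = 0 \<longrightarrow> y \<in> x ` K) \<longrightarrow>
    disc_integral e \<delta> I M pc J N qc \<le> ennreal D * (\<Sum>k\<in>K. \<Sum>\<nu>\<le>M.
      ennreal (pw (vcoef I M pc (x k) \<nu>) e) / ennreal (cdenom \<delta> L J N qc (x k) (real \<nu> * e + 2)))"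
proof -
  define \<Lambda> where "\<Lambda> = {..N} \<union> {L}"
  have fin\<Lambda>: "finite \<Lambda>" by (simp add: \<Lambda>_def)
  obtain \<kappa> where \<kappa>: "\<kappa> > 0" "\<And>\<nu> l. \<nu> \<le> M \<Longrightarrow> l \<in> \<Lambda> \<Longrightarrow> \<kappa> \<le> \<bar>real \<nu> * e + 2 - real l * \<delta>\<bar>"
    using spectral_gap by (auto simp: \<Lambda>_def)
  obtain K0 where K0: "K0 > 0" "\<And>r0 a::complex. r0 > 0 \<Longrightarrow>
      (\<integral>\<^sup>+z. ennreal (kern \<kappa> r0 (cmod (z - a))) \<partial>lborel) \<le> ennreal K0"
    using nn_integral_kern_le[OF \<kappa>(1)] by blast
  \<comment> \<open>For the artificial monomial: a point of the unit disc has distance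
    \<open>r < 2\<close> from a center, so \<open>r ^ L \<le> 2 ^ (L - N) * r ^ N\<close>, while the
    local size of the denominator is at least \<open>r ^ N / 2\<close>.\<close>
  define \<kappa>0 :: real where "\<kappa>0 = (1 / 2) ^ (L - N + 1)"
  have "\<kappa>0 \<le> 1" unfolding \<kappa>0_def by (rule power_le_one) auto
  then have \<kappa>0: "0 < \<kappa>0" "\<kappa>0 \<le> 1" by (simp_all add: \<kappa>0_def)
  define Cq where "Cq = real J * (3 ^ N * (2 * real h + 1))"
  have Cq: "Cq > 0" using J by (simp add: Cq_def)
  define Cc where "Cc = real (card \<Lambda> * card \<Lambda>)"
  define A where "A = Cq powr \<delta> * (real (M + 1) powr e * (\<kappa>0 powr (- \<delta>) * Cc))"
  have A: "A \<ge> 0" unfolding A_def Cc_def by auto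
  define D where "D = max 1 (A * K0)"
  have "disc_integral e \<delta> I M pc J N qc \<le> ennreal D * (\<Sum>k\<in>K. \<Sum>\<nu>\<le>M.
      ennreal (pw (vcoef I M pc (x k) \<nu>) e) / ennreal (cdenom \<delta> L J N qc (x k) (real \<nu> * e + 2)))"
    if nm: "near_monic C J N qc" and K: "finite K" "K \<noteq> {}" and x: "\<forall>k\<in>K. cmod (x k) \<le> 1 / 2"
      and roots: "\<forall>j\<in>{1..J}. \<forall>y. peval N (\<lambda>\<nu>. of_nat h * qc 1 \<nu> + qc j \<nu>) y = 0 \<longrightarrow> y \<in> x ` K"
    for pc qc and K :: "nat set" and x
  proof -
    define n where "n k \<nu> = pw (vcoef I M pc (x k) \<nu>) e" for k \<nu>
    define g where "g k \<nu> = cdenom \<delta> L J N qc (x k) (real \<nu> * e + 2)" for k \<nu>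
    have n0: "0 \<le> n k \<nu>" for k \<nu> by (simp add: n_def pw_nonneg)
    have g0: "0 \<le> g k \<nu>" for k \<nu> by (simp add: g_def cdenom_def gap_nonneg)
    have D1: "1 \<le> D" by (simp add: D_def)
    show ?thesis
    \<comment> \<open>A positive numerator over zero makes the right-hand side infinite. Otherwise
      real quotients can be used, those with numerator 0 being irrelevant.\<close>
    proof (cases "\<exists>k\<in>K. \<exists>\<nu>\<le>M. n k \<nu> > 0 \<and> g k \<nu> = 0")
      case True
      then obtain k \<nu> where "k \<in> K" "\<nu> \<le> M" "n k \<nu> > 0" "g k \<nu> = 0" by blast
      then have "ennreal (n k \<nu>) / ennreal (g k \<nu>) = top" by simp
      then have "top \<le> (\<Sum>\<nu>\<le>M. ennreal (n k \<nu>) / ennreal (g k \<nu>))"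
        using \<open>\<nu> \<le> M\<close> member_le_sum[of \<nu> "{..M}" "\<lambda>\<nu>. ennreal (n k \<nu>) / ennreal (g k \<nu>)"] by auto
      also have "\<dots> \<le> (\<Sum>k\<in>K. \<Sum>\<nu>\<le>M. ennreal (n k \<nu>) / ennreal (g k \<nu>))"
        using \<open>k \<in> K\<close> K(1) member_le_sum[of k K "\<lambda>k. \<Sum>\<nu>\<le>M. ennreal (n k \<nu>) / ennreal (g k \<nu>)"]
          by auto
      finally have "(\<Sum>k\<in>K. \<Sum>\<nu>\<le>M. ennreal (n k \<nu>) / ennreal (g k \<nu>)) = top"
        by (simp only: top_unique)
      then show ?thesis using D1 unfolding n_def g_def by (simp add: ennreal_mult_top)
    next
      case False
      have ex: "\<exists>r0>0. \<forall>r q. 0 < r \<longrightarrow> (\<forall>l\<in>\<Lambda>. \<kappa>0 * (cext L (vcoef J N qc (x k)) l * r ^ l) \<le> q) \<longrightarrow>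
          n k \<nu> * (r powr (real \<nu> * e) * q powr (- \<delta>))
            \<le> \<kappa>0 powr (- \<delta>) * Cc * (n k \<nu> / g k \<nu>) * kern \<kappa> r0 r"
        if kv: "k \<in> K" "\<nu> \<le> M" for k \<nu>
      proof (cases "n k \<nu> = 0")
        case True
        then show ?thesis by (intro exI[of _ 1]) auto
      next
        case nz: False
        then have g: "0 < g k \<nu>" using False kv n0[of k \<nu>] g0[of k \<nu>] by force
        define c where "c = cext L (vcoef J N qc (x k))"
        define a where "a = real \<nu> * e + 2"
        have gg: "g k \<nu> = gap a \<delta> \<Lambda> c" by (simp add: g_def cdenom_def \<Lambda>_def a_def c_def)
        obtain r0 \<tau> l m where bal: "r0 > 0" "\<tau> > 0" "(l, m) \<in> gpairs a \<delta> \<Lambda>" "c l * r0 ^ l = \<tau>"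
          "c m * r0 ^ m = \<tau>"
          "gap a \<delta> \<Lambda> c \<le> real (card (gpairs a \<delta> \<Lambda>)) * (\<tau> powr \<delta> * r0 powr (- a))"
          using balanced_radius[of \<Lambda> c \<delta> a] fin\<Lambda> \<delta> g gg cext_nonneg unfolding c_def by metis
        have lm: "l \<in> \<Lambda>" "m \<in> \<Lambda>" "real l * \<delta> < a" "a < real m * \<delta>" using bal(3)
          by (auto simp: gpairs_def)
        have \<kappa>l: "\<kappa> \<le> a - real l * \<delta>" and \<kappa>m: "\<kappa> \<le> real m * \<delta> - a"
          using \<kappa>(2)[OF kv(2) lm(1)] \<kappa>(2)[OF kv(2) lm(2)] lm(3,4) by (auto simp: a_def)
        have card: "real (card (gpairs a \<delta> \<Lambda>)) \<le> Cc"
          unfolding Cc_def gpairs_def card_cartesian_product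
          using fin\<Lambda> by (intro of_nat_mono mult_le_mono card_mono) auto
        have gle: "g k \<nu> \<le> Cc * (\<tau> powr \<delta> * r0 powr (- a))"
          unfolding gg by (rule order_trans[OF bal(6)]) (use card in \<open>auto intro!: mult_right_mono\<close>)
        show ?thesis
        proof (intro exI[of _ r0] conjI allI impI)
          fix r q :: real
          assume r: "0 < r" and q: "\<forall>l\<in>\<Lambda>. \<kappa>0 * (cext L (vcoef J N qc (x k)) l * r ^ l) \<le> q"
          have "r powr (a - 2) * q powr (- \<delta>) \<le> \<kappa>0 powr (- \<delta>) * Cc / g k \<nu> * kern \<kappa> r0 r"
            by (rule weight_le_kern[where c = c, OF r bal(1,2) \<kappa>0(1) \<delta> \<kappa>(1) g bal(4,5) _ _ \<kappa>l \<kappa>m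
              gle])
               (use q lm in \<open>auto simp: c_def\<close>)
          from mult_left_mono[OF this n0[of k \<nu>]]
          show "n k \<nu> * (r powr (real \<nu> * e) * q powr (- \<delta>))
            \<le> \<kappa>0 powr (- \<delta>) * Cc * (n k \<nu> / g k \<nu>) * kern \<kappa> r0 r"
            by (simp add: a_def mult_ac)
        qed (rule bal(1))
      qed
      then obtain r0 where r0: "\<And>k \<nu>. k \<in> K \<Longrightarrow> \<nu> \<le> M \<Longrightarrow> r0 k \<nu> > 0"
        "\<And>k \<nu> r q. k \<in> K \<Longrightarrow> \<nu> \<le> M \<Longrightarrow> 0 < r \<Longrightarrow> (\<And>l. l \<in> \<Lambda>
          \<Longrightarrow> \<kappa>0 * (cext L (vcoef J N qc (x k)) l * r ^ l) \<le> q) \<Longrightarrow>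
          n k \<nu> * (r powr (real \<nu> * e) * q powr (- \<delta>))
            \<le> \<kappa>0 powr (- \<delta>) * Cc * (n k \<nu> / g k \<nu>) * kern \<kappa> (r0 k \<nu>) r"
        by metis
      define w where "w k \<nu> z = ennreal (A * (n k \<nu> / g k \<nu>)) * ennreal (kern \<kappa> (r0 k \<nu>) (cmod
        (z - x k)))" for k \<nu> and z :: complex
      have pt: "ennreal (pw (vnorm I M pc z) e) / ennreal (pw (vnorm J N qc z) \<delta>) * indicator
        (ball 0 1) z
          \<le> (\<Sum>k\<in>K. \<Sum>\<nu>\<le>M. w k \<nu> z)" if z: "z \<notin> x ` K" for z
      proof (cases "z \<in> ball 0 1")
        case True
        \<comment> \<open>Being closest to \<open>z\<close> among all centers is exactly the
          condition on roots in \<open>vsum_le_vnorm\<close>. The centers themselves, where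
          \<open>r = 0\<close>, form a null set.\<close>
        obtain k where k: "k \<in> K" "\<And>k'. k' \<in> K \<Longrightarrow> cmod (z - x k) \<le> cmod (z - x k')"
          using ex_min_if_finite[of "(\<lambda>k. cmod (z - x k)) ` K"] K by (auto simp: not_less) 
        define r where "r = cmod (z - x k)"
        have r: "0 < r" using z k(1) by (auto simp: r_def)
        have "cmod (z - x k) \<le> cmod z + cmod (x k)" by (rule norm_triangle_ineq4)
        then have r2: "r < 2" using True x k(1) by (fastforce simp: r_def)
        define q where "q = vsum J N qc (x k) r"
        have qN: "r ^ N / 2 \<le> q" unfolding q_def using nm J r by (intro vsum_ge) auto
        have q0: "q > 0" using qN r by (smt (verit) half_gt_zero zero_less_power)
        have qQ: "q \<le> Cq * vnorm J N qc z"
          unfolding q_def r_def Cq_def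
        proof (rule vsum_le_vnorm[OF nm J C h])
          fix j y assume "j \<in> {1..J}" "peval N (\<lambda>\<nu>. of_nat h * qc 1 \<nu> + qc j \<nu>) y = 0"
          then have "y \<in> x ` K" using roots by blast
          then show "cmod (z - x k) \<le> cmod (z - y)" using k(2) by auto
        qed
        have q\<Lambda>: "\<kappa>0 * (cext L (vcoef J N qc (x k)) l * r ^ l) \<le> q" if "l \<in> \<Lambda>" for l
        proof (cases "l = L")
          case True
          have "r ^ (L - N) \<le> 2 ^ (L - N)" using r r2 by (intro power_mono) auto
          then have "\<kappa>0 * (r ^ (L - N) * r ^ N) \<le> \<kappa>0 * (2 ^ (L - N) * r ^ N)"
            using \<kappa>0 r by (intro mult_left_mono mult_right_mono) auto
          also have "\<dots> = r ^ N / 2" by (simp add: \<kappa>0_def power_divide)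
          finally show ?thesis using qN True L(1) by (simp add: cext_def flip: power_add)
        next
          case False
          then have "vcoef J N qc (x k) l * r ^ l \<le> q"
            unfolding q_def using that r by (intro vcoef_le_vsum) (auto simp: \<Lambda>_def)
          moreover have "\<kappa>0 * (vcoef J N qc (x k) l * r ^ l) \<le> 1 * (vcoef J N qc (x k) l * r ^ l)"
            using \<kappa>0 r by (intro mult_right_mono mult_nonneg_nonneg vcoef_nonneg) auto
          ultimately show ?thesis using False by (simp add: cext_def)
        qed
        have num: "pw (vnorm I M pc z) e \<le> real (M + 1) powr e * (\<Sum>\<nu>\<le>M. n k \<nu> * r powr (real \<nu>
          * e))"
        proof -
          have "pw (vnorm I M pc z) e \<le> pw (vsum I M pc (x k) r) e"
            unfolding r_def using e by (intro pw_mono vnorm_nonneg vnorm_le_vsum) auto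
          also have "\<dots> \<le> real (card {..M}) powr e * (\<Sum>\<nu>\<le>M. pw (vcoef I M pc (x k) \<nu> * r ^ \<nu>) e)"
            unfolding vsum_def using r e by (intro pw_sum_le mult_nonneg_nonneg vcoef_nonneg) auto
          also have "(\<Sum>\<nu>\<le>M. pw (vcoef I M pc (x k) \<nu> * r ^ \<nu>) e)
            = (\<Sum>\<nu>\<le>M. n k \<nu> * r powr (real \<nu> * e))"
            using r by (intro sum.cong) (simp_all add: pw_mult vcoef_nonneg n_def pw_pos powr_powr
              flip: powr_realpow)
          finally show ?thesis by simp
        qed
        have den: "q powr \<delta> / Cq powr \<delta> \<le> pw (vnorm J N qc z) \<delta>"
        proof -
          have "q / Cq \<le> vnorm J N qc z" using qQ Cq by (simp add: pos_divide_le_eq mult.commute)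
          then have "pw (q / Cq) \<delta> \<le> pw (vnorm J N qc z) \<delta>" using q0 Cq \<delta> by (intro pw_mono) auto
          then show ?thesis using q0 Cq by (simp add: pw_pos powr_divide)
        qed
        have den0: "0 < q powr \<delta> / Cq powr \<delta>" using q0 Cq by simp
        have "ennreal (pw (vnorm I M pc z) e) / ennreal (pw (vnorm J N qc z) \<delta>)
           = ennreal (pw (vnorm I M pc z) e / pw (vnorm J N qc z) \<delta>)"
          using den den0 by (intro divide_ennreal) (auto simp: pw_nonneg)
        also have "\<dots> \<le> ennreal (\<Sum>\<nu>\<le>M. A * (n k \<nu> / g k \<nu>) * kern \<kappa> (r0 k \<nu>) r)"
        proof (rule ennreal_leI)
          have "pw (vnorm I M pc z) e / pw (vnorm J N qc z) \<delta>
            \<le> (real (M + 1) powr e * (\<Sum>\<nu>\<le>M. n k \<nu> * r powr (real \<nu> * e))) / (q powr \<delta> / Cq powr \<delta>)"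
            by (rule frac_le[OF _ num den0 den]) (auto intro!: sum_nonneg mult_nonneg_nonneg n0)
          also have "\<dots> = Cq powr \<delta> * (real (M + 1) powr e * (\<Sum>\<nu>\<le>M. n k \<nu> * (r powr (real \<nu> * e)
            * q powr (- \<delta>))))"
            by (simp add: powr_minus sum_distrib_right divide_inverse mult_ac sum_distrib_left)
          also have "\<dots> \<le> Cq powr \<delta> * (real (M + 1) powr e * (\<Sum>\<nu>\<le>M. \<kappa>0 powr (- \<delta>) * Cc * (n k \<nu>
            / g k \<nu>) * kern \<kappa> (r0 k \<nu>) r))"
            by (intro mult_left_mono sum_mono r0(2)) (use k r q\<Lambda> in auto)
          also have "\<dots> = (\<Sum>\<nu>\<le>M. A * (n k \<nu> / g k \<nu>) * kern \<kappa> (r0 k \<nu>) r)"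
            by (simp add: A_def sum_distrib_left mult_ac)
          finally show "pw (vnorm I M pc z) e / pw (vnorm J N qc z) \<delta>
            \<le> (\<Sum>\<nu>\<le>M. A * (n k \<nu> / g k \<nu>) * kern \<kappa> (r0 k \<nu>) r)" .
        qed
        also have "\<dots> = (\<Sum>\<nu>\<le>M. w k \<nu> z)"
        proof -
          have kn: "0 \<le> kern \<kappa> s t" for s t by (simp add: kern_def)
          have "(\<Sum>\<nu>\<le>M. w k \<nu> z) = (\<Sum>\<nu>\<le>M. ennreal (A * (n k \<nu> / g k \<nu>) * kern \<kappa> (r0 k \<nu>) r))"
            unfolding w_def r_def using A n0 g0 kn by (intro sum.cong ennreal_mult[symmetric]) auto
          also have "\<dots> = ennreal (\<Sum>\<nu>\<le>M. A * (n k \<nu> / g k \<nu>) * kern \<kappa> (r0 k \<nu>) r)"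
            using A n0 g0 kn by (intro sum_ennreal mult_nonneg_nonneg divide_nonneg_nonneg)
          finally show ?thesis ..
        qed
        also have "\<dots> \<le> (\<Sum>k\<in>K. \<Sum>\<nu>\<le>M. w k \<nu> z)"
          using K(1) k(1) by (intro member_le_sum) auto
        finally show ?thesis using True by simp
      qed simp
      have meas: "w k \<nu> \<in> borel_measurable lborel" for k \<nu>
        unfolding w_def kern_def by measurable
      have "finite (x ` K)" using K(1) by simp
      then have ae: "AE z in lborel. z \<notin> x ` K"
        by (intro AE_not_in finite_imp_null_set_lborel)
      have "disc_integral e \<delta> I M pc J N qc \<le> (\<integral>\<^sup>+z. (\<Sum>k\<in>K. \<Sum>\<nu>\<le>M. w k \<nu> z) \<partial>lborel)"
        unfolding disc_integral_def by (rule nn_integral_mono_AE) (use ae pt in auto)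
      also have "\<dots> = (\<Sum>k\<in>K. \<Sum>\<nu>\<le>M. \<integral>\<^sup>+z. w k \<nu> z \<partial>lborel)"
        using meas by (simp add: nn_integral_sum)
      also have "\<dots> \<le> (\<Sum>k\<in>K. \<Sum>\<nu>\<le>M. ennreal D * (ennreal (n k \<nu>) / ennreal (g k \<nu>)))"
      proof (intro sum_mono)
        fix k \<nu> assume kv: "k \<in> K" "\<nu> \<in> {..M}"
        have "(\<integral>\<^sup>+z. w k \<nu> z \<partial>lborel) = ennreal (A * (n k \<nu> / g k \<nu>)) * (\<integral>\<^sup>+z. ennreal (kern \<kappa>
          (r0 k \<nu>) (cmod (z - x k))) \<partial>lborel)"
          unfolding w_def kern_def by (intro nn_integral_cmult) measurable
        also have "\<dots> \<le> ennreal (A * (n k \<nu> / g k \<nu>)) * ennreal K0"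
          using kv r0(1) by (intro mult_left_mono K0(2)) auto
        also have "\<dots> = ennreal ((A * K0) * (n k \<nu> / g k \<nu>))"
          using A n0 g0 K0(1) by (subst ennreal_mult[symmetric]) (auto simp: mult_ac)
        also have "\<dots> \<le> ennreal (D * (n k \<nu> / g k \<nu>))"
          using n0 g0 by (intro ennreal_leI mult_right_mono) (auto simp: D_def)
        also have "\<dots> = ennreal D * ennreal (n k \<nu> / g k \<nu>)"
          using n0 g0 D1 by (intro ennreal_mult) auto
        also have "\<dots> \<le> ennreal D * (ennreal (n k \<nu>) / ennreal (g k \<nu>))"
        proof (intro mult_left_mono)
          show "ennreal (n k \<nu> / g k \<nu>) \<le> ennreal (n k \<nu>) / ennreal (g k \<nu>)"
            using n0[of k \<nu>] g0[of k \<nu>] by (cases "g k \<nu> = 0") (auto simp: divide_ennreal)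
        qed simp
        finally show "(\<integral>\<^sup>+z. w k \<nu> z \<partial>lborel) \<le> ennreal D * (ennreal (n k \<nu>) / ennreal (g k \<nu>))" .
      qed
      also have "\<dots> = ennreal D * (\<Sum>k\<in>K. \<Sum>\<nu>\<le>M. ennreal (n k \<nu>) / ennreal (g k \<nu>))"
        by (simp add: sum_distrib_left)
      finally show ?thesis unfolding n_def g_def .
    qed
  qed
  moreover have "D \<ge> 1" by (simp add: D_def)
  ultimately show ?thesis by blast
qed

text \<open>If the denominator \<open>g\<close> is positive, the balanced radius, shrunk by a
  bounded factor to fit into the disc, already accounts for \<open>n / g\<close>. If
  \<open>g = 0 < n\<close>, then the polynomials in the denominator vanish at \<open>x\<close> to
  such an order that ever smaller radii force the integral to be infinite.\<close>

lemma disc_integral_ge_center: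
  "\<exists>D\<ge>1. \<forall>pc qc x \<nu>. near_monic C J N qc \<longrightarrow> cmod x \<le> 1 / 2 \<longrightarrow> \<nu> \<le> M \<longrightarrow>
    ennreal (pw (vcoef I M pc x \<nu>) e) / ennreal (cdenom \<delta> L J N qc x (real \<nu> * e + 2))
      \<le> ennreal D * disc_integral e \<delta> I M pc J N qc"
proof -
  obtain c where c: "c > 0" "\<And>pc J N qc x r. cmod x \<le> 1 / 2 \<Longrightarrow> 0 < r \<Longrightarrow> r \<le> 1 / 2 \<Longrightarrow> 0
    < vsum J N qc x r \<Longrightarrow>
    ennreal (c * (r\<^sup>2 * pw (vsum I M pc x r) e / pw (vsum J N qc x r) \<delta>))
      \<le> disc_integral e \<delta> I M pc J N qc"
    using disc_integral_ge[OF I e less_imp_le[OF \<delta>], of M] by blast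
  define \<Lambda> where "\<Lambda> = {..N} \<union> {L}"
  have fin\<Lambda>: "finite \<Lambda>" by (simp add: \<Lambda>_def)
  obtain \<kappa> where \<kappa>: "\<kappa> > 0" "\<And>\<nu> l. \<nu> \<le> M \<Longrightarrow> l \<in> \<Lambda> \<Longrightarrow> \<kappa> \<le> \<bar>real \<nu> * e + 2 - real l * \<delta>\<bar>"
    using spectral_gap by (auto simp: \<Lambda>_def)
  define B where "B = max 1 (real J * (2 ^ N * C))"
  have B1: "1 \<le> B" by (simp add: B_def)
  define am where "am = real M * e + 2"
  define D0 where "D0 = (2 * B) powr am * real (N + 1) powr \<delta> / c"
  define D where "D = max 1 D0"
  have "ennreal (pw (vcoef I M pc x \<nu>) e) / ennreal (cdenom \<delta> L J N qc x (real \<nu> * e + 2))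
      \<le> ennreal D * disc_integral e \<delta> I M pc J N qc"
    if nm: "near_monic C J N qc" and x: "cmod x \<le> 1 / 2" and \<nu>: "\<nu> \<le> M" for pc qc x \<nu>
  proof -
    define F where "F = disc_integral e \<delta> I M pc J N qc"
    define n where "n = pw (vcoef I M pc x \<nu>) e"
    define a where "a = real \<nu> * e + 2"
    define q where "q r = vsum J N qc x r" for r
    define cc where "cc = cext L (vcoef J N qc x)"
    define g where "g = gap a \<delta> \<Lambda> cc"
    have g: "cdenom \<delta> L J N qc x (real \<nu> * e + 2) = g"
      by (simp add: g_def cdenom_def a_def cc_def \<Lambda>_def)
    have n0: "0 \<le> n" by (simp add: n_def pw_nonneg)
    have g0: "0 \<le> g" by (simp add: g_def gap_nonneg)
    have aL: "a < real L * \<delta>" 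
    proof -
      have "real \<nu> * e \<le> real M * e" using \<nu> e by (intro mult_right_mono) auto
      then show ?thesis using L(2) by (simp add: a_def)
    qed
    have aam: "a \<le> am" "0 < a" using \<nu> e by (auto simp: a_def am_def intro!: mult_right_mono
      add_nonneg_pos)
    have vB: "vcoef J N qc x l \<le> B" for l using vcoef_le[OF nm, of x l] x by (simp add: B_def)
    have q0: "0 < q r" if "0 < r" for r
      using vsum_ge[OF nm J, of r x] that unfolding q_def
        by (smt (verit) half_gt_zero zero_less_power)
    have low: "ennreal (c * (n * r powr a * q r powr (- \<delta>))) \<le> F" if r: "0 < r" "r \<le> 1 / 2" for r
    proof -
      have "n * r powr (real \<nu> * e) = pw (vcoef I M pc x \<nu> * r ^ \<nu>) e"
        using r by (simp add: n_def pw_mult vcoef_nonneg pw_pos powr_powr flip: powr_realpow)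
      also have "\<dots> \<le> pw (vsum I M pc x r) e"
        using r \<nu> e by (intro pw_mono vcoef_le_vsum mult_nonneg_nonneg vcoef_nonneg) auto
      finally have 1: "n * r powr (real \<nu> * e) \<le> pw (vsum I M pc x r) e" .
      have "n * r powr a * q r powr (- \<delta>) = r\<^sup>2 * (n * r powr (real \<nu> * e)) / pw (q r) \<delta>"
      proof -
        have "r powr a = r powr (real \<nu> * e) * r\<^sup>2" using r by (simp add: a_def powr_add)
        moreover have "q r powr (- \<delta>) = inverse (pw (q r) \<delta>)" using q0[OF r(1)]
          by (simp add: pw_pos powr_minus)
        ultimately show ?thesis by (simp only: divide_inverse mult_ac)
      qed
      also have "\<dots> \<le> r\<^sup>2 * pw (vsum I M pc x r) e / pw (q r) \<delta>"
        using 1 by (intro divide_right_mono mult_left_mono) (auto simp: pw_nonneg)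
      finally have "ennreal (c * (n * r powr a * q r powr (- \<delta>)))
        \<le> ennreal (c * (r\<^sup>2 * pw (vsum I M pc x r) e / pw (q r) \<delta>))"
        using c(1) by (intro ennreal_leI mult_left_mono) auto
      also have "\<dots> \<le> F" unfolding q_def F_def using x r q0[OF r(1)]
        by (intro c(2)) (auto simp: q_def)
      finally show ?thesis .
    qed
    have split: "real l * \<delta> < a \<or> a < real l * \<delta>" if "l \<in> \<Lambda>" for l
      using \<kappa>(1) \<kappa>(2)[OF \<nu> that] by (auto simp: a_def)
    consider "n = 0" | "0 < n" "0 < g" | "0 < n" "g = 0" using n0 g0 by linarith
    then have "ennreal n / ennreal g \<le> ennreal D * F"
    proof cases
      case 1
      then show ?thesis by simp
    next
      case 2
      obtain r0 \<tau> l m where bal: "r0 > 0" "\<tau> > 0" "(l, m) \<in> gpairs a \<delta> \<Lambda>" "cc l * r0 ^ l = \<tau>"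
          "\<And>l' m'. (l', m') \<in> gpairs a \<delta> \<Lambda> \<Longrightarrow> cc l' * r0 ^ l' \<le> \<tau> \<and> cc m' * r0 ^ m' \<le> \<tau>"
          "\<tau> powr \<delta> * r0 powr (- a) \<le> g"
        using balanced_radius[of \<Lambda> cc \<delta> a] fin\<Lambda> \<delta> 2(2) cext_nonneg unfolding cc_def g_def by metis
      have lm: "l \<in> \<Lambda>" "m \<in> \<Lambda>" "real l * \<delta> < a" "a < real m * \<delta>" using bal(3)
        by (auto simp: gpairs_def)
      \<comment> \<open>By nondegeneracy every exponent in \<open>\<Lambda>\<close> lies strictly on
        one side of \<open>a\<close>, so it forms a pair with \<open>m\<close> or with
        \<open>l\<close>.\<close>
      have all: "cc k * r0 ^ k \<le> \<tau>" if "k \<in> \<Lambda>" for k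
        using split[OF that] that lm bal(5)[of k m] bal(5)[of l k] by (auto simp: gpairs_def)
      have qr0: "q r0 \<le> real (N + 1) * \<tau>"
      proof -
        have "vsum J N qc x r0 \<le> (\<Sum>l\<le>N. \<tau>)"
          unfolding vsum_def
        proof (rule sum_mono)
          fix k assume "k \<in> {..N}"
          then show "vcoef J N qc x k * r0 ^ k \<le> \<tau>"
            using all[of k] L(1) by (simp add: cc_def cext_def \<Lambda>_def)
        qed
        then show ?thesis by (simp add: q_def)
      qed
      have lL: "l < L" using lm aL \<delta> by (smt (verit) mult_right_mono of_nat_less_iff)
      \<comment> \<open>The artificial monomial has coefficient 1, so
        \<open>r0 ^ L \<le> \<tau> = vcoef J N qc x l * r0 ^ l\<close> with \<open>l < L\<close>.
        Bounded coefficients therefore bound the radius.\<close>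
      have r0B: "r0 \<le> B"
      proof (cases "r0 \<le> 1")
        case True
        then show ?thesis using B1 by simp
      next
        case False
        have "1 * r0 ^ L \<le> \<tau>" using all[of L] by (simp add: cc_def cext_def \<Lambda>_def)
        also have "\<tau> = vcoef J N qc x l * r0 ^ l" using bal(4) lL by (simp add: cc_def cext_def)
        finally have "r0 ^ (L - l) * r0 ^ l \<le> vcoef J N qc x l * r0 ^ l" using lL
          by (simp flip: power_add)
        then have "r0 ^ (L - l) \<le> vcoef J N qc x l" using bal(1) by (simp add: mult_le_cancel_right)
        moreover have "r0 \<le> r0 ^ (L - l)" using False lL by (intro self_le_power) auto
        ultimately show ?thesis using vB[of l] by simp
      qed
      define r1 where "r1 = r0 / (2 * B)"
      have r1: "0 < r1" "r1 \<le> 1 / 2" "r1 \<le> r0"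
        using bal(1) r0B B1 by (auto simp: r1_def field_simps)
      have "q r1 \<le> real (N + 1) * \<tau>" using vsum_mono[of r1 r0 J N qc x] r1 qr0 by (simp add: q_def)
      then have "(real (N + 1) * \<tau>) powr (- \<delta>) \<le> q r1 powr (- \<delta>)"
        using q0[OF r1(1)] \<delta> by (intro powr_mono2') auto
      then have q1: "real (N + 1) powr (- \<delta>) * \<tau> powr (- \<delta>) \<le> q r1 powr (- \<delta>)"
        using bal(2) by (simp add: powr_mult)
      have "(2 * B) powr (- am) * r0 powr a \<le> (2 * B) powr (- a) * r0 powr a"
        using B1 aam by (intro mult_right_mono powr_mono) auto
      also have "\<dots> = r1 powr a"
      proof -
        have "r1 powr a = r0 powr a / (2 * B) powr a" unfolding r1_def by (rule powr_divide)
        then show ?thesis by (simp only: powr_minus divide_inverse mult_ac)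
      qed
      finally have r1a: "(2 * B) powr (- am) * r0 powr a \<le> r1 powr a" .
      have gi: "n / g \<le> n * (r0 powr a * \<tau> powr (- \<delta>))"
      proof -
        have "n / g \<le> n / (\<tau> powr \<delta> * r0 powr (- a))"
          using bal n0 by (intro divide_left_mono mult_pos_pos) (auto simp: 2)
        moreover have "n / (\<tau> powr \<delta> * r0 powr (- a)) = n * (r0 powr a * \<tau> powr (- \<delta>))"
          by (simp only: powr_minus divide_inverse inverse_mult_distrib inverse_inverse_eq mult_ac)
        ultimately show ?thesis by simp
      qed
      have "D0 * (c * (n * ((2 * B) powr (- am) * r0 powr a) * (real (N + 1) powr (- \<delta>) * \<tau> powr
        (- \<delta>)))) = n * (r0 powr a * \<tau> powr (- \<delta>))"
      proof -
        have "(2 * B) powr am * (2 * B) powr (- am) = 1" using B1 by (simp flip: powr_add)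
        moreover have "real (N + 1) powr \<delta> * real (N + 1) powr (- \<delta>) = 1" by (simp flip: powr_add)
        moreover have "D0 * (c * (n * ((2 * B) powr (- am) * r0 powr a) * (real (N + 1) powr (- \<delta>)
          * \<tau> powr (- \<delta>))))
           = ((2 * B) powr am * (2 * B) powr (- am)) * (real (N + 1) powr \<delta> * real (N + 1) powr
             (- \<delta>)) * (n * (r0 powr a * \<tau> powr (- \<delta>)))"
          unfolding D0_def using c(1) by (simp add: field_simps)
        ultimately show ?thesis by simp
      qed
      then have "n / g \<le> D0 * (c * (n * ((2 * B) powr (- am) * r0 powr a) * (real (N + 1) powr
        (- \<delta>) * \<tau> powr (- \<delta>))))"
        using gi by (simp only:)
      also have "\<dots> \<le> D * (c * (n * r1 powr a * q r1 powr (- \<delta>)))"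
        using r1a q1 n0 c(1) by (intro mult_mono) (auto simp: D_def D0_def)
      finally have "ennreal (n / g) \<le> ennreal (D * (c * (n * r1 powr a * q r1 powr (- \<delta>))))"
        by (rule ennreal_leI)
      also have "\<dots> = ennreal D * ennreal (c * (n * r1 powr a * q r1 powr (- \<delta>)))"
        using n0 c(1) by (intro ennreal_mult) (auto simp: D_def)
      also have "\<dots> \<le> ennreal D * F" using low[OF r1(1,2)] by (intro mult_left_mono) auto
      finally show ?thesis using 2 by (simp add: divide_ennreal)
    next
      case 3
      \<comment> \<open>The pair \<open>(l, L)\<close> contributes a term to \<open>g\<close> in
        which the second coefficient is 1, so the first one must vanish.\<close>
      have zero: "vcoef J N qc x l = 0" if l: "l \<le> N" "real l * \<delta> < a" for l
      proof -
        have mem: "(l, L) \<in> gpairs a \<delta> \<Lambda>" using l aL by (auto simp: gpairs_def \<Lambda>_def)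
        have "(case (l, L) of (l, m) \<Rightarrow> cc l powr expo_x a \<delta> l m * cc m powr expo_y a \<delta> l m) = 0"
          using 3(2) mem sum_nonneg_0[of "gpairs a \<delta> \<Lambda>"
            "\<lambda>(l, m). cc l powr expo_x a \<delta> l m * cc m powr expo_y a \<delta> l m" "(l, L)"]
            finite_gpairs[OF fin\<Lambda>] by (auto simp: g_def gap_def)
        then show ?thesis using l L(1) by (auto simp: cc_def cext_def)
      qed
      define c' where "c' = c * (n * (real (N + 1) * B) powr (- \<delta>))"
      have c': "0 < c'" using c(1) 3(1) B1 by (simp add: c'_def)
      have big: "ennreal (c' * r powr (- \<kappa>)) \<le> F" if r: "0 < r" "r \<le> 1 / 2" for r
      proof -
        \<comment> \<open>All surviving exponents satisfy
          \<open>l \<delta> \<ge> a + \<kappa>\<close>, so \<open>q r\<close> is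
          \<open>O(r powr \<beta>)\<close> and the lower bound
          \<open>r powr a * q r powr (- \<delta>)\<close> grows at least like
          \<open>r powr (- \<kappa>)\<close>.\<close>
        define \<beta> where "\<beta> = (a + \<kappa>) / \<delta>"
        have "q r \<le> (\<Sum>l\<le>N. B * r powr \<beta>)"
          unfolding q_def vsum_def
        proof (rule sum_mono)
          fix l assume l: "l \<in> {..N}"
          then have l\<Lambda>: "l \<in> \<Lambda>" by (simp add: \<Lambda>_def)
          show "vcoef J N qc x l * r ^ l \<le> B * r powr \<beta>"
          proof (cases "real l * \<delta> < a")
            case True
            then show ?thesis using zero[of l] l B1 by simp
          next
            case False
            then have "a + \<kappa> \<le> real l * \<delta>" using \<kappa>(2)[OF \<nu> l\<Lambda>] split[OF l\<Lambda>] by (auto simp: a_def)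
            then have "\<beta> \<le> real l" using \<delta> by (simp add: \<beta>_def pos_divide_le_eq)
            then have "r powr real l \<le> r powr \<beta>" using r by (intro powr_mono') auto
            then have "r ^ l \<le> r powr \<beta>" using r by (simp add: powr_realpow)
            then show ?thesis using vB[of l] r B1 by (intro mult_mono) auto
          qed
        qed
        then have "q r \<le> (real (N + 1) * B) * r powr \<beta>" by simp
        then have "((real (N + 1) * B) * r powr \<beta>) powr (- \<delta>) \<le> q r powr (- \<delta>)"
          using q0[OF r(1)] \<delta> by (intro powr_mono2') auto
        moreover have "((real (N + 1) * B) * r powr \<beta>) powr (- \<delta>)
          = (real (N + 1) * B) powr (- \<delta>) * r powr (- a - \<kappa>)"
          using B1 \<delta> by (simp add: powr_mult powr_powr \<beta>_def)
        ultimately have "c * (n * r powr a * ((real (N + 1) * B) powr (- \<delta>) * r powr (- a - \<kappa>)))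
          \<le> c * (n * r powr a * q r powr (- \<delta>))"
          using c(1) n0 by (intro mult_left_mono) auto
        moreover have "c' * r powr (- \<kappa>) = c * (n * r powr a * ((real (N + 1) * B) powr (- \<delta>)
          * r powr (- a - \<kappa>)))"
        proof -
          have "r powr (- \<kappa>) = r powr a * r powr (- a - \<kappa>)" by (simp flip: powr_add)
          then show ?thesis unfolding c'_def by (simp only: mult_ac)
        qed
        ultimately have "c' * r powr (- \<kappa>) \<le> c * (n * r powr a * q r powr (- \<delta>))"
          by (simp only:)
        then show ?thesis using low[OF r] ennreal_leI order_trans by blast
      qed
      have "F = top"
      proof (rule ccontr)
        assume "F \<noteq> top"
        then obtain f where f: "0 \<le> f" "F = ennreal f" by (cases F) auto
        \<comment> \<open>Chosen so that \<open>c' * s powr (- \<kappa>) = f + 1\<close>, beyond the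
          assumed finite value \<open>f\<close>.\<close>
        define s where "s = ((f + 1) / c') powr (- (1 / \<kappa>))"
        define r where "r = min (1 / 2) s"
        have s: "0 < s" using f(1) c' by (simp add: s_def)
        then have r: "0 < r" "r \<le> 1 / 2" by (auto simp: r_def)
        have "(f + 1) / c' = s powr (- \<kappa>)" using f(1) c' \<kappa>(1) by (simp add: s_def powr_powr)
        also have "\<dots> \<le> r powr (- \<kappa>)" using r s \<kappa>(1) by (intro powr_mono2') (auto simp: r_def)
        finally have "f + 1 \<le> c' * r powr (- \<kappa>)" using c'
          by (simp add: pos_divide_le_eq mult.commute)
        moreover have "c' * r powr (- \<kappa>) \<le> f" using big[OF r] f by (simp add: ennreal_le_iff)
        ultimately show False by simp
      qed
      then show ?thesis by (simp add: D_def ennreal_mult_top)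
    qed
    then show ?thesis unfolding g F_def n_def .
  qed
  moreover have "D \<ge> 1" by (simp add: D_def)
  ultimately show ?thesis by blast
qed

end

section \<open>Local quantities as absolute polynomial powers in coefficients and centers\<close>

lemma app_pw:
  assumes "app V \<Omega> f" "e \<in> \<rat>" "0 \<le> e"
  shows "app V \<Omega> (\<lambda>x. pw (f x) e)"
  using app_powr[OF assms(1,2)] assms(3) app_1[of V \<Omega>] by (cases "e = 0") (auto simp: pw_def)

lemma polyfun_tay:
  assumes "\<And>i. (\<lambda>x. f x i) \<in> polyfun \<int> W" "y \<in> polyfun \<int> W"
  shows "(\<lambda>x. tay D (f x) l (y x)) \<in> polyfun \<int> W"
  unfolding tay_def
  by (intro polyfun_sum polyfun.mult polyfun.const polyfun_power assms) simp

lemma app_vcoef: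
  assumes "\<And>j i. j \<in> {1..n} \<Longrightarrow> (\<lambda>x. f x j i) \<in> polyfun \<int> W" "y \<in> polyfun \<int> W"
  shows "app W \<Omega> (\<lambda>x. vcoef n D (f x) (y x) l)"
  unfolding vcoef_def by (intro app_sum app_norm polyfun_tay assms) auto

lemma app_cdenom:
  assumes "\<And>j i. j \<in> {1..n} \<Longrightarrow> (\<lambda>x. f x j i) \<in> polyfun \<int> W" "y \<in> polyfun \<int> W"
    and "a \<in> \<rat>" "\<delta> \<in> \<rat>" "0 < \<delta>"
  shows "app W \<Omega> (\<lambda>x. cdenom \<delta> L n D (f x) (y x) a)"
  unfolding cdenom_def gap_def split_def
proof (intro app_sum app_mult app_powr)
  fix p assume p: "p \<in> gpairs a \<delta> ({..D} \<union> {L})"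
  have c: "app W \<Omega> (\<lambda>x. cext L (vcoef n D (f x) (y x)) l)" for l
    unfolding cext_def using app_1[of W \<Omega>] app_vcoef[of n f W y \<Omega> D l] assms(1,2)
      by (cases "l = L") auto
  show "app W \<Omega> (\<lambda>x. cext L (vcoef n D (f x) (y x)) (fst p))"
    "app W \<Omega> (\<lambda>x. cext L (vcoef n D (f x) (y x)) (snd p))" by (rule c)+
  show "expo_x a \<delta> (fst p) (snd p) \<in> \<rat>" "expo_y a \<delta> (fst p) (snd p) \<in> \<rat>"
    unfolding expo_x_def expo_y_def using assms(3,4) by auto
  show "0 < expo_x a \<delta> (fst p) (snd p)" "0 < expo_y a \<delta> (fst p) (snd p)"
    using expo_pos[OF assms(5)] p by (metis prod.collapse)+
qed

text \<open>A root satisfies \<open>|z|^D \<le> \<sigma> max(1, |z|)^D\<close>. As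
  \<open>\<sigma> \<le> 1 / 2\<close>, this excludes \<open>|z| \<ge> 1\<close>, and then
  \<open>|z|^D \<le> \<sigma> \<le> (1 / 2)^D\<close>. Degree \<open>D = 0\<close> is excluded as
  well, since it would give \<open>1 \<le> 1 / 2\<close>.\<close>

lemma near_monic_root_le:
  assumes "(\<Sum>i\<le>D. cmod (f i - (if i = D then 1 else 0))) \<le> (1 / 2) ^ (D + 1)" "peval D f z = 0"
  shows "cmod z \<le> 1 / 2"
proof -
  define \<sigma> where "\<sigma> = (\<Sum>i\<le>D. cmod (f i - (if i = D then 1 else 0)))"
  have \<sigma>: "\<sigma> \<le> (1 / 2) ^ (D + 1)" using assms(1) by (simp add: \<sigma>_def)
  have "(1 / 2 :: real) ^ (D + 1) \<le> (1 / 2) ^ 1" by (intro power_decreasing) auto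
  then have \<sigma>1: "\<sigma> \<le> 1 / 2" using \<sigma> by simp
  have "peval D f z = z ^ D + (\<Sum>i\<le>D. (f i - (if i = D then 1 else 0)) * z ^ i)"
  proof -
    have "(\<Sum>i\<le>D. (if i = D then 1 else 0) * z ^ i) = (\<Sum>i\<le>D. if i = D then z ^ D else 0)"
      by (rule sum.cong) auto
    then show ?thesis by (simp add: peval_def left_diff_distrib sum_subtractf)
  qed
  then have "z ^ D = - (\<Sum>i\<le>D. (f i - (if i = D then 1 else 0)) * z ^ i)"
    using assms(2) by (simp add: eq_neg_iff_add_eq_0)
  then have "cmod z ^ D = cmod (\<Sum>i\<le>D. (f i - (if i = D then 1 else 0)) * z ^ i)"
    by (metis norm_minus_cancel norm_power)
  also have "\<dots> \<le> (\<Sum>i\<le>D. cmod (f i - (if i = D then 1 else 0)) * cmod z ^ i)"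
    by (rule order_trans[OF norm_sum]) (simp add: norm_mult norm_power)
  also have "\<dots> \<le> (\<Sum>i\<le>D. cmod (f i - (if i = D then 1 else 0)) * max 1 (cmod z) ^ D)"
  proof (intro sum_mono mult_left_mono)
    fix i assume "i \<in> {..D}"
    have "cmod z ^ i \<le> max 1 (cmod z) ^ i" by (intro power_mono) auto
    also have "\<dots> \<le> max 1 (cmod z) ^ D" using \<open>i \<in> {..D}\<close> by (intro power_increasing) auto
    finally show "cmod z ^ i \<le> max 1 (cmod z) ^ D" .
  qed auto
  also have "\<dots> = \<sigma> * max 1 (cmod z) ^ D" by (simp add: \<sigma>_def sum_distrib_right)
  finally have le: "cmod z ^ D \<le> \<sigma> * max 1 (cmod z) ^ D" .
  have "cmod z < 1"
  proof (rule ccontr)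
    assume "\<not> ?thesis"
    then have "max 1 (cmod z) = cmod z" "0 < cmod z ^ D" by (auto intro!: zero_less_power)
    then show False using le \<sigma>1 by (simp add: mult_le_cancel_right1)
  qed
  then have le': "cmod z ^ D \<le> \<sigma>" using le by (simp add: max_def)
  then have "D \<noteq> 0" using \<sigma>1 by (cases D) auto
  have "(1 / 2 :: real) ^ (D + 1) \<le> (1 / 2) ^ D" by (intro power_decreasing) auto
  then have "cmod z ^ D \<le> (1 / 2) ^ D" using le' \<sigma> by linarith
  then show ?thesis using \<open>D \<noteq> 0\<close> by (simp add: power_mono_iff)
qed

section \<open>The parameters as coefficient vectors padded to a common degree\<close>

definition pcoef :: "(nat \<Rightarrow> nat) \<Rightarrow> (coord \<Rightarrow> complex) \<Rightarrow> nat \<Rightarrow> nat \<Rightarrow> complex" where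
  "pcoef M b i \<mu> = (if \<mu> \<le> M i then b (Inl (i, \<mu>)) else 0)"

definition qcoef :: "(nat \<Rightarrow> nat) \<Rightarrow> (coord \<Rightarrow> complex) \<Rightarrow> nat \<Rightarrow> nat \<Rightarrow> complex" where
  "qcoef N b j \<nu> = (if \<nu> \<le> N j then b (Inr (j, \<nu>)) else 0)"

lemma pcoef_polyfun: "i \<in> {1..I} \<Longrightarrow> (\<lambda>b. pcoef M b i \<mu>) \<in> polyfun \<int> (coords I J M N)"
  by (cases "\<mu> \<le> M i") (auto simp: pcoef_def coords_def intro!: polyfun.intros)

lemma qcoef_polyfun: "j \<in> {1..J} \<Longrightarrow> (\<lambda>b. qcoef N b j \<nu>) \<in> polyfun \<int> (coords I J M N)"
  by (cases "\<nu> \<le> N j") (auto simp: qcoef_def coords_def intro!: polyfun.intros)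

lemma Pb_eq_peval:
  assumes "M i \<le> D"
  shows "Pb M b i z = peval D (pcoef M b i) z"
proof -
  have "peval D (pcoef M b i) z = (\<Sum>\<mu>\<in>{0..M i}. pcoef M b i \<mu> * z ^ \<mu>)"
    unfolding peval_def by (rule sum.mono_neutral_right) (use assms in \<open>auto simp: pcoef_def\<close>)
  then show ?thesis by (simp add: Pb_def pcoef_def)
qed

lemma Qb_eq_peval:
  assumes "N j \<le> D"
  shows "Qb N b j z = peval D (qcoef N b j) z"
proof -
  have "peval D (qcoef N b j) z = (\<Sum>\<nu>\<in>{0..N j}. qcoef N b j \<nu> * z ^ \<nu>)"
    unfolding peval_def by (rule sum.mono_neutral_right) (use assms in \<open>auto simp: qcoef_def\<close>)
  then show ?thesis by (simp add: Qb_def qcoef_def)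
qed

lemma apow_eq_pw: "0 \<le> S \<Longrightarrow> apow S e = pw (sqrt S) (real_of_rat e)"
  by (auto simp: apow_def pw_def powr_half_sqrt[symmetric] powr_powr)

lemma integral_Rb_eq:
  assumes "\<And>i. i \<in> {1..I} \<Longrightarrow> M i \<le> M'" "\<And>j. j \<in> {1..J} \<Longrightarrow> N j \<le> N'"
  shows "(\<integral>\<^sup>+ z \<in> ball 0 1. Rb I J M N \<epsilon> \<delta> b z \<partial>lborel) =
    disc_integral (real_of_rat \<epsilon>) (real_of_rat \<delta>) I M' (pcoef M b) J N' (qcoef N b)"
proof -
  have "(\<Sum>i=1..I. (cmod (Pb M b i z))\<^sup>2) = (\<Sum>i=1..I. (cmod (peval M' (pcoef M b i) z))\<^sup>2)"
    "(\<Sum>j=1..J. (cmod (Qb N b j z))\<^sup>2) = (\<Sum>j=1..J. (cmod (peval N' (qcoef N b j) z))\<^sup>2)" for z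
    using assms Pb_eq_peval[of M _ M' b z] Qb_eq_peval[of N _ N' b z]
    by (intro sum.cong refl arg_cong[where f = "\<lambda>w. (cmod w)\<^sup>2"]; blast)+
  then show ?thesis
    unfolding disc_integral_def Rb_def vnorm_def L2_set_def
    by (simp add: apow_eq_pw sum_nonneg)
qed

section \<open>The auxiliary polynomials and their roots\<close>

definition cpoly :: "nat \<Rightarrow> nat \<Rightarrow> (nat \<Rightarrow> nat \<Rightarrow> complex) \<Rightarrow> nat \<Rightarrow> complex poly" where
  "cpoly h N qc j = (\<Sum>\<nu>\<le>N. monom (of_nat h * qc 1 \<nu> + qc j \<nu>) \<nu>)"

lemma coeff_cpoly: "coeff (cpoly h N qc j) i = (if i \<le> N then of_nat h * qc 1 i + qc j i else 0)"
  by (simp add: cpoly_def coeff_sum)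

lemma poly_cpoly: "poly (cpoly h N qc j) y = peval N (\<lambda>\<nu>. of_nat h * qc 1 \<nu> + qc j \<nu>) y"
  by (simp add: cpoly_def peval_def poly_sum poly_monom)

lemma polyfun_coeff_prod:
  fixes P :: "'k \<Rightarrow> ('v \<Rightarrow> complex) \<Rightarrow> complex poly"
  assumes "finite S" "\<And>j i. j \<in> S \<Longrightarrow> (\<lambda>x. coeff (P j x) i) \<in> polyfun \<int> V"
  shows "(\<lambda>x. coeff (\<Prod>j\<in>S. P j x) i) \<in> polyfun \<int> V"
  using assms
proof (induction arbitrary: i)
  case empty
  then show ?case by (cases i) (auto intro!: polyfun.const)
next
  case (insert j S)
  have "(\<lambda>x. coeff (P j x * (\<Prod>j\<in>S. P j x)) i) \<in> polyfun \<int> V"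
    using insert by (intro polyfun_coeff_mult) auto
  then show ?case using insert by simp
qed

lemma splits_exists:
  assumes "p \<noteq> 0" "degree p = n"
  shows "\<exists>\<alpha>. splits n p \<alpha>"
proof -
  obtain A where A: "size A = n" "p = smult (coeff p n) (\<Prod>x\<in>#A. [:-x, 1:])"
    using alg_closed_imp_factorization[OF assms(1)] assms(2) by auto
  obtain xs where xs: "mset xs = A" using ex_mset by blast
  have "(\<Prod>x\<in>#A. [:-x, 1:]) = prod_list (map (\<lambda>x. [:-x, 1:]) xs)"
    by (simp add: xs[symmetric] prod_mset_prod_list flip: mset_map)
  also have "\<dots> = (\<Prod>k<n. [:- (xs ! k), 1:])"
    using A(1) by (simp add: prod.list_conv_set_nth atLeast0LessThan xs[symmetric])
  finally show ?thesis using A(2) unfolding splits_def by (intro exI[of _ "\<lambda>k. xs ! k"]) simp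
qed

lemma near_monic_cpoly:
  assumes nm: "near_monic C J N qc" and C: "0 < C" and h: "C * 2 ^ (N + 2) \<le> real h" and j:
    "j \<in> {1..J}" and J: "1 \<le> J"
  shows "C \<le> cmod (coeff (cpoly h N qc j) N)" "cmod (coeff (cpoly h N qc j) N) \<le> real h * C + C"
    "poly (cpoly h N qc j) y = 0 \<Longrightarrow> cmod y \<le> 1 / 2"
proof -
  have bnd: "cmod (qc i N) \<le> C" if "i \<in> {1..J}" for i
  proof -
    have "cmod (qc i N) \<le> (\<Sum>\<nu>\<le>N. cmod (qc i \<nu>))" by (rule member_le_sum) auto
    then show ?thesis using nm that by (force simp: near_monic_def)
  qed
  have "(2::real) ^ 2 \<le> 2 ^ (N + 2)" by (intro power_increasing) auto
  then have "C * 4 \<le> C * 2 ^ (N + 2)" using C by (intro mult_left_mono) auto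
  then have h4: "4 * C \<le> real h" using h by simp
  have "real h * (1 / 2) \<le> real h * cmod (qc 1 N)"
    using near_monic_lead[OF nm] by (intro mult_left_mono) auto
  then have "2 * C \<le> cmod (of_nat h * qc 1 N)" using h4 by (simp add: norm_mult)
  moreover have "cmod (of_nat h * qc 1 N) - cmod (qc j N) \<le> cmod (of_nat h * qc 1 N + qc j N)"
    by (rule norm_diff_ineq)
  ultimately show "C \<le> cmod (coeff (cpoly h N qc j) N)"
    using bnd[OF j] by (simp add: coeff_cpoly)
  have "cmod (of_nat h * qc 1 N + qc j N) \<le> real h * cmod (qc 1 N) + cmod (qc j N)"
    by (rule order_trans[OF norm_triangle_ineq]) (simp add: norm_mult)
  also have "\<dots> \<le> real h * C + C" using bnd[OF j] bnd[of 1] J by (intro add_mono mult_left_mono) auto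
  finally show "cmod (coeff (cpoly h N qc j) N) \<le> real h * C + C" by (simp add: coeff_cpoly)
  have h0: "0 < real h" using h4 C by simp
  assume root: "poly (cpoly h N qc j) y = 0"
  \<comment> \<open>Division by \<open>h\<close> turns the auxiliary polynomial into
    \<open>Q_1 + Q_j / h\<close>, a small perturbation of \<open>Z^N\<close>.\<close>
  define f where "f \<nu> = of_real (1 / real h) * qc j \<nu> + qc 1 \<nu>" for \<nu>
  show "cmod y \<le> 1 / 2"
  proof (rule near_monic_root_le)
    have "of_nat h * peval N f y = peval N (\<lambda>\<nu>. of_nat h * qc 1 \<nu> + qc j \<nu>) y"
      unfolding peval_def sum_distrib_left using h0
        by (intro sum.cong) (auto simp: f_def field_simps)
    then show "peval N f y = 0" using root h0 by (simp add: poly_cpoly)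
    have "(\<Sum>i\<le>N. cmod (f i - (if i = N then 1 else 0))) \<le>
      (\<Sum>i\<le>N. cmod (qc 1 i - (if i = N then 1 else 0)) + 1 / real h * cmod (qc j i))"
    proof (rule sum_mono)
      fix i
      have "f i - (if i = N then 1 else 0) = (qc 1 i - (if i
        = N then 1 else 0)) + of_real (1 / real h) * qc j i"
        by (simp add: f_def)
      then show "cmod (f i - (if i = N then 1 else 0)) \<le> cmod (qc 1 i - (if i
        = N then 1 else 0)) + 1 / real h * cmod (qc j i)"
        by (metis abs_of_nonneg divide_nonneg_nonneg norm_mult norm_of_real norm_triangle_ineq
          of_nat_0_le_iff zero_le_one)
    qed
    also have "\<dots> = (\<Sum>i\<le>N. cmod (qc 1 i - (if i
      = N then 1 else 0))) + 1 / real h * (\<Sum>i\<le>N. cmod (qc j i))"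
      by (simp add: sum.distrib sum_distrib_left)
    also have "\<dots> \<le> (1 / 2) ^ (N + 2) + 1 / real h * C"
      using nm j by (intro add_mono mult_left_mono) (auto simp: near_monic_def)
    also have "1 / real h * C \<le> (1 / 2) ^ (N + 2)"
      using h h0 C by (simp add: field_simps power_divide)
    finally show "(\<Sum>i\<le>N. cmod (f i - (if i = N then 1 else 0))) \<le> (1 / 2) ^ (N + 1)" by simp
  qed
qed

lemma splits_root_iff:
  assumes "splits n p \<alpha>" "coeff p n \<noteq> 0"
  shows "poly p y = 0 \<longleftrightarrow> y \<in> \<alpha> ` {..<n}"
proof -
  have "poly p y = coeff p n * (\<Prod>k<n. y - \<alpha> k)"
    by (subst assms(1)[unfolded splits_def]) (simp add: poly_prod)
  then show ?thesis using assms(2) by auto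
qed

lemma sum_le_card_mult:
  fixes f :: "'a \<Rightarrow> ennreal"
  assumes "finite S" "\<And>t. t \<in> S \<Longrightarrow> f t \<le> ennreal D * F" "0 \<le> D"
  shows "(\<Sum>t\<in>S. f t) \<le> ennreal (real (card S) * D) * F"
proof -
  have "(\<Sum>t\<in>S. f t) \<le> of_nat (card S) * (ennreal D * F)" using assms(2) by (rule sum_bounded_above)
  then show ?thesis using assms(3) by (simp add: ennreal_mult mult.assoc
    ennreal_of_nat_eq_real_of_nat)
qed

text \<open>With the roots adjoined as extra variables, the two estimates by centers present the
  integral as a finite sum of quotients. It is stratifiable in coefficients and roots, and
  elimination then removes the roots.\<close>

lemma stratifiable_disc_integral:
  fixes pc qc :: "('v \<Rightarrow> complex) \<Rightarrow> nat \<Rightarrow> nat \<Rightarrow> complex" and e \<delta> C :: real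
  assumes I: "1 \<le> I" and J: "1 \<le> J" and e: "0 \<le> e" "e \<in> \<rat>" and \<delta>: "0 \<le> \<delta>" "\<delta> \<in> \<rat>" and C: "0 < C"
    and nondeg: "\<And>\<nu> l. \<nu> \<le> M \<Longrightarrow> l \<le> N \<Longrightarrow> real \<nu> * e + 2 \<noteq> real l * \<delta>"
    and pc: "\<And>i \<mu>. i \<in> {1..I} \<Longrightarrow> (\<lambda>b. pc b i \<mu>) \<in> polyfun \<int> V"
    and qc: "\<And>j \<nu>. j \<in> {1..J} \<Longrightarrow> (\<lambda>b. qc b j \<nu>) \<in> polyfun \<int> V"
    and nm: "\<And>b. b \<in> \<Omega> \<Longrightarrow> near_monic C J N (qc b)"
    and nz: "\<And>b. b \<in> \<Omega> \<Longrightarrow> 0 < (\<Sum>i=1..I. \<Sum>\<mu>\<le>M. cmod (pc b i \<mu>))"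
  shows "stratifiable V \<Omega> (\<lambda>b. disc_integral e \<delta> I M (pc b) J N (qc b))"
proof -
  define P where "P b = pw (\<Sum>i=1..I. \<Sum>\<mu>\<le>M. cmod (pc b i \<mu>)) e" for b
  define F where "F b = disc_integral e \<delta> I M (pc b) J N (qc b)" for b
  have P0: "0 < P b" if "b \<in> \<Omega>" for b using nz[OF that] by (simp add: P_def pw_pos)
  obtain D1 where D1: "D1 \<ge> 1" "\<And>b. b \<in> \<Omega> \<Longrightarrow> ennreal (P b) \<le> ennreal D1 * F b"
    using disc_integral_ge_norm[OF I e(1) \<delta>(1) J C, where M = M and N = N] nm
      unfolding P_def F_def by blast
  have "stratifiable V \<Omega> F"
  proof (cases "\<delta> = 0")
    case True
    have "app V \<Omega> P" unfolding P_def by (intro app_pw app_sum app_norm pc e)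
    then have st: "stratifiable V \<Omega> (\<lambda>b. ennreal (P b) + ennreal 0 / ennreal 1)"
      by (rule stratifiable_base[OF _ app_0 app_1]) (rule P0)
    show ?thesis
    proof (rule stratifiable_comparable[OF st, of "D1 + pi"])
      show "1 \<le> D1 + pi" using D1(1) pi_gt_zero by linarith
      fix b assume b: "b \<in> \<Omega>"
      have "ennreal D1 * F b \<le> ennreal (D1 + pi) * F b" by (intro mult_right_mono ennreal_leI) auto
      then show "ennreal (P b) + ennreal 0 / ennreal 1 \<le> ennreal (D1 + pi) * F b"
        using D1(2)[OF b] by (auto intro: order_trans)
      have "F b \<le> ennreal pi * ennreal (P b)"
        unfolding F_def P_def True by (rule disc_integral_le_norm[OF e(1)])
      also have "\<dots> \<le> ennreal (D1 + pi) * ennreal (P b)"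
        using D1(1) by (intro mult_right_mono ennreal_leI) auto
      finally show "F b \<le> ennreal (D1 + pi) * (ennreal (P b) + ennreal 0 / ennreal 1)" by simp
    qed
  next
    case False
    then have \<delta>0: "0 < \<delta>" using \<delta>(1) by simp
    \<comment> \<open>Large enough that \<open>r^L\<close> lies beyond every critical exponent
      \<open>\<nu> e + 2\<close>, so that \<open>L\<close> can serve as upper partner for every
      exponent below it.\<close>
    obtain L where L: "N < L" "real M * e + 2 < real L * \<delta>"
    proof -
      obtain k :: nat where k: "(real M * e + 2) / \<delta> < real k" using reals_Archimedean2 by blast
      have "real M * e + 2 < real k * \<delta>" using k \<delta>0 by (simp add: pos_divide_less_eq)
      also have "\<dots> \<le> real (k + N + 1) * \<delta>" using \<delta>0 by (intro mult_right_mono) auto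
      finally show ?thesis by (intro that[of "k + N + 1"]) auto
    qed
    define h where "h = nat \<lceil>C * 2 ^ (N + 2)\<rceil>"
    have h: "C * 2 ^ (N + 2) \<le> real h" unfolding h_def by (rule real_nat_ceiling_ge)
    obtain D2 where D2: "D2 \<ge> 1" "\<And>pc qc (K :: nat set) x. near_monic C J N qc \<Longrightarrow> finite K \<Longrightarrow> K \<noteq> {} \<Longrightarrow>
       (\<forall>k\<in>K. cmod (x k) \<le> 1 / 2) \<Longrightarrow>
      (\<forall>j\<in>{1..J}. \<forall>y. peval N (\<lambda>\<nu>. of_nat h * qc 1 \<nu> + qc j \<nu>) y = 0 \<longrightarrow> y \<in> x ` K) \<Longrightarrow>
      disc_integral e \<delta> I M pc J N qc \<le> ennreal D2 * (\<Sum>k\<in>K. \<Sum>\<nu>\<le>M.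
      ennreal (pw (vcoef I M pc (x k) \<nu>) e) / ennreal (cdenom \<delta> L J N qc (x k) (real \<nu> * e + 2)))"
      using disc_integral_le[OF I J e(1) \<delta>0 C L nondeg h] by blast
    obtain D3 where D3: "D3 \<ge> 1" "\<And>pc qc x \<nu>. near_monic C J N qc \<Longrightarrow> cmod x \<le> 1 / 2 \<Longrightarrow> \<nu> \<le> M \<Longrightarrow>
      ennreal (pw (vcoef I M pc x \<nu>) e) / ennreal (cdenom \<delta> L J N qc x (real \<nu> * e + 2))
      \<le> ennreal D3 * disc_integral e \<delta> I M pc J N qc"
      using disc_integral_ge_center[OF I J e(1) \<delta>0 C L nondeg h] by blast
    \<comment> \<open>One polynomial for all roots: counted with multiplicity there are
      \<open>N * J\<close> of them, a number independent of \<open>b\<close>.\<close>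
    define G where "G b = (\<Prod>j=1..J. cpoly h N (qc b) j)" for b
    define n where "n = N * J"
    have G: "(\<lambda>b. coeff (G b) i) \<in> polyfun \<int> V" for i
      unfolding G_def
    proof (rule polyfun_coeff_prod)
      fix j i assume "j \<in> {1..J}"
      then show "(\<lambda>b. coeff (cpoly h N (qc b) j) i) \<in> polyfun \<int> V"
        using J unfolding coeff_cpoly
        by (cases "i \<le> N") (auto intro!: polyfun.intros qc)
    qed simp
    have deg: "degree (cpoly h N (qc b) j) = N" if "b \<in> \<Omega>" "j \<in> {1..J}" for b j
    proof (rule antisym)
      show "degree (cpoly h N (qc b) j) \<le> N" by (rule degree_le) (auto simp: coeff_cpoly)
      show "N \<le> degree (cpoly h N (qc b) j)"
        using near_monic_cpoly(1)[OF nm[OF that(1)] C h that(2) J] C by (intro le_degree) auto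
    qed
    have nzp: "cpoly h N (qc b) j \<noteq> 0" if "b \<in> \<Omega>" "j \<in> {1..J}" for b j
      using near_monic_cpoly(1)[OF nm[OF that(1)] C h that(2) J] C by auto
    have degG: "degree (G b) = n" if "b \<in> \<Omega>" for b
      unfolding G_def n_def using nzp[OF that] deg[OF that]
        by (subst degree_prod_eq_sum_degree) (auto simp: mult.commute)
    have leadG: "cmod (coeff (G b) n) = (\<Prod>j=1..J. cmod (coeff (cpoly h N (qc b) j) N))"
      if "b \<in> \<Omega>" for b
    proof -
      have "coeff (G b) n = lead_coeff (G b)" using degG[OF that] by simp
      also have "\<dots> = (\<Prod>j=1..J. lead_coeff (cpoly h N (qc b) j))" unfolding G_def
        by (rule lead_coeff_prod)
      also have "\<dots> = (\<Prod>j=1..J. coeff (cpoly h N (qc b) j) N)" using deg[OF that]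
        by (intro prod.cong) auto
      finally show ?thesis by (simp add: prod_norm)
    qed
    have lo: "C ^ J \<le> cmod (coeff (G b) n)" and hi: "cmod (coeff (G b) n) \<le> (real h * C + C) ^ J"
      if "b \<in> \<Omega>" for b
    proof -
      have "(\<Prod>j=1..J. C) \<le> (\<Prod>j=1..J. cmod (coeff (cpoly h N (qc b) j) N))"
        using near_monic_cpoly(1)[OF nm[OF that] C h _ J] C by (intro prod_mono) auto
      then show "C ^ J \<le> cmod (coeff (G b) n)" by (simp add: leadG[OF that])
      have "(\<Prod>j=1..J. cmod (coeff (cpoly h N (qc b) j) N)) \<le> (\<Prod>j=1..J. real h * C + C)"
        using near_monic_cpoly(2)[OF nm[OF that] C h _ J] by (intro prod_mono) auto
      then show "cmod (coeff (G b) n) \<le> (real h * C + C) ^ J" by (simp add: leadG[OF that])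
    qed
    have CJ: "0 < C ^ J" using C by simp
    have "\<exists>\<alpha>. splits n (G b) \<alpha>" if "b \<in> \<Omega>" for b
      using lo[OF that] CJ degG[OF that] by (intro splits_exists) auto
    then obtain rt where rt: "\<And>b. b \<in> \<Omega> \<Longrightarrow> splits n (G b) (rt b)" by metis
    define W where "W = Inl ` V \<union> Inr ` {..<n}"
    \<comment> \<open>All labellings of the roots are included and not only \<open>rt b\<close>, so
      that every arrangement used in the elimination stays inside.\<close>
    define \<Omega>' where "\<Omega>' = {case_sum b \<alpha> | b \<alpha>. b \<in> \<Omega> \<and> splits n (G b) \<alpha>}"
    define base where "base x = (\<lambda>v. x (Inl v))" for x :: "'v + nat \<Rightarrow> complex"
    \<comment> \<open>The index \<open>k = n\<close> stands for the center \<open>0\<close>; it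
      keeps the family of centers nonempty when there are no roots.\<close>
    define ctr where "ctr k x = (if k < n then x (Inr k) else 0)" for k and x ::
      "'v + nat \<Rightarrow> complex"
    define num where "num t x = pw (vcoef I M (pc (base x)) (ctr (fst t) x) (snd t)) e" for t
      and x :: "'v + nat \<Rightarrow> complex"
    define den where "den t x = cdenom \<delta> L J N (qc (base x)) (ctr (fst t) x) (real (snd t) * e
      + 2)" for t and x :: "'v + nat \<Rightarrow> complex"
    define S where "S = {..n} \<times> {..M}"
    have finS: "finite S" and neS: "S \<noteq> {}" by (auto simp: S_def)
    have lift: "(\<lambda>x. p (base x)) \<in> polyfun \<int> W"
      if "p \<in> polyfun \<int> V" for p :: "('v \<Rightarrow> complex) \<Rightarrow> complex"
      unfolding base_def using that by (rule polyfun_reindex)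
        (auto intro!: polyfun.intros simp: W_def)
    have ctr: "ctr k \<in> polyfun \<int> W" for k
      by (cases "k < n") (auto simp: ctr_def[abs_def] W_def intro!: polyfun.intros)
    have rat: "real \<nu> * e + 2 \<in> \<rat>" for \<nu> using e(2) by auto
    \<comment> \<open>\<open>P\<close> supplies the positive summand for
      \<open>stratifiable_base\<close>. By \<open>D1\<close> it is at most a constant times
      \<open>F\<close>, so adding it preserves comparability.\<close>
    have "stratifiable W \<Omega>' (\<lambda>x. \<Sum>t\<in>S. ennreal (P (base x)) + ennreal (num t x) / ennreal
      (den t x))"
    proof (intro stratifiable_sum finS neS stratifiable_base)
      show "app W \<Omega>' (\<lambda>x. P (base x))" unfolding P_def by (intro app_pw app_sum app_norm lift pc e)
      show "app W \<Omega>' (\<lambda>x. num t x)" for t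
        unfolding num_def by (intro app_pw app_vcoef lift pc e ctr)
      show "app W \<Omega>' (\<lambda>x. den t x)" for t
        unfolding den_def by (intro app_cdenom lift qc ctr rat \<delta>(2) \<delta>0)
      show "0 < P (base x)" if "x \<in> \<Omega>'" for x using that P0 by (auto simp: \<Omega>'_def base_def)
    qed
    then have "stratifiable W \<Omega>' (\<lambda>x. F (base x))"
    proof (rule stratifiable_comparable)
      show "1 \<le> D2 + real (card S) * (D1 + D3)" using D1(1) D2(1) D3(1)
        by (simp add: add_increasing2)
      fix x assume "x \<in> \<Omega>'"
      then obtain b \<alpha> where x: "x = case_sum b \<alpha>" "b \<in> \<Omega>" "splits n (G b) \<alpha>" by (auto simp: \<Omega>'_def)
      have base: "base x = b" by (simp add: base_def x)
      have lead: "coeff (G b) n \<noteq> 0" using lo[OF x(2)] CJ by auto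
      have Groot: "poly (G b) y = 0 \<longleftrightarrow> (\<exists>j\<in>{1..J}. poly (cpoly h N (qc b) j) y = 0)" for y
        unfolding G_def poly_prod by auto
      have small: "cmod (ctr k x) \<le> 1 / 2" for k
      proof (cases "k < n")
        case True
        then have "poly (G b) (\<alpha> k) = 0" using splits_root_iff[OF x(3) lead] by auto
        then obtain j where "j \<in> {1..J}" "poly (cpoly h N (qc b) j) (\<alpha> k) = 0" using Groot by blast
        then show ?thesis using near_monic_cpoly(3)[OF nm[OF x(2)] C h _ J] True
          by (auto simp: ctr_def x)
      qed (simp add: ctr_def)
      have cover: "\<forall>j\<in>{1..J}. \<forall>y. peval N (\<lambda>\<nu>. of_nat h * qc b 1 \<nu> + qc b j \<nu>) y = 0
        \<longrightarrow> y \<in> (\<lambda>k. ctr k x) ` {..n}"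
      proof (intro ballI allI impI)
        fix j y assume "j \<in> {1..J}" "peval N (\<lambda>\<nu>. of_nat h * qc b 1 \<nu> + qc b j \<nu>) y = 0"
        then have "poly (G b) y = 0" using Groot poly_cpoly[of h N "qc b" j y] by auto
        then obtain k where "k < n" "y = \<alpha> k" using splits_root_iff[OF x(3) lead] by auto
        then show "y \<in> (\<lambda>k. ctr k x) ` {..n}" by (intro image_eqI[of _ _ k]) (auto simp: ctr_def x)
      qed
      have "F b \<le> ennreal D2 * (\<Sum>k\<le>n. \<Sum>\<nu>\<le>M. ennreal (num (k, \<nu>) x) / ennreal (den (k, \<nu>) x))"
        unfolding F_def num_def den_def base fst_conv snd_conv
        by (rule D2(2)[OF nm[OF x(2)] _ _ _ cover]) (use small in auto)
      also have "(\<Sum>k\<le>n. \<Sum>\<nu>\<le>M. ennreal (num (k, \<nu>) x) / ennreal (den (k, \<nu>) x))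
        = (\<Sum>t\<in>S. ennreal (num t x) / ennreal (den t x))"
        unfolding S_def by (subst sum.cartesian_product) (auto simp: split_def)
      also have "\<dots> \<le> (\<Sum>t\<in>S. ennreal (P (base x)) + ennreal (num t x) / ennreal (den t x))"
        by (intro sum_mono) auto
      also have "ennreal D2 * \<dots> \<le> ennreal (D2 + real (card S) * (D1 + D3)) * \<dots>"
        using D1(1) D3(1) by (intro mult_right_mono ennreal_leI) auto
      finally show "F (base x) \<le> ennreal (D2 + real (card S) * (D1 + D3)) * (\<Sum>t\<in>S. ennreal (P
        (base x)) + ennreal (num t x) / ennreal (den t x))"
        using base by (simp add: mult_left_mono)
      have "(\<Sum>t\<in>S. ennreal (P (base x)) + ennreal (num t x) / ennreal (den t x))
        \<le> ennreal (real (card S) * (D1 + D3)) * F b"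
      proof (rule sum_le_card_mult[OF finS])
        fix t assume "t \<in> S"
        then have "ennreal (num t x) / ennreal (den t x) \<le> ennreal D3 * F b"
          unfolding F_def num_def den_def base using small
          by (intro D3(2) nm x) (auto simp: S_def)
        then have "ennreal (P b) + ennreal (num t x) / ennreal (den t x)
          \<le> ennreal D1 * F b + ennreal D3 * F b"
          using D1(2)[OF x(2)] by (intro add_mono)
        then show "ennreal (P (base x)) + ennreal (num t x) / ennreal (den t x)
          \<le> ennreal (D1 + D3) * F b"
          using D1(1) D3(1) by (simp add: base ennreal_plus distrib_right)
      qed (use D1(1) D3(1) in auto)
      also have "\<dots> \<le> ennreal (D2 + real (card S) * (D1 + D3)) * F b"
        using D2(1) by (intro mult_right_mono ennreal_leI) auto
      finally show "(\<Sum>t\<in>S. ennreal (P (base x)) + ennreal (num t x) / ennreal (den t x))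
        \<le> ennreal (D2 + real (card S) * (D1 + D3)) * F (base x)"
        by (simp add: base)
    qed
    then have st: "stratifiable (Inl ` V \<union> Inr ` {..<n}) \<Omega>' (\<lambda>x. F (\<lambda>v. x (Inl v)))"
      unfolding base_def W_def .
    show ?thesis by (rule stratifiable_eliminate[OF G rt CJ lo hi _ st]) (auto simp: \<Omega>'_def)
  qed
  then show ?thesis by (simp add: F_def[abs_def])
qed

theorem theorem4:
  fixes \<epsilon> \<delta> :: rat and I J :: nat and M N :: "nat \<Rightarrow> nat" and C :: real
  assumes "\<epsilon> \<ge> 0" and "\<delta> \<ge> 0" and "I \<ge> 1" and "J \<ge> 1" and "C > 0"
    and "\<forall>j k. 1 \<le> j \<longrightarrow> j \<le> k \<longrightarrow> k \<le> J \<longrightarrow> N k \<le> N j"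
    and nondeg: "\<forall>\<nu> l::nat. \<nu> \<le> Max (M ` {1..I}) \<longrightarrow>
                 l \<le> nat (\<lfloor>\<delta>\<rfloor> + 1) * Max (N ` {1..J}) \<longrightarrow>
                 of_nat \<nu> * \<epsilon> + 2 - of_nat l / of_int (\<lfloor>\<delta>\<rfloor> + 1) * \<delta> \<noteq> 0"
  shows "\<exists>s::real. 0 < s \<and> s < 1 \<and>
    (\<exists>(NN::nat) (U :: nat \<Rightarrow> (coord \<Rightarrow> complex) set) (T :: nat \<Rightarrow> coord arp).
       U 0 = paramB I J M N \<and> U NN = {} \<and>
       (\<forall>k<NN. U (Suc k) \<subset> U k) \<and>
       (\<forall>k\<le>NN. \<exists>S. is_variety (coords I J M N) S \<and> U k = paramB I J M N \<inter> S) \<and>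
       (\<forall>k<NN. is_ARP \<int> (coords I J M N) (T k)) \<and>
       (\<forall>k<NN. \<forall>b \<in> U k - U (Suc k). arpK (T k) b \<noteq> 0) \<and>
       (\<exists>c1 c2::real. 0 < c1 \<and> 0 < c2 \<and>
          (\<forall>k<NN. \<forall>b \<in> U k - U (Suc k).
             (\<Sum>\<nu>=0..N 1. cmod (b (Inr (1, \<nu>)) - (if \<nu> = N 1 then 1 else 0))) < s \<longrightarrow>
             (\<forall>j. 1 < j \<and> j \<le> J \<longrightarrow> (\<Sum>\<nu>=0..N j. cmod (b (Inr (j, \<nu>)))) < C) \<longrightarrow>
             ennreal c1 * arp_val (T k) b \<le> (\<integral>\<^sup>+ z \<in> ball 0 1. Rb I J M N \<epsilon> \<delta> b z \<partial>lborel) \<and>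
             (\<integral>\<^sup>+ z \<in> ball 0 1. Rb I J M N \<epsilon> \<delta> b z \<partial>lborel) \<le> ennreal c2 * arp_val (T k) b)) \<and>
       (\<forall>k<NN. U (Suc k) = {b \<in> U k. arpK (T k) b = 0} \<and>
                U (Suc k) = {b \<in> U k. arpK (T k) b = 0 \<and> arpL (T k) b = 0}))"
proof -
  define M' where "M' = Max (M ` {1..I})"
  define N' where "N' = N 1"
  \<comment> \<open>The tolerance of \<open>near_monic\<close> for the common degree
    \<open>N' = N 1\<close>, which bounds every \<open>N j\<close> by monotonicity.\<close>
  define s :: real where "s = (1 / 2) ^ (N' + 2)"
  have "s \<le> (1 / 2) ^ 1" unfolding s_def by (rule power_decreasing) auto
  then have s: "0 < s" "s < 1" by (simp_all add: s_def)
  have M': "M i \<le> M'" if "i \<in> {1..I}" for i unfolding M'_def using that by (intro Max_ge) auto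
  have N': "N j \<le> N'" if "j \<in> {1..J}" for j unfolding N'_def using that assms(6) by auto
  define \<Omega> where "\<Omega> = {b \<in> paramB I J M N.
    (\<Sum>\<nu>=0..N 1. cmod (b (Inr (1, \<nu>)) - (if \<nu> = N 1 then 1 else 0))) < s \<and>
    (\<forall>j. 1 < j \<and> j \<le> J \<longrightarrow> (\<Sum>\<nu>=0..N j. cmod (b (Inr (j, \<nu>)))) < C)}"
  define F where "F b = (\<integral>\<^sup>+ z \<in> ball 0 1. Rb I J M N \<epsilon> \<delta> b z \<partial>lborel)" for b
  have "F = (\<lambda>b. disc_integral (real_of_rat \<epsilon>) (real_of_rat \<delta>) I M' (pcoef M b) J N' (qcoef N b))"
    unfolding F_def using M' N' by (intro ext integral_Rb_eq)
  moreover have "stratifiable (coords I J M N) \<Omega> (\<lambda>b. disc_integral (real_of_rat \<epsilon>)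
    (real_of_rat \<delta>) I M' (pcoef M b) J N' (qcoef N b))"
  proof (rule stratifiable_disc_integral[OF assms(3,4)])
    \<comment> \<open>The bound in \<open>near_monic\<close> includes \<open>Q_1\<close>, whose
      coefficient sum is at most \<open>1 + s < 2\<close>.\<close>
    show "0 < max C 2" by simp
    fix \<nu> l assume \<nu>: "\<nu> \<le> M'" and l: "l \<le> N'"
    define d where "d = nat (\<lfloor>\<delta>\<rfloor> + 1)"
    have d0: "0 < \<lfloor>\<delta>\<rfloor> + 1" using zero_le_floor[THEN iffD2, OF assms(2)] by linarith
    have d: "of_int (\<lfloor>\<delta>\<rfloor> + 1) = (of_nat d :: rat)" "d \<noteq> 0"
      unfolding d_def using of_nat_nat[OF less_imp_le[OF d0], where ?'a = rat] zero_less_nat_eq d0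
        by (simp, linarith)
    have "N' \<le> Max (N ` {1..J})" unfolding N'_def using assms(4) by (intro Max_ge) auto
    \<comment> \<open>Nondegeneracy is applied to \<open>d * l\<close> with
      \<open>d = \<lfloor>\<delta>\<rfloor> + 1\<close>, so that the fraction reduces to the integer
      \<open>l\<close>.\<close>
    then have dl: "d * l \<le> d * Max (N ` {1..J})" using l by (intro mult_le_mono) auto
    have "of_nat \<nu> * \<epsilon> + 2 - of_nat (d * l) / of_int (\<lfloor>\<delta>\<rfloor> + 1) * \<delta> \<noteq> 0"
      by (rule nondeg[rule_format, OF \<nu>[unfolded M'_def] dl[unfolded d_def], folded d_def])
    then have "of_nat \<nu> * \<epsilon> + 2 - of_nat (d * l) / of_nat d * \<delta> \<noteq> 0" unfolding d(1) .
    then have "of_nat \<nu> * \<epsilon> + 2 \<noteq> of_nat l * \<delta>" using d(2) by simp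
    then have "real_of_rat (of_nat \<nu> * \<epsilon> + 2) \<noteq> real_of_rat (of_nat l * \<delta>)"
      unfolding of_rat_eq_iff .
    then show "real \<nu> * real_of_rat \<epsilon> + 2 \<noteq> real l * real_of_rat \<delta>"
      by (simp add: of_rat_add of_rat_mult)
  next
    fix b assume b: "b \<in> \<Omega>"
    have 1: "(\<Sum>\<nu>\<le>N'. cmod (qcoef N b 1 \<nu> - (if \<nu> = N' then 1 else 0))) < s"
      using b by (simp add: \<Omega>_def N'_def qcoef_def atLeast0AtMost)
    have "(\<Sum>\<nu>\<le>N'. cmod (qcoef N b j \<nu>)) \<le> max C 2" if j: "j \<in> {1..J}" for j
    proof (cases "j = 1")
      case True
      have "(\<Sum>\<nu>\<le>N'. cmod (qcoef N b 1 \<nu>)) \<le> (\<Sum>\<nu>\<le>N'. cmod (qcoef N b 1 \<nu> - (if \<nu>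
        = N' then 1 else 0)) + (if \<nu> = N' then 1 else 0))"
      proof (rule sum_mono)
        fix \<nu>
        show "cmod (qcoef N b 1 \<nu>) \<le> cmod (qcoef N b 1 \<nu> - (if \<nu> = N' then 1 else 0)) + (if \<nu>
          = N' then 1 else 0)"
          using norm_triangle_ineq[of "qcoef N b 1 \<nu> - 1" 1] by auto
      qed
      also have "\<dots> \<le> s + 1" using 1 by (simp add: sum.distrib)
      finally show ?thesis using s True by simp
    next
      case False
      have "(\<Sum>\<nu>\<le>N'. cmod (qcoef N b j \<nu>)) = (\<Sum>\<nu>\<in>{0..N j}. cmod (qcoef N b j \<nu>))"
        by (rule sum.mono_neutral_right) (use N'[OF j] in \<open>auto simp: qcoef_def\<close>)
      also have "\<dots> < C" using b j False by (simp add: \<Omega>_def qcoef_def)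
      finally show ?thesis by simp
    qed
    then show "near_monic (max C 2) J N' (qcoef N b)" using 1 unfolding near_monic_def s_def by simp
    obtain i \<mu> where i: "1 \<le> i" "i \<le> I" "\<mu> \<le> M i" "b (Inl (i, \<mu>)) \<noteq> 0"
      using b by (auto simp: \<Omega>_def paramB_def)
    then have pos: "0 < (\<Sum>\<mu>\<le>M'. cmod (pcoef M b i \<mu>))"
      using M'[of i] by (intro sum_pos2[of _ \<mu>]) (auto simp: pcoef_def)
    show "0 < (\<Sum>i=1..I. \<Sum>\<mu>\<le>M'. cmod (pcoef M b i \<mu>))"
      by (rule sum_pos2[of _ i]) (use i pos in \<open>auto intro: sum_nonneg\<close>)
  qed (use assms in \<open>auto intro: pcoef_polyfun qcoef_polyfun\<close>)
  ultimately have "stratifiable (coords I J M N) \<Omega> F" by simp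
  from chain_of_stratifiable[OF this, of "paramB I J M N"]
  obtain NN Us T D where D: "D > 0" and *: "is_chain (coords I J M N) (paramB I J M N) \<Omega> F D
    (paramB I J M N) NN Us T"
    by blast
  have c: "Us 0 = paramB I J M N" "Us NN = {}" "\<forall>k<NN. Us (Suc k) \<subset> Us k"
    "\<forall>k\<le>NN. \<exists>S. is_variety (coords I J M N) S \<and> Us k = paramB I J M N \<inter> S"
      "\<forall>k<NN. is_ARP \<int> (coords I J M N) (T k)"
    "\<forall>k<NN. \<forall>b\<in>Us k - Us (Suc k). arpK (T k) b \<noteq> 0"
    "\<forall>k<NN. \<forall>b\<in>Us k - Us (Suc k). b \<in> \<Omega> \<longrightarrow> comparable D (F b) (arp_val (T k) b)"
    "\<forall>k<NN. Us (Suc k) = {b \<in> Us k. arpK (T k) b = 0} \<and>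
      Us (Suc k) = {b \<in> Us k. arpK (T k) b = 0 \<and> arpL (T k) b = 0}"
    using * unfolding is_chain_def by - (elim conjE, assumption)+
  have mem: "b \<in> \<Omega>" if "k < NN" "b \<in> Us k"
    "(\<Sum>\<nu>=0..N 1. cmod (b (Inr (1, \<nu>)) - (if \<nu> = N 1 then 1 else 0))) < s"
    \<comment> \<open>Every set of the chain lies in the parameter set, so on it the two smallness
      conditions are all that \<open>\<Omega>\<close> asks for.\<close>
    "\<forall>j. 1 < j \<and> j \<le> J \<longrightarrow> (\<Sum>\<nu>=0..N j. cmod (b (Inr (j, \<nu>)))) < C" for k b
  proof -
    have "b \<in> paramB I J M N" using c(4) that(1,2) by (metis IntD1 less_imp_le)
    then show ?thesis using that by (simp add: \<Omega>_def)
  qed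
  show ?thesis
  proof (rule exI[of _ s], intro conjI s, rule exI[of _ NN], rule exI[of _ Us], rule exI[of _ T],
      intro conjI c(1-6,8), rule exI[of _ "1 / D"], rule exI[of _ D], intro conjI allI ballI impI)
    fix k b
    assume k: "k < NN" and b: "b \<in> Us k - Us (Suc k)"
      and 1: "(\<Sum>\<nu>=0..N 1. cmod (b (Inr (1, \<nu>)) - (if \<nu> = N 1 then 1 else 0))) < s"
      and 2: "\<forall>j. 1 < j \<and> j \<le> J \<longrightarrow> (\<Sum>\<nu>=0..N j. cmod (b (Inr (j, \<nu>)))) < C"
    have "b \<in> \<Omega>" using mem[OF k _ 1 2] b by blast
    then have "comparable D (F b) (arp_val (T k) b)" using c(7) k b by blast
    then have "ennreal (1 / D) * arp_val (T k) b \<le> F b" "F b \<le> ennreal D * arp_val (T k) b"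
      using D by (auto intro: comparable_ge simp: comparable_def)
    then show "ennreal (1 / D) * arp_val (T k) b \<le> (\<integral>\<^sup>+ z \<in> ball 0 1. Rb I J M N \<epsilon> \<delta> b z \<partial>lborel)"
      "(\<integral>\<^sup>+ z \<in> ball 0 1. Rb I J M N \<epsilon> \<delta> b z \<partial>lborel) \<le> ennreal D * arp_val (T k) b"
      by (simp_all add: F_def)
  qed (use D in auto)
qed

end
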